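(* Let $(\mathfrak g,[-,-]_{\mathfrak g})$ be a Leibniz algebra with Leibniz kernel $K$, let $L_{\mathfrak g}=(K[1]\hookrightarrow\mathfrak g,[-,-]_{\mathfrak g},h_2)$ be the associated hemistrict Lie 2-algebra, let $\mathcal G=(K[1]\hookrightarrow\mathfrak g,\tilde l_2,\tilde l_3)$ be the semistrict Lie 2-algebra obtained by skew-symmetrization, and let $\mathfrak g_{\mathrm{Lie}}=\mathfrak g/K$. Let $V=(\vec V,l,r,h_v)$ be a representation of $L_{\mathfrak g}$ such that $l_\alpha=0$ for all $\alpha\in K[1]$ (the degree $-1$ part of $L_{\mathfrak g}$). Then $$H^\bullet(L_{\mathfrak g},V)\cong H^\bullet(\mathcal G,V)\cong H^\bullet_{\mathrm{CE}}(\mathfrak g_{\mathrm{Lie}},V).$$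
   Context: All vector spaces are over $\mathbb K=\mathbb R$ or $\mathbb C$. 2-term cochain complexes sit in degrees $-1,0$; $|x|$ is the degree of $x$. **Leibniz algebra**: a vector space $\mathfrak g$ with a bilinear bracket satisfying $[x,[y,z]]=[[x,y],z]+[y,[x,z]]$. Its Leibniz kernel is $K=\mathrm{span}\{[x,y]+[y,x]\mid x,y\in\mathfrak g\}$; it is an ideal with $[K,\mathfrak g]=0$, and $\mathfrak g_{\mathrm{Lie}}=\mathfrak g/K$ is a Lie algebra. **Hemistrict Lie 2-algebra** $L=(\vec L,[-,-],h_2)$: a 2-term complex $\vec L=(L^{-1}\xrightarrow dL^0)$, a degree-$0$ bilinear bracket on $L^\bullet$ (zero on $L^{-1}\times L^{-1}$) with $d[x,y]=[dx,y]+(-1)^{|x|}[x,dy]$ and $[x,[y,z]]=[[x,y],z]+(-1)^{|x||y|}[y,[x,z]]$, and a symmetric bilinear map $h_2:L^0\times L^0\to L^{-1}$ such that $[x,y]+[y,x]=dh_2(x,y)$, $[x,\alpha]+[\alpha,x]=h_2(x,d\alpha)$, $[h_2(x,y),z]=0$, $[x,h_2(y,z)]=h_2([x,y],z)+h_2(y,[x,z])$ for $x,y,z\in L^0,\alpha\in L^{-1}$. **$L_{\mathfrak g}$**: $L^{-1}=K[1]$ (a copy of $K$ in degree $-1$), $L^0=\mathfrak g$, $d$ the inclusion, brackets induced by $[-,-]_{\mathfrak g}$, and $h_2(x,y)=[x,y]_{\mathfrak g}+[y,x]_{\mathfrak g}$ regarded in $K[1]$. **$\mathcal G$**: same complex,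 with $\tilde l_2(x,y)=\frac12([x,y]_{\mathfrak g}-[y,x]_{\mathfrak g})$, $\tilde l_2(x,\alpha)=-\tilde l_2(\alpha,x)=\frac12[x,\alpha]_{\mathfrak g}$ and $\tilde l_3(x,y,z)=-\frac1{12}\big(h_2([x,y]_{\mathfrak g}-[y,x]_{\mathfrak g},z)+h_2([y,z]_{\mathfrak g}-[z,y]_{\mathfrak g},x)+h_2([z,x]_{\mathfrak g}-[x,z]_{\mathfrak g},y)\big)$ for $x,y,z\in\mathfrak g,\alpha\in K[1]$. **Representation** $V=(\vec V,l,r,h_v)$ of a hemistrict Lie 2-algebra $L$ on a 2-term complex $\vec V=(V^{-1}\xrightarrow dV^0)$: cochain maps $l:L^i\otimes V^j\to V^{i+j}$, $r:V^j\otimes L^i\to V^{i+j}$ ($V^{-2}=0$) and a bilinear map $h_v:L^0\times V^0\to V^{-1}$. Write $l_xv=l(x,v)$, $r_xv=(-1)^{|x||v|}r(v,x)$. Required: $l_{[x_1,x_2]}=l_{x_1}l_{x_2}-(-1)^{|x_1||x_2|}l_{x_2}l_{x_1}$; $l(x,v)+r(v,x)$ equals $dh_v(x,v)$ if $x\in L^0,v\in V^0$, equals $h_v(dx,v)$ if $x\in L^{-1},v\in V^0$, and equals $h_v(x,dv)$ if $x\in L^0,v\in V^{-1}$; and for $x_1,x_2\in L^0,v\in V^0$: $r_{x_2}h_v(x_1,v)=0$, $l_{h_2(x_1,x_2)}v=0$, $l_{x_1}h_v(x_2,v)=h_v([x_1,x_2],v)+h_v(x_2,l_{x_1}v)$.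 Below $L=L_{\mathfrak g}$ and $l_\alpha=0$ for $\alpha\in L^{-1}$, so that $l$ induces actions of $\mathfrak g_{\mathrm{Lie}}$ and of $\mathcal G$ on $\vec V$. Put $\epsilon_0=1$, $\epsilon_{-1}=0$. **$H^\bullet(L,V)$** (the general definition of $D$ contains one further term, linear in the $l_{\alpha_j}$, which vanishes here). For $n\ge -1$, $C^n(L,V)$ is the space of families $\omega=(\omega^{(p)}_k)$, $p\in\{-1,0\}$, $0\le k\le\lfloor\frac{n-p}{2}\rfloor$, of linear maps $\omega_k^{(p)}:(L^0)^{\otimes(n-p-2k)}\otimes S^k(L^{-1})\to V^p$ ($S^k$ the ordinary symmetric power) with $$\omega_k^{(p)}(\cdots,x_i,x_{i+1},\cdots\mid\cdots)+\omega_k^{(p)}(\cdots,x_{i+1},x_i,\cdots\mid\cdots)=-\omega_{k+1}^{(p)}(\cdots,\widehat{x_i},\widehat{x_{i+1}},\cdots\mid h_2(x_i,x_{i+1}),\cdots)$$ for $1\le i\le n-p-2k-1$. The differential $D:C^n\to C^{n+1}$ is, with $m=n+1-p-2k$, $$(D\omega)_k^{(p)}(x_1,\dots,x_m\mid\alpha_1,\dots,\alpha_k)=\sum_{j}\omega^{(p)}_{k-1}(d\alpha_j,x_1,\dots,x_m\mid\cdots\widehat{\alpha_j}\cdots)+\epsilon_p(-1)^{n+1}d\,\omega_k^{(-1)}(x_1,\dots,x_m\mid\alpha_1,\dots,\alpha_k)$$ $$+\sum_i(-1)^{i-1}l_{x_i}\omega_k^{(p)}(\cdots\widehat{x_i}\cdots\mid\cdots)+\sum_{i<j}(-1)^i\omega_k^{(p)}(\cdots,\widehat{x_i},\cdots,\widehat{x_j},[x_i,x_j],\cdots\mid\cdots)+\sum_{i,j}(-1)^{i+1}\omega_k^{(p)}(\cdots\widehat{x_i}\cdots\mid\cdots,[\alpha_j,x_i],\cdots),$$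 where $[x_i,x_j]$ (resp. $[\alpha_j,x_i]$) takes the place of $x_j$ (resp. $\alpha_j$). $H^\bullet(L,V)$ is its cohomology. **$H^\bullet_{\mathrm{CE}}(\mathfrak g_{\mathrm{Lie}},V)$**: cohomology of the total complex $\bigoplus_{p+r=n}\mathrm{Hom}(\wedge^p\mathfrak g_{\mathrm{Lie}},V^r)$ ($p\ge0$, $r\in\{-1,0\}$) with differential $d_V+d_{\mathrm{CE}}$, $d_V\eta=(-1)^{n+1}d\circ\eta$ on total degree $n$, $d_{\mathrm{CE}}$ the Chevalley-Eilenberg differential. **$H^\bullet(\mathcal G,V)$**: cohomology of $A^n=\bigoplus_{p+2q+r=n}\mathrm{Hom}(\wedge^pL^0\otimes S^q(L^{-1}),V^r)$ ($p,q\ge0$, $r\in\{-1,0\}$) with, for $\eta\in A^n$ and $m=n+1-r-2q$, $$(D_A\eta)^{(r)}_q(x_1,\dots,x_m\mid\alpha_1,\dots,\alpha_q)=\epsilon_r(-1)^{n+1}d\,\eta_q^{(-1)}(x_1,\dots,x_m\mid\alpha_1,\dots,\alpha_q)+\sum_j\eta_{q-1}^{(r)}(d\alpha_j,x_1,\dots,x_m\mid\cdots\widehat{\alpha_j}\cdots)$$ $$+\sum_i(-1)^{i-1}l_{x_i}\eta_q^{(r)}(\cdots\widehat{x_i}\cdots\mid\cdots)+\sum_{i<j}(-1)^{i+j}\eta_q^{(r)}(\tilde l_2(x_i,x_j),\cdots\widehat{x_i}\cdots\widehat{x_j}\cdots\mid\cdots)+\sum_{i,j}(-1)^{i+1}\eta_q^{(r)}(\cdots\widehat{x_i}\cdots\mid\cdots,\tilde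 l_2(\alpha_j,x_i),\cdots)$$ $$+\sum_{i<j<k}(-1)^{i+j+k}\eta_{q+1}^{(r)}(\cdots\widehat{x_i}\cdots\widehat{x_j}\cdots\widehat{x_k}\cdots\mid\tilde l_3(x_i,x_j,x_k),\alpha_1,\dots,\alpha_q).$$ *)

theory Defs
  imports
    Complex_Main
    "HOL-Library.Function_Algebras"
    "HOL-Library.Multiset"
    "HOL-Library.Product_Plus"
    "HOL-Library.Set_Algebras"
begin

section \<open>Linear algebra on subspaces and on quotients\<close>

text \<open>
  The definitions make sense over any field. The ground fields \<open>\<real>\<close> and \<open>\<complex>\<close> together are captured by
  the class \<^class>\<open>real_normed_field\<close>: by the Gelfand-Mazur theorem they are, up to isomorphism, its
  only instances.

  A vector space is a type with a \<^locale>\<open>vector_space\<close> structure, a subspace of such a type, or a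
  quotient of such a subspace, i.e. a set of cosets. On cosets, addition is the Minkowski sum
  \<open>X + Y\<close> of \<^theory>\<open>HOL-Library.Set_Algebras\<close>, so the definitions below only require
  \<^class>\<open>plus\<close> on the domain.
\<close>

definition linear_on ::
    "'a::plus set \<Rightarrow> ('k \<Rightarrow> 'a \<Rightarrow> 'a) \<Rightarrow> ('k \<Rightarrow> 'b::plus \<Rightarrow> 'b) \<Rightarrow> ('a \<Rightarrow> 'b) \<Rightarrow> bool" where
  "linear_on A sA sB f \<longleftrightarrow>
     (\<forall>x\<in>A. \<forall>y\<in>A. f (x + y) = f x + f y) \<and> (\<forall>c. \<forall>x\<in>A. f (sA c x) = sB c (f x))"

definition bilinear_on ::
    "'a::plus set \<Rightarrow> ('k \<Rightarrow> 'a \<Rightarrow> 'a) \<Rightarrow> 'b::plus set \<Rightarrow> ('k \<Rightarrow> 'b \<Rightarrow> 'b) \<Rightarrow>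
     'c::plus set \<Rightarrow> ('k \<Rightarrow> 'c \<Rightarrow> 'c) \<Rightarrow> ('a \<Rightarrow> 'b \<Rightarrow> 'c) \<Rightarrow> bool" where
  "bilinear_on A sA B sB C sC f \<longleftrightarrow>
     (\<forall>x\<in>A. \<forall>y\<in>B. f x y \<in> C) \<and>
     (\<forall>x\<in>A. linear_on B sB sC (f x)) \<and> (\<forall>y\<in>B. linear_on A sA sC (\<lambda>x. f x y))"

text \<open>
  The zero coset is \<open>W\<close>, so \<open>c \<cdot> (x + W)\<close> has to be \<open>s c x + W\<close> also for \<open>c = 0\<close>; hence the
  additional summand \<open>W\<close>.
\<close>

definition quotient_space :: "'a::plus set \<Rightarrow> 'a set \<Rightarrow> 'a set set" where
  "quotient_space Z W = (\<lambda>z. z +o W) ` Z"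

definition quotient_scale :: "('k \<Rightarrow> 'a \<Rightarrow> 'a) \<Rightarrow> 'a::plus set \<Rightarrow> 'k \<Rightarrow> 'a set \<Rightarrow> 'a set" where
  "quotient_scale s W c X = s c ` X + W"

text \<open>
  Linear maps out of \<open>A\<^sup>\<otimes>\<^sup>m \<otimes> S\<^sup>k B\<close> are multilinear functions of a list \<open>xs\<close> of length \<open>m\<close> over \<open>A\<close> and
  a list \<open>as\<close> of length \<open>k\<close> over \<open>B\<close> that are symmetric in \<open>as\<close>. They are extended by zero
  outside that domain, so that equality of maps is equality of functions. The arity \<open>m\<close> is an
  integer; the space is zero if \<open>m < 0\<close>.
\<close>

definition multi_dom :: "'a set \<Rightarrow> 'b set \<Rightarrow> int \<Rightarrow> nat \<Rightarrow> 'a list \<Rightarrow> 'b list \<Rightarrow> bool" where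
  "multi_dom A B m k xs as \<longleftrightarrow>
     int (length xs) = m \<and> set xs \<subseteq> A \<and> length as = k \<and> set as \<subseteq> B"

definition Hom_tensor_sym ::
    "'a::plus set \<Rightarrow> ('k \<Rightarrow> 'a \<Rightarrow> 'a) \<Rightarrow> 'b::plus set \<Rightarrow> ('k \<Rightarrow> 'b \<Rightarrow> 'b) \<Rightarrow>
     ('k \<Rightarrow> 'v \<Rightarrow> 'v) \<Rightarrow> int \<Rightarrow> nat \<Rightarrow> ('a list \<Rightarrow> 'b list \<Rightarrow> 'v::ab_group_add) set" where
  "Hom_tensor_sym A sA B sB sV m k = {f.
     (\<forall>xs as. \<not> multi_dom A B m k xs as \<longrightarrow> f xs as = 0) \<and>
     (\<forall>xs as. multi_dom A B m k xs as \<longrightarrow>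
        (\<forall>i<length xs. linear_on A sA sV (\<lambda>x. f (xs[i := x]) as)) \<and>
        (\<forall>j<length as. linear_on B sB sV (\<lambda>\<alpha>. f xs (as[j := \<alpha>]))) \<and>
        (\<forall>bs. mset bs = mset as \<longrightarrow> f xs bs = f xs as))}"

definition Hom_wedge_sym ::
    "'a::plus set \<Rightarrow> ('k \<Rightarrow> 'a \<Rightarrow> 'a) \<Rightarrow> 'b::plus set \<Rightarrow> ('k \<Rightarrow> 'b \<Rightarrow> 'b) \<Rightarrow>
     ('k \<Rightarrow> 'v \<Rightarrow> 'v) \<Rightarrow> int \<Rightarrow> nat \<Rightarrow> ('a list \<Rightarrow> 'b list \<Rightarrow> 'v::ab_group_add) set" where
  "Hom_wedge_sym A sA B sB sV m k =
     {f \<in> Hom_tensor_sym A sA B sB sV m k. \<forall>xs as. \<not> distinct xs \<longrightarrow> f xs as = 0}"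

definition Hom_wedge ::
    "'a::plus set \<Rightarrow> ('k \<Rightarrow> 'a \<Rightarrow> 'a) \<Rightarrow> ('k \<Rightarrow> 'v \<Rightarrow> 'v) \<Rightarrow> int \<Rightarrow> ('a list \<Rightarrow> 'v::ab_group_add) set" where
  "Hom_wedge A sA sV m = {f.
     (\<forall>xs. \<not> (int (length xs) = m \<and> set xs \<subseteq> A) \<longrightarrow> f xs = 0) \<and>
     (\<forall>xs. int (length xs) = m \<and> set xs \<subseteq> A \<longrightarrow>
        (\<forall>i<length xs. linear_on A sA sV (\<lambda>x. f (xs[i := x])))) \<and>
     (\<forall>xs. \<not> distinct xs \<longrightarrow> f xs = 0)}"

definition omit :: "nat set \<Rightarrow> 'a list \<Rightarrow> 'a list" where
  "omit I xs = nths xs (- I)"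


section \<open>Cochain complexes and their cohomology\<close>

record ('k, 'c) cochain_complex =
  cscale :: "'k \<Rightarrow> 'c \<Rightarrow> 'c"
  cspace :: "int \<Rightarrow> 'c set"
  cdiff  :: "int \<Rightarrow> 'c \<Rightarrow> 'c"    \<comment> \<open>\<open>cdiff X n\<close> maps degree \<open>n\<close> to degree \<open>n + 1\<close>\<close>

definition cocycles :: "('k, 'c::ab_group_add) cochain_complex \<Rightarrow> int \<Rightarrow> 'c set" where
  "cocycles X n = {\<omega> \<in> cspace X n. cdiff X n \<omega> = 0}"

definition coboundaries :: "('k, 'c::ab_group_add) cochain_complex \<Rightarrow> int \<Rightarrow> 'c set" where
  "coboundaries X n = cdiff X (n - 1) ` cspace X (n - 1)"

definition cohomology :: "('k, 'c::ab_group_add) cochain_complex \<Rightarrow> int \<Rightarrow> 'c set set" where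
  "cohomology X n = quotient_space (cocycles X n) (coboundaries X n)"

definition cohomology_scale ::
    "('k, 'c::ab_group_add) cochain_complex \<Rightarrow> int \<Rightarrow> 'k \<Rightarrow> 'c set \<Rightarrow> 'c set" where
  "cohomology_scale X n = quotient_scale (cscale X) (coboundaries X n)"

definition cohomology_isomorphic ::
    "('k, 'c::ab_group_add) cochain_complex \<Rightarrow> ('k, 'e::ab_group_add) cochain_complex \<Rightarrow> bool" where
  "cohomology_isomorphic X Y \<longleftrightarrow>
     (\<forall>n. \<exists>\<phi>. bij_betw \<phi> (cohomology X n) (cohomology Y n) \<and>
              linear_on (cohomology X n) (cohomology_scale X n) (cohomology_scale Y n) \<phi>)"


section \<open>Hemistrict Lie 2-algebras and their representations\<close>

text \<open>
  The parts \<open>L\<^sup>0\<close> and \<open>L\<^sup>-\<^sup>1\<close> are subspaces \<open>spc0\<close>, \<open>spc1\<close> of two ambient vector spaces. In the names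
  of structure maps, the suffix lists the degrees of the arguments, with \<open>m\<close> for \<open>-1\<close>.
\<close>

record ('k, 'a, 'b) two_term =
  scl0 :: "'k \<Rightarrow> 'a \<Rightarrow> 'a"
  scl1 :: "'k \<Rightarrow> 'b \<Rightarrow> 'b"
  spc0 :: "'a set"
  spc1 :: "'b set"
  dL :: "'b \<Rightarrow> 'a"

record ('k, 'a, 'b) hemistrict = "('k, 'a, 'b) two_term" +
  br_00 :: "'a \<Rightarrow> 'a \<Rightarrow> 'a"
  br_0m :: "'a \<Rightarrow> 'b \<Rightarrow> 'b"
  br_m0 :: "'b \<Rightarrow> 'a \<Rightarrow> 'b"
  h2 :: "'a \<Rightarrow> 'a \<Rightarrow> 'b"

locale two_term_complex =
  fixes L :: "('k::field, 'a::ab_group_add, 'b::ab_group_add, 'z) two_term_scheme"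
  assumes vs0: "vector_space (scl0 L)" and vs1: "vector_space (scl1 L)"
    and sub0: "module.subspace (scl0 L) (spc0 L)" and sub1: "module.subspace (scl1 L) (spc1 L)"
    and d_in: "\<alpha> \<in> spc1 L \<Longrightarrow> dL L \<alpha> \<in> spc0 L"
    and d_linear: "linear_on (spc1 L) (scl1 L) (scl0 L) (dL L)"

locale hemistrict_lie2 = two_term_complex L
  for L :: "('k::field, 'a::ab_group_add, 'b::ab_group_add, 'z) hemistrict_scheme" +
  assumes bil_00: "bilinear_on (spc0 L) (scl0 L) (spc0 L) (scl0 L) (spc0 L) (scl0 L) (br_00 L)"
    and bil_0m: "bilinear_on (spc0 L) (scl0 L) (spc1 L) (scl1 L) (spc1 L) (scl1 L) (br_0m L)"
    and bil_m0: "bilinear_on (spc1 L) (scl1 L) (spc0 L) (scl0 L) (spc1 L) (scl1 L) (br_m0 L)"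
    and bil_h2: "bilinear_on (spc0 L) (scl0 L) (spc0 L) (scl0 L) (spc1 L) (scl1 L) (h2 L)"
    and d_br_0m: "\<lbrakk>x \<in> spc0 L; \<alpha> \<in> spc1 L\<rbrakk> \<Longrightarrow> dL L (br_0m L x \<alpha>) = br_00 L x (dL L \<alpha>)"
    and d_br_m0: "\<lbrakk>x \<in> spc0 L; \<alpha> \<in> spc1 L\<rbrakk> \<Longrightarrow> dL L (br_m0 L \<alpha> x) = br_00 L (dL L \<alpha>) x"
    and d_br_mm: "\<lbrakk>\<alpha> \<in> spc1 L; \<beta> \<in> spc1 L\<rbrakk> \<Longrightarrow> 0 = br_0m L (dL L \<alpha>) \<beta> - br_m0 L \<alpha> (dL L \<beta>)"
    and leibniz_000: "\<lbrakk>x \<in> spc0 L; y \<in> spc0 L; z \<in> spc0 L\<rbrakk> \<Longrightarrow>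
      br_00 L x (br_00 L y z) = br_00 L (br_00 L x y) z + br_00 L y (br_00 L x z)"
    and leibniz_00m: "\<lbrakk>x \<in> spc0 L; y \<in> spc0 L; \<alpha> \<in> spc1 L\<rbrakk> \<Longrightarrow>
      br_0m L x (br_0m L y \<alpha>) = br_0m L (br_00 L x y) \<alpha> + br_0m L y (br_0m L x \<alpha>)"
    and leibniz_0m0: "\<lbrakk>x \<in> spc0 L; \<alpha> \<in> spc1 L; z \<in> spc0 L\<rbrakk> \<Longrightarrow>
      br_0m L x (br_m0 L \<alpha> z) = br_m0 L (br_0m L x \<alpha>) z + br_m0 L \<alpha> (br_00 L x z)"
    and leibniz_m00: "\<lbrakk>\<alpha> \<in> spc1 L; y \<in> spc0 L; z \<in> spc0 L\<rbrakk> \<Longrightarrow>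
      br_m0 L \<alpha> (br_00 L y z) = br_m0 L (br_m0 L \<alpha> y) z + br_0m L y (br_m0 L \<alpha> z)"
    and h2_sym: "\<lbrakk>x \<in> spc0 L; y \<in> spc0 L\<rbrakk> \<Longrightarrow> h2 L x y = h2 L y x"
    and h2_00: "\<lbrakk>x \<in> spc0 L; y \<in> spc0 L\<rbrakk> \<Longrightarrow> br_00 L x y + br_00 L y x = dL L (h2 L x y)"
    and h2_0m: "\<lbrakk>x \<in> spc0 L; \<alpha> \<in> spc1 L\<rbrakk> \<Longrightarrow> br_0m L x \<alpha> + br_m0 L \<alpha> x = h2 L x (dL L \<alpha>)"
    and br_h2_left: "\<lbrakk>x \<in> spc0 L; y \<in> spc0 L; z \<in> spc0 L\<rbrakk> \<Longrightarrow> br_m0 L (h2 L x y) z = 0"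
    and br_h2_right: "\<lbrakk>x \<in> spc0 L; y \<in> spc0 L; z \<in> spc0 L\<rbrakk> \<Longrightarrow>
      br_0m L x (h2 L y z) = h2 L (br_00 L x y) z + h2 L y (br_00 L x z)"

text \<open>
  The complex \<open>V\<^sup>-\<^sup>1 \<rightarrow> V\<^sup>0\<close> is \<open>dV :: 'v \<Rightarrow> 'w\<close>. The maps \<open>lact_ij\<close> take arguments in \<open>L\<^sup>i \<otimes> V\<^sup>j\<close>, the
  maps \<open>ract_ji\<close> take arguments in \<open>V\<^sup>j \<otimes> L\<^sup>i\<close>; the components with values in \<open>V\<^sup>-\<^sup>2 = 0\<close> do not
  appear.
\<close>

record ('k, 'a, 'b, 'v, 'w) rep2 =
  sclV1 :: "'k \<Rightarrow> 'v \<Rightarrow> 'v"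
  sclV0 :: "'k \<Rightarrow> 'w \<Rightarrow> 'w"
  dV :: "'v \<Rightarrow> 'w"
  lact_00 :: "'a \<Rightarrow> 'w \<Rightarrow> 'w"
  lact_0m :: "'a \<Rightarrow> 'v \<Rightarrow> 'v"
  lact_m0 :: "'b \<Rightarrow> 'w \<Rightarrow> 'v"
  ract_00 :: "'w \<Rightarrow> 'a \<Rightarrow> 'w"
  ract_m0 :: "'v \<Rightarrow> 'a \<Rightarrow> 'v"
  ract_0m :: "'w \<Rightarrow> 'b \<Rightarrow> 'v"
  hV :: "'a \<Rightarrow> 'w \<Rightarrow> 'v"

locale hemistrict_rep = hemistrict_lie2 L
  for L :: "('k::field, 'a::ab_group_add, 'b::ab_group_add, 'z) hemistrict_scheme" +
  fixes V :: "('k, 'a, 'b, 'v::ab_group_add, 'w::ab_group_add) rep2"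
  assumes dV_linear: "Vector_Spaces.linear (sclV1 V) (sclV0 V) (dV V)"
    and bil_l00: "bilinear_on (spc0 L) (scl0 L) UNIV (sclV0 V) UNIV (sclV0 V) (lact_00 V)"
    and bil_l0m: "bilinear_on (spc0 L) (scl0 L) UNIV (sclV1 V) UNIV (sclV1 V) (lact_0m V)"
    and bil_lm0: "bilinear_on (spc1 L) (scl1 L) UNIV (sclV0 V) UNIV (sclV1 V) (lact_m0 V)"
    and bil_r00: "bilinear_on UNIV (sclV0 V) (spc0 L) (scl0 L) UNIV (sclV0 V) (ract_00 V)"
    and bil_rm0: "bilinear_on UNIV (sclV1 V) (spc0 L) (scl0 L) UNIV (sclV1 V) (ract_m0 V)"
    and bil_r0m: "bilinear_on UNIV (sclV0 V) (spc1 L) (scl1 L) UNIV (sclV1 V) (ract_0m V)"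
    and bil_hV: "bilinear_on (spc0 L) (scl0 L) UNIV (sclV0 V) UNIV (sclV1 V) (hV V)"
    \<comment> \<open>\<open>l\<close> and \<open>r\<close> are cochain maps; the last equation of each group is the one in degree \<open>-2\<close>\<close>
    and d_l0m: "x \<in> spc0 L \<Longrightarrow> dV V (lact_0m V x v) = lact_00 V x (dV V v)"
    and d_lm0: "\<alpha> \<in> spc1 L \<Longrightarrow> dV V (lact_m0 V \<alpha> u) = lact_00 V (dL L \<alpha>) u"
    and d_lmm: "\<alpha> \<in> spc1 L \<Longrightarrow> 0 = lact_0m V (dL L \<alpha>) v - lact_m0 V \<alpha> (dV V v)"
    and d_rm0: "x \<in> spc0 L \<Longrightarrow> dV V (ract_m0 V v x) = ract_00 V (dV V v) x"
    and d_r0m: "\<alpha> \<in> spc1 L \<Longrightarrow> dV V (ract_0m V u \<alpha>) = ract_00 V u (dL L \<alpha>)"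
    and d_rmm: "\<alpha> \<in> spc1 L \<Longrightarrow> 0 = ract_0m V (dV V v) \<alpha> - ract_m0 V v (dL L \<alpha>)"
    \<comment> \<open>\<open>l\<close> is compatible with the bracket\<close>
    and l_br_00_0: "\<lbrakk>x \<in> spc0 L; y \<in> spc0 L\<rbrakk> \<Longrightarrow>
      lact_00 V (br_00 L x y) u = lact_00 V x (lact_00 V y u) - lact_00 V y (lact_00 V x u)"
    and l_br_00_m: "\<lbrakk>x \<in> spc0 L; y \<in> spc0 L\<rbrakk> \<Longrightarrow>
      lact_0m V (br_00 L x y) v = lact_0m V x (lact_0m V y v) - lact_0m V y (lact_0m V x v)"
    and l_br_0m_0: "\<lbrakk>x \<in> spc0 L; \<alpha> \<in> spc1 L\<rbrakk> \<Longrightarrow>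
      lact_m0 V (br_0m L x \<alpha>) u = lact_0m V x (lact_m0 V \<alpha> u) - lact_m0 V \<alpha> (lact_00 V x u)"
    and l_br_m0_0: "\<lbrakk>x \<in> spc0 L; \<alpha> \<in> spc1 L\<rbrakk> \<Longrightarrow>
      lact_m0 V (br_m0 L \<alpha> x) u = lact_m0 V \<alpha> (lact_00 V x u) - lact_0m V x (lact_m0 V \<alpha> u)"
    \<comment> \<open>\<open>hV\<close> controls the failure of \<open>r = - l\<close>\<close>
    and hV_00: "x \<in> spc0 L \<Longrightarrow> lact_00 V x u + ract_00 V u x = dV V (hV V x u)"
    and hV_m0: "\<alpha> \<in> spc1 L \<Longrightarrow> lact_m0 V \<alpha> u + ract_0m V u \<alpha> = hV V (dL L \<alpha>) u"
    and hV_0m: "x \<in> spc0 L \<Longrightarrow> lact_0m V x v + ract_m0 V v x = hV V x (dV V v)"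
    and r_hV: "\<lbrakk>x \<in> spc0 L; y \<in> spc0 L\<rbrakk> \<Longrightarrow> ract_m0 V (hV V x u) y = 0"
    and l_h2: "\<lbrakk>x \<in> spc0 L; y \<in> spc0 L\<rbrakk> \<Longrightarrow> lact_m0 V (h2 L x y) u = 0"
    and l_hV: "\<lbrakk>x \<in> spc0 L; y \<in> spc0 L\<rbrakk> \<Longrightarrow>
      lact_0m V x (hV V y u) = hV V (br_00 L x y) u + hV V y (lact_00 V x u)"


section \<open>The complex of a hemistrict Lie 2-algebra\<close>

text \<open>
  A cochain \<open>\<omega>\<close> is the pair \<open>(\<omega>\<^sup>(\<^sup>-\<^sup>1\<^sup>), \<omega>\<^sup>(\<^sup>0\<^sup>))\<close>, each component being a family indexed by \<open>k\<close>.
\<close>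

type_synonym ('a, 'b, 'v) family = "nat \<Rightarrow> 'a list \<Rightarrow> 'b list \<Rightarrow> 'v"
type_synonym ('a, 'b, 'v, 'w) cochain = "('a, 'b, 'v) family \<times> ('a, 'b, 'w) family"

definition cochain_scale ::
    "('k, 'a, 'b, 'v, 'w) rep2 \<Rightarrow> 'k \<Rightarrow> ('a, 'b, 'v, 'w) cochain \<Rightarrow> ('a, 'b, 'v, 'w) cochain" where
  "cochain_scale V c \<omega> =
     (\<lambda>k xs as. sclV1 V c (fst \<omega> k xs as), \<lambda>k xs as. sclV0 V c (snd \<omega> k xs as))"

text \<open>
  The symmetry condition relating \<open>\<omega>\<^sub>k\<close> and \<open>\<omega>\<^sub>k\<^sub>+\<^sub>1\<close>; positions in lists are counted from 0. For values
  in \<open>V\<^sup>p\<close> and total degree \<open>n\<close>, the integer \<open>N\<close> is \<open>n - p\<close>.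
\<close>

definition h2_skew ::
    "('k, 'a, 'b, 'z) hemistrict_scheme \<Rightarrow> int \<Rightarrow> ('a, 'b, 'v::ab_group_add) family \<Rightarrow> bool" where
  "h2_skew L N f \<longleftrightarrow>
     (\<forall>k xs as i. multi_dom (spc0 L) (spc1 L) (N - 2 * int k) k xs as \<and> Suc i < length xs \<longrightarrow>
        f k xs as + f k (xs[i := xs ! Suc i, Suc i := xs ! i]) as =
        - f (Suc k) (omit {i, Suc i} xs) (h2 L (xs ! i) (xs ! Suc i) # as))"

definition hemi_component ::
    "('k, 'a::plus, 'b::plus, 'z) hemistrict_scheme \<Rightarrow> ('k \<Rightarrow> 'v \<Rightarrow> 'v) \<Rightarrow> int \<Rightarrow>
     ('a, 'b, 'v::ab_group_add) family set" where
  "hemi_component L sV N = {f.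
     (\<forall>k. f k \<in> Hom_tensor_sym (spc0 L) (scl0 L) (spc1 L) (scl1 L) sV (N - 2 * int k) k) \<and>
     h2_skew L N f}"

definition hemi_cochains ::
    "('k, 'a::plus, 'b::plus, 'z) hemistrict_scheme \<Rightarrow>
     ('k, 'a, 'b, 'v::ab_group_add, 'w::ab_group_add) rep2 \<Rightarrow> int \<Rightarrow>
     ('a, 'b, 'v, 'w) cochain set" where
  "hemi_cochains L V n =
     hemi_component L (sclV1 V) (n + 1) \<times> hemi_component L (sclV0 V) n"

text \<open>
  The part of \<open>D\<close> that does not involve \<open>dV\<close>, for one component of \<open>\<omega>\<close>, with \<open>\<rho>\<close> the action of \<open>L\<^sup>0\<close>
  on the values. This is the specialization of the general differential to representations with
  \<open>l\<^sub>\<alpha> = 0\<close> for \<open>\<alpha>\<close> in \<open>L\<^sup>-\<^sup>1\<close>: in general there is one further term linear in the \<open>l\<^sub>\<alpha>\<close>.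
  The signs are those of the formula with indices from 1, shifted to indices from 0.
\<close>

definition hemi_diff_part ::
    "('k::field, 'a, 'b, 'z) hemistrict_scheme \<Rightarrow> ('k \<Rightarrow> 'v \<Rightarrow> 'v) \<Rightarrow> ('a \<Rightarrow> 'v \<Rightarrow> 'v) \<Rightarrow>
     ('a, 'b, 'v::ab_group_add) family \<Rightarrow> ('a, 'b, 'v) family" where
  "hemi_diff_part L sV \<rho> f k xs as =
     (\<Sum>j<length as. f (k - 1) (dL L (as ! j) # xs) (omit {j} as)) +
     (\<Sum>i<length xs. sV ((-1) ^ i) (\<rho> (xs ! i) (f k (omit {i} xs) as))) +
     (\<Sum>j<length xs. \<Sum>i<j. sV ((-1) ^ (i + 1))
        (f k (omit {i} (xs[j := br_00 L (xs ! i) (xs ! j)])) as)) +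
     (\<Sum>i<length xs. \<Sum>j<length as. sV ((-1) ^ i)
        (f k (omit {i} xs) (as[j := br_m0 L (as ! j) (xs ! i)])))"

definition hemi_diff ::
    "('k::field, 'a, 'b, 'z) hemistrict_scheme \<Rightarrow>
     ('k, 'a, 'b, 'v::ab_group_add, 'w::ab_group_add) rep2 \<Rightarrow> int \<Rightarrow>
     ('a, 'b, 'v, 'w) cochain \<Rightarrow> ('a, 'b, 'v, 'w) cochain" where
  "hemi_diff L V n \<omega> =
     (\<lambda>k xs as.
        if multi_dom (spc0 L) (spc1 L) (n + 2 - 2 * int k) k xs as
        then hemi_diff_part L (sclV1 V) (lact_0m V) (fst \<omega>) k xs as
        else 0,
      \<lambda>k xs as.
        if multi_dom (spc0 L) (spc1 L) (n + 1 - 2 * int k) k xs as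
        then sclV0 V ((-1) powi (n + 1)) (dV V (fst \<omega> k xs as))
           + hemi_diff_part L (sclV0 V) (lact_00 V) (snd \<omega>) k xs as
        else 0)"

definition hemi_complex ::
    "('k::field, 'a::plus, 'b::plus, 'z) hemistrict_scheme \<Rightarrow>
     ('k, 'a, 'b, 'v::ab_group_add, 'w::ab_group_add) rep2 \<Rightarrow>
     ('k, ('a, 'b, 'v, 'w) cochain) cochain_complex" where
  "hemi_complex L V =
     \<lparr>cscale = cochain_scale V, cspace = hemi_cochains L V, cdiff = hemi_diff L V\<rparr>"


section \<open>The complex of a semistrict Lie 2-algebra\<close>

record ('k, 'a, 'b) semistrict = "('k, 'a, 'b) two_term" +
  l2_00 :: "'a \<Rightarrow> 'a \<Rightarrow> 'a"
  l2_0m :: "'a \<Rightarrow> 'b \<Rightarrow> 'b"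
  l2_m0 :: "'b \<Rightarrow> 'a \<Rightarrow> 'b"
  l3 :: "'a \<Rightarrow> 'a \<Rightarrow> 'a \<Rightarrow> 'b"

definition semi_component ::
    "('k, 'a::plus, 'b::plus, 'z) semistrict_scheme \<Rightarrow> ('k \<Rightarrow> 'v \<Rightarrow> 'v) \<Rightarrow> int \<Rightarrow>
     ('a, 'b, 'v::ab_group_add) family set" where
  "semi_component G sV N = {f.
     \<forall>q. f q \<in> Hom_wedge_sym (spc0 G) (scl0 G) (spc1 G) (scl1 G) sV (N - 2 * int q) q}"

definition semi_cochains ::
    "('k, 'a::plus, 'b::plus, 'z) semistrict_scheme \<Rightarrow>
     ('k, 'a, 'b, 'v::ab_group_add, 'w::ab_group_add) rep2 \<Rightarrow> int \<Rightarrow>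
     ('a, 'b, 'v, 'w) cochain set" where
  "semi_cochains G V n =
     semi_component G (sclV1 V) (n + 1) \<times> semi_component G (sclV0 V) n"

definition semi_diff_part ::
    "('k::field, 'a, 'b, 'z) semistrict_scheme \<Rightarrow> ('k \<Rightarrow> 'v \<Rightarrow> 'v) \<Rightarrow> ('a \<Rightarrow> 'v \<Rightarrow> 'v) \<Rightarrow>
     ('a, 'b, 'v::ab_group_add) family \<Rightarrow> ('a, 'b, 'v) family" where
  "semi_diff_part G sV \<rho> f q xs as =
     (\<Sum>j<length as. f (q - 1) (dL G (as ! j) # xs) (omit {j} as)) +
     (\<Sum>i<length xs. sV ((-1) ^ i) (\<rho> (xs ! i) (f q (omit {i} xs) as))) +
     (\<Sum>j<length xs. \<Sum>i<j. sV ((-1) ^ (i + j))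
        (f q (l2_00 G (xs ! i) (xs ! j) # omit {i, j} xs) as)) +
     (\<Sum>i<length xs. \<Sum>j<length as. sV ((-1) ^ i)
        (f q (omit {i} xs) (as[j := l2_m0 G (as ! j) (xs ! i)]))) +
     (\<Sum>k<length xs. \<Sum>j<k. \<Sum>i<j. sV ((-1) ^ (i + j + k + 1))
        (f (Suc q) (omit {i, j, k} xs) (l3 G (xs ! i) (xs ! j) (xs ! k) # as)))"

definition semi_diff ::
    "('k::field, 'a, 'b, 'z) semistrict_scheme \<Rightarrow>
     ('k, 'a, 'b, 'v::ab_group_add, 'w::ab_group_add) rep2 \<Rightarrow> int \<Rightarrow>
     ('a, 'b, 'v, 'w) cochain \<Rightarrow> ('a, 'b, 'v, 'w) cochain" where
  "semi_diff G V n \<eta> =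
     (\<lambda>q xs as.
        if multi_dom (spc0 G) (spc1 G) (n + 2 - 2 * int q) q xs as
        then semi_diff_part G (sclV1 V) (lact_0m V) (fst \<eta>) q xs as
        else 0,
      \<lambda>q xs as.
        if multi_dom (spc0 G) (spc1 G) (n + 1 - 2 * int q) q xs as
        then sclV0 V ((-1) powi (n + 1)) (dV V (fst \<eta> q xs as))
           + semi_diff_part G (sclV0 V) (lact_00 V) (snd \<eta>) q xs as
        else 0)"

definition semi_complex ::
    "('k::field, 'a::plus, 'b::plus, 'z) semistrict_scheme \<Rightarrow>
     ('k, 'a, 'b, 'v::ab_group_add, 'w::ab_group_add) rep2 \<Rightarrow>
     ('k, ('a, 'b, 'v, 'w) cochain) cochain_complex" where
  "semi_complex G V =
     \<lparr>cscale = cochain_scale V, cspace = semi_cochains G V, cdiff = semi_diff G V\<rparr>"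


section \<open>The Chevalley-Eilenberg complex with coefficients in a 2-term complex\<close>

text \<open>
  The Lie algebra has carrier \<open>A\<close>, scalar multiplication \<open>sA\<close> and bracket \<open>br\<close>, and acts by \<open>\<rho>1\<close>, \<open>\<rho>0\<close>
  on the two terms of \<open>d :: 'v \<Rightarrow> 'w\<close>.
\<close>

definition ce_diff_part ::
    "('a \<Rightarrow> 'a \<Rightarrow> 'a) \<Rightarrow> ('k::field \<Rightarrow> 'v \<Rightarrow> 'v) \<Rightarrow> ('a \<Rightarrow> 'v \<Rightarrow> 'v) \<Rightarrow>
     ('a list \<Rightarrow> 'v::ab_group_add) \<Rightarrow> 'a list \<Rightarrow> 'v" where
  "ce_diff_part br sV \<rho> f xs =
     (\<Sum>i<length xs. sV ((-1) ^ i) (\<rho> (xs ! i) (f (omit {i} xs)))) +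
     (\<Sum>j<length xs. \<Sum>i<j. sV ((-1) ^ (i + j)) (f (br (xs ! i) (xs ! j) # omit {i, j} xs)))"

definition ce_complex ::
    "'a::plus set \<Rightarrow> ('k::field \<Rightarrow> 'a \<Rightarrow> 'a) \<Rightarrow> ('a \<Rightarrow> 'a \<Rightarrow> 'a) \<Rightarrow>
     ('k \<Rightarrow> 'v \<Rightarrow> 'v) \<Rightarrow> ('k \<Rightarrow> 'w \<Rightarrow> 'w) \<Rightarrow> ('v \<Rightarrow> 'w) \<Rightarrow> ('a \<Rightarrow> 'v \<Rightarrow> 'v) \<Rightarrow> ('a \<Rightarrow> 'w \<Rightarrow> 'w) \<Rightarrow>
     ('k, ('a list \<Rightarrow> 'v::ab_group_add) \<times> ('a list \<Rightarrow> 'w::ab_group_add)) cochain_complex" where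
  "ce_complex A sA br s1 s0 d \<rho>1 \<rho>0 =
     \<lparr>cscale = (\<lambda>c \<eta>. (\<lambda>xs. s1 c (fst \<eta> xs), \<lambda>xs. s0 c (snd \<eta> xs))),
      cspace = (\<lambda>n. Hom_wedge A sA s1 (n + 1) \<times> Hom_wedge A sA s0 n),
      cdiff = (\<lambda>n \<eta>.
        (\<lambda>xs. if int (length xs) = n + 2 \<and> set xs \<subseteq> A
              then ce_diff_part br s1 \<rho>1 (fst \<eta>) xs else 0,
         \<lambda>xs. if int (length xs) = n + 1 \<and> set xs \<subseteq> A
              then s0 ((-1) powi (n + 1)) (d (fst \<eta> xs)) + ce_diff_part br s0 \<rho>0 (snd \<eta>) xs
              else 0))\<rparr>"


section \<open>Structures associated with a Leibniz algebra\<close>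

locale leibniz_algebra = vector_space scale
  for scale :: "'k::field \<Rightarrow> 'g::ab_group_add \<Rightarrow> 'g" +
  fixes br :: "'g \<Rightarrow> 'g \<Rightarrow> 'g"
  assumes br_linear_right: "Vector_Spaces.linear scale scale (br x)"
    and br_linear_left: "Vector_Spaces.linear scale scale (\<lambda>x. br x y)"
    and leibniz: "br x (br y z) = br (br x y) z + br y (br x z)"

definition leibniz_kernel :: "('k::field \<Rightarrow> 'g \<Rightarrow> 'g) \<Rightarrow> ('g \<Rightarrow> 'g \<Rightarrow> 'g) \<Rightarrow> 'g::ab_group_add set" where
  "leibniz_kernel s br = module.span s {br x y + br y x | x y. True}"

definition L_of :: "('k::field \<Rightarrow> 'g \<Rightarrow> 'g) \<Rightarrow> ('g \<Rightarrow> 'g \<Rightarrow> 'g) \<Rightarrow> ('k, 'g::ab_group_add, 'g) hemistrict" where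
  "L_of s br =
     \<lparr>scl0 = s, scl1 = s, spc0 = UNIV, spc1 = leibniz_kernel s br, dL = (\<lambda>\<alpha>. \<alpha>),
      br_00 = br, br_0m = br, br_m0 = br, h2 = (\<lambda>x y. br x y + br y x)\<rparr>"

definition G_of :: "('k::field \<Rightarrow> 'g \<Rightarrow> 'g) \<Rightarrow> ('g \<Rightarrow> 'g \<Rightarrow> 'g) \<Rightarrow> ('k, 'g::ab_group_add, 'g) semistrict" where
  "G_of s br = (let h = h2 (L_of s br) in
     \<lparr>scl0 = s, scl1 = s, spc0 = UNIV, spc1 = leibniz_kernel s br, dL = (\<lambda>\<alpha>. \<alpha>),
      l2_00 = (\<lambda>x y. s (1 / 2) (br x y - br y x)),
      l2_0m = (\<lambda>x \<alpha>. s (1 / 2) (br x \<alpha>)),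
      l2_m0 = (\<lambda>\<alpha> x. - s (1 / 2) (br x \<alpha>)),
      l3 = (\<lambda>x y z. - s (1 / 12)
        (h (br x y - br y x) z + h (br y z - br z y) x + h (br z x - br x z) y))\<rparr>)"

text \<open>
  The Lie algebra \<open>\<gg>/K\<close> consists of cosets of \<open>K\<close>; its bracket is \<open>[x + K, y + K] = [x, y] + K\<close>. A coset acts
  on the representation by the common value of \<open>l\<^sub>x\<close> for its elements \<open>x\<close>, which is well defined if
  \<open>l\<^sub>\<alpha> = 0\<close> for all \<open>\<alpha>\<close> in \<open>L\<^sup>-\<^sup>1\<close>.
\<close>

definition lie_bracket ::
    "('k::field \<Rightarrow> 'g \<Rightarrow> 'g) \<Rightarrow> ('g \<Rightarrow> 'g \<Rightarrow> 'g) \<Rightarrow> 'g::ab_group_add set \<Rightarrow> 'g set \<Rightarrow> 'g set" where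
  "lie_bracket s br X Y = {br x y | x y. x \<in> X \<and> y \<in> Y} + leibniz_kernel s br"

definition coset_action :: "('g \<Rightarrow> 'v \<Rightarrow> 'v) \<Rightarrow> 'g set \<Rightarrow> 'v \<Rightarrow> 'v" where
  "coset_action l X v = the_elem ((\<lambda>x. l x v) ` X)"

definition lie_ce_complex ::
    "('k::field \<Rightarrow> 'g \<Rightarrow> 'g) \<Rightarrow> ('g \<Rightarrow> 'g \<Rightarrow> 'g) \<Rightarrow>
     ('k, 'g::ab_group_add, 'g, 'v::ab_group_add, 'w::ab_group_add) rep2 \<Rightarrow>
     ('k, ('g set list \<Rightarrow> 'v) \<times> ('g set list \<Rightarrow> 'w)) cochain_complex" where
  "lie_ce_complex s br V =
     ce_complex (quotient_space UNIV (leibniz_kernel s br)) (quotient_scale s (leibniz_kernel s br))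
       (lie_bracket s br) (sclV1 V) (sclV0 V) (dV V)
       (coset_action (lact_0m V)) (coset_action (lact_00 V))"

context leibniz_algebra
begin

lemma br_simps:
  "br (x + y) z = br x z + br y z" "br z (x + y) = br z x + br z y"
  "br (scale c x) z = scale c (br x z)" "br z (scale c x) = scale c (br z x)"
  "br 0 z = 0" "br z 0 = 0"
proof -
  interpret R: Vector_Spaces.linear scale scale "br z" for z by (rule br_linear_right)
  interpret L: Vector_Spaces.linear scale scale "\<lambda>x. br x z" for z by (rule br_linear_left)
  show "br (x + y) z = br x z + br y z" "br z (x + y) = br z x + br z y"
    "br (scale c x) z = scale c (br x z)" "br z (scale c x) = scale c (br z x)"
    "br 0 z = 0" "br z 0 = 0"
    by (simp_all add: R.add L.add R.scale L.scale R.zero L.zero)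
qed

lemma sym_in_kernel: "br x y + br y x \<in> leibniz_kernel scale br"
  unfolding leibniz_kernel_def by (rule span_base) blast

lemma kernel_br: "\<alpha> \<in> leibniz_kernel scale br \<Longrightarrow> br \<alpha> z = 0"
  unfolding leibniz_kernel_def
proof (induction rule: span_induct_alt)
  case base
  show ?case by (simp add: br_simps)
next
  case (step c a b)
  then obtain x y where a: "a = br x y + br y x" by blast
  have "br a z = 0"
    using leibniz[of x y z] leibniz[of y x z] by (simp add: a br_simps)
  with step show ?case by (simp add: br_simps)
qed

lemma br_kernel: "\<alpha> \<in> leibniz_kernel scale br \<Longrightarrow> br z \<alpha> \<in> leibniz_kernel scale br"
  unfolding leibniz_kernel_def
proof (induction rule: span_induct_alt)
  case base
  show ?case by (simp add: br_simps span_zero)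
next
  case (step c a b)
  then obtain x y where a: "a = br x y + br y x" by blast
  have "br z a = (br (br z x) y + br y (br z x)) + (br (br z y) x + br x (br z y))"
    by (simp add: a br_simps leibniz[of z x y] leibniz[of z y x] algebra_simps)
  also have "\<dots> \<in> span {br x y + br y x | x y. True}"
    by (intro span_add span_base) blast+
  finally show ?case using step by (simp add: br_simps span_add span_scale)
qed

theorem hemistrict_lie2_L_of: "hemistrict_lie2 (L_of scale br)"
proof -
  let ?K = "leibniz_kernel scale br"
  have sub: "subspace ?K"
    by (simp add: leibniz_kernel_def subspace_span)
  have der: "br x (br y z + br z y) =
      br (br x y) z + br z (br x y) + (br y (br x z) + br (br x z) y)" for x y z
    using leibniz[of x y z] leibniz[of x z y] by (simp add: br_simps algebra_simps)
  show ?thesis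
    by (unfold_locales, unfold L_of_def hemistrict.simps two_term.simps)
      (rule leibniz der scale_right_distrib scale_left_distrib scale_scale scale_one subspace_UNIV kernel_br[OF sym_in_kernel] sub
       | simp add: bilinear_on_def linear_on_def br_simps kernel_br br_kernel sym_in_kernel
           subspace_0[OF sub] scale_right_distrib add_ac)+
qed

end

end

theory Submission
  imports Defs
begin

text \<open>
  Write \<open>K\<close> for the Leibniz kernel and \<open>h(x, y) = [x, y] + [y, x]\<close>. All three complexes consist of pairs of
  a cochain with values in \<open>V\<^sup>-\<^sup>1\<close> and one with values in \<open>V\<^sup>0\<close>, and the differential of \<open>V\<close> enters only
  by mapping the first component to the second. So everything of substance happens for one component,
  that is, for a single module on which \<open>K\<close> acts by zero (\<open>leibniz_module\<close>), as long as it is natural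
  in the module.

  The hemistrict and the semistrict complex are isomorphic. The condition on a hemistrict family says
  that it is a linear form on the algebra generated by \<open>\<gg>\<close> and by central elements from \<open>K\<close> with relations
  \<open>x y + y x = - h(x, y)\<close>, an analogue of a Clifford algebra. As for Clifford algebras, this
  algebra acts on \<open>\<Lambda>\<gg> \<otimes> S K\<close>, a generator \<open>x\<close> acting by \<open>x \<and> _\<close> minus half the contraction with
  \<open>h(x, _)\<close>, and acting on \<open>1\<close> identifies the algebra with \<open>\<Lambda>\<gg> \<otimes> S K\<close>. The transpose \<open>wick\<close> of this
  identification maps semistrict families to hemistrict ones. It is triangular with respect to the number
  of arguments in \<open>K\<close>, hence bijective. It commutes with the differentials because both satisfy a Cartan
  formula with the same Lie derivative: \<open>D \<iota>\<^sub>x + \<iota>\<^sub>x D = L\<^sub>x\<close> on the hemistrict side (\<open>hemi_cartan\<close>), and the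
  same with the transposed action of \<open>x\<close> for \<open>\<iota>\<^sub>x\<close> on the semistrict side (\<open>semi_cartan\<close>). The
  coefficient \<open>1 / 12\<close> of the ternary bracket is what makes the second formula true
  (\<open>jac3_identity\<close>). By the first Cartan formula \<open>D\<^sup>2 = 0\<close> on hemistrict families (\<open>hemiD_hemiD\<close>), and
  transport along \<open>wick\<close> gives \<open>D\<^sup>2 = 0\<close> on semistrict families, with no computation with the ternary bracket.

  The semistrict complex is quasi-isomorphic to the Chevalley-Eilenberg complex of \<open>\<gg> / K\<close>. Pullback along
  \<open>\<gg> \<rightarrow> \<gg> / K\<close> identifies Chevalley-Eilenberg cochains with the basic families: those without arguments in
  \<open>S K\<close> that vanish as soon as an argument lies in \<open>K\<close>. On its component with the most
  arguments in \<open>S K\<close>, the differential of a family is the Koszul differential of \<open>K \<subseteq> \<gg>\<close>. A linear projection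
  onto \<open>K\<close> provides a homotopy that shows exactness (\<open>koszul_exact\<close>), so that the top component can be removed,
  time and again, by subtracting coboundaries, until only a basic family is left (\<open>cohomologous_to_basic\<close>).

  Two diagram chases (\<open>two_term_comparison\<close>) extend these facts from one component to pairs.
\<close>

section \<open>Alternating sums over the entries of a list\<close>

text \<open>
  The differentials are sums over entries of a list that are removed from it, with signs given by
  positions. Recursion on the list replaces the positions: \<open>alt_sum\<close>, \<open>alt_sum2\<close> and \<open>alt_sum3\<close> remove one,
  two and three entries, with sign \<open>(-1)\<^sup>i\<close>, \<open>(-1)\<^sup>i\<^sup>+\<^sup>j\<close> and \<open>(-1)\<^sup>i\<^sup>+\<^sup>j\<^sup>+\<^sup>k\<^sup>+\<^sup>1\<close> for positions
  counted from 0, \<open>pick_sum\<close> removes one without sign, \<open>der_sum\<close> applies a map to one entry, and \<open>bracket_sum\<close>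
  replaces an entry by its bracket with an earlier one, which is removed.
\<close>

primrec alt_sum :: "('a \<Rightarrow> 'a list \<Rightarrow> 'v::ab_group_add) \<Rightarrow> 'a list \<Rightarrow> 'v" where
  "alt_sum G [] = 0"
| "alt_sum G (x # xs) = G x xs - alt_sum (\<lambda>y ys. G y (x # ys)) xs"

primrec alt_sum2 :: "('a \<Rightarrow> 'a \<Rightarrow> 'a list \<Rightarrow> 'v::ab_group_add) \<Rightarrow> 'a list \<Rightarrow> 'v" where
  "alt_sum2 G [] = 0"
| "alt_sum2 G (x # xs) = alt_sum2 (\<lambda>y z zs. G y z (x # zs)) xs - alt_sum (G x) xs"

primrec alt_sum3 :: "('a \<Rightarrow> 'a \<Rightarrow> 'a \<Rightarrow> 'a list \<Rightarrow> 'v::ab_group_add) \<Rightarrow> 'a list \<Rightarrow> 'v" where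
  "alt_sum3 G [] = 0"
| "alt_sum3 G (x # xs) = - alt_sum3 (\<lambda>y z w ws. G y z w (x # ws)) xs - alt_sum2 (G x) xs"

primrec pick_sum :: "('a \<Rightarrow> 'a list \<Rightarrow> 'v::ab_group_add) \<Rightarrow> 'a list \<Rightarrow> 'v" where
  "pick_sum G [] = 0"
| "pick_sum G (x # xs) = G x xs + pick_sum (\<lambda>y ys. G y (x # ys)) xs"

primrec der_sum :: "('a \<Rightarrow> 'a) \<Rightarrow> ('a list \<Rightarrow> 'v::ab_group_add) \<Rightarrow> 'a list \<Rightarrow> 'v" where
  "der_sum \<delta> g [] = 0"
| "der_sum \<delta> g (x # xs) = g (\<delta> x # xs) + der_sum \<delta> (\<lambda>ys. g (x # ys)) xs"

primrec bracket_sum :: "('a \<Rightarrow> 'a \<Rightarrow> 'a) \<Rightarrow> ('a list \<Rightarrow> 'v::ab_group_add) \<Rightarrow> 'a list \<Rightarrow> 'v" where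
  "bracket_sum b g [] = 0"
| "bracket_sum b g (x # xs) = - der_sum (b x) g xs - bracket_sum b (\<lambda>ys. g (x # ys)) xs"

lemma omit_Cons [simp]:
  "omit {0} (x # xs) = xs" "omit {Suc i} (x # xs) = x # omit {i} xs"
  "omit {0, Suc j} (x # xs) = omit {j} xs" "omit {Suc i, Suc j} (x # xs) = x # omit {i, j} xs"
  "omit {0, Suc j, Suc k} (x # xs) = omit {j, k} xs"
  "omit {Suc i, Suc j, Suc k} (x # xs) = x # omit {i, j, k} xs"
proof -
  have *: "omit I (x # xs) = (if 0 \<in> I then [] else [x]) @ omit {j. Suc j \<in> I} xs" for I
    by (simp add: omit_def nths_Cons Compl_eq)
  have e: "{j. j = a \<or> j = b} = {a, b}" "{j. j = a \<or> j = b \<or> j = c} = {a, b, c}" for a b c :: nat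
    by auto
  show "omit {0} (x # xs) = xs" "omit {Suc i} (x # xs) = x # omit {i} xs"
    "omit {0, Suc j} (x # xs) = omit {j} xs" "omit {Suc i, Suc j} (x # xs) = x # omit {i, j} xs"
    "omit {0, Suc j, Suc k} (x # xs) = omit {j, k} xs"
    "omit {Suc i, Suc j, Suc k} (x # xs) = x # omit {i, j, k} xs"
    by (simp_all add: * e omit_def[of "{}"] nths_all)
qed

lemma sum_pairs_shift:
  "(\<Sum>j<Suc n. \<Sum>i<j. g i j) = (\<Sum>j<n. g 0 (Suc j)) + (\<Sum>j<n. \<Sum>i<j. g (Suc i) (Suc j))"
  for g :: "nat \<Rightarrow> nat \<Rightarrow> 'a::ab_group_add"
  by (simp add: sum.lessThan_Suc_shift sum.distrib del: sum.lessThan_Suc)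

lemma sum_triples_shift:
  "(\<Sum>k<Suc n. \<Sum>j<k. \<Sum>i<j. g i j k) =
     (\<Sum>k<n. \<Sum>j<k. g 0 (Suc j) (Suc k)) + (\<Sum>k<n. \<Sum>j<k. \<Sum>i<j. g (Suc i) (Suc j) (Suc k))"
  for g :: "nat \<Rightarrow> nat \<Rightarrow> nat \<Rightarrow> 'a::ab_group_add"
  by (simp add: sum.lessThan_Suc_shift sum.distrib del: sum.lessThan_Suc)

lemma pick_sum_eq: "(\<Sum>j<length xs. G (xs ! j) (omit {j} xs)) = pick_sum G xs"
  by (induction xs arbitrary: G) (simp_all add: sum.lessThan_Suc_shift del: sum.lessThan_Suc)

lemma der_sum_eq: "(\<Sum>j<length xs. g (xs[j := \<delta> (xs ! j)])) = der_sum \<delta> g xs"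
  by (induction xs arbitrary: g) (simp_all add: sum.lessThan_Suc_shift del: sum.lessThan_Suc)

context vector_space
begin

lemma alt_sum_eq: "(\<Sum>i<length xs. scale ((-1) ^ i) (G (xs ! i) (omit {i} xs))) = alt_sum G xs"
  by (induction xs arbitrary: G)
    (simp_all add: sum.lessThan_Suc_shift sum_negf del: sum.lessThan_Suc)

lemma alt_sum2_eq:
  "(\<Sum>j<length xs. \<Sum>i<j. scale ((-1) ^ (i + j)) (G (xs ! i) (xs ! j) (omit {i, j} xs))) =
     alt_sum2 G xs"
proof (induction xs arbitrary: G)
  case (Cons x xs)
  show ?case
    using Cons.IH[of "\<lambda>y z zs. G y z (x # zs)"] alt_sum_eq[of "G x" xs]
    unfolding length_Cons sum_pairs_shift by (simp add: sum_negf)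
qed simp

lemma alt_sum3_eq:
  "(\<Sum>k<length xs. \<Sum>j<k. \<Sum>i<j. scale ((-1) ^ (i + j + k + 1))
      (G (xs ! i) (xs ! j) (xs ! k) (omit {i, j, k} xs))) = alt_sum3 G xs"
proof (induction xs arbitrary: G)
  case (Cons x xs)
  show ?case
    using Cons.IH[of "\<lambda>y z w ws. G y z w (x # ws)", THEN arg_cong[where f = uminus]] alt_sum2_eq[of "G x" xs]
    unfolding length_Cons sum_triples_shift by (simp add: sum_negf)
qed simp

lemma bracket_sum_eq:
  "(\<Sum>j<length xs. \<Sum>i<j. scale ((-1) ^ (i + 1)) (g (omit {i} (xs[j := b (xs ! i) (xs ! j)])))) =
     bracket_sum b g xs"
proof (induction xs arbitrary: g)
  case (Cons x xs)
  show ?case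
    using Cons.IH[of "\<lambda>ys. g (x # ys)", THEN arg_cong[where f = uminus]] der_sum_eq[of g xs "b x"]
    unfolding length_Cons sum_pairs_shift by (simp add: sum_negf)
qed simp

end

lemma alt_sum_0 [simp]: "alt_sum (\<lambda>y ys. 0) xs = 0"
  by (induction xs) simp_all

lemma alt_sum2_0 [simp]: "alt_sum2 (\<lambda>y z zs. 0) xs = 0"
  by (induction xs) simp_all

lemma alt_sum3_0 [simp]: "alt_sum3 (\<lambda>y z w zs. 0) xs = 0"
  by (induction xs) simp_all

lemma pick_sum_0 [simp]: "pick_sum (\<lambda>y ys. 0) xs = 0"
  by (induction xs) simp_all

lemma der_sum_0 [simp]: "der_sum \<delta> (\<lambda>ys. 0) xs = 0"
  by (induction xs) simp_all

lemma alt_sum_add: "alt_sum (\<lambda>y ys. G y ys + H y ys) xs = alt_sum G xs + alt_sum H xs"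
  by (induction xs arbitrary: G H) (simp_all add: algebra_simps)

lemma alt_sum2_add: "alt_sum2 (\<lambda>y z ys. G y z ys + H y z ys) xs = alt_sum2 G xs + alt_sum2 H xs"
  by (induction xs arbitrary: G H) (simp_all add: algebra_simps alt_sum_add)

lemma pick_sum_add: "pick_sum (\<lambda>y ys. G y ys + H y ys) xs = pick_sum G xs + pick_sum H xs"
  by (induction xs arbitrary: G H) (simp_all add: algebra_simps)

lemma der_sum_add: "der_sum \<delta> (\<lambda>ys. G ys + H ys) xs = der_sum \<delta> G xs + der_sum \<delta> H xs"
  by (induction xs arbitrary: G H) (simp_all add: algebra_simps)

lemma bracket_sum_add:
  "bracket_sum b (\<lambda>ys. G ys + H ys) xs = bracket_sum b G xs + bracket_sum b H xs"
  by (induction xs arbitrary: G H) (simp_all add: algebra_simps der_sum_add)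

lemma
  assumes add: "\<And>u v. \<phi> (u + v) = \<phi> u + \<phi> v"
  shows additive_alt_sum: "\<phi> (alt_sum G xs) = alt_sum (\<lambda>y ys. \<phi> (G y ys)) xs"
    and additive_alt_sum2: "\<phi> (alt_sum2 G2 xs) = alt_sum2 (\<lambda>y z ys. \<phi> (G2 y z ys)) xs"
    and additive_alt_sum3: "\<phi> (alt_sum3 G3 xs) = alt_sum3 (\<lambda>y z w ys. \<phi> (G3 y z w ys)) xs"
    and additive_pick_sum: "\<phi> (pick_sum G xs) = pick_sum (\<lambda>y ys. \<phi> (G y ys)) xs"
    and additive_der_sum: "\<phi> (der_sum \<delta> g xs) = der_sum \<delta> (\<lambda>ys. \<phi> (g ys)) xs"
    and additive_bracket_sum: "\<phi> (bracket_sum b g xs) = bracket_sum b (\<lambda>ys. \<phi> (g ys)) xs"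
proof -
  have z: "\<phi> 0 = 0" using add[of 0 0] by simp
  have m: "\<phi> (- u) = - \<phi> u" for u using add[of u "- u"] z by (simp add: eq_neg_iff_add_eq_0 add.commute)
  have d: "\<phi> (u - v) = \<phi> u - \<phi> v" for u v using add[of u "- v"] m by simp
  show 1: "\<phi> (alt_sum G xs) = alt_sum (\<lambda>y ys. \<phi> (G y ys)) xs" for G xs
    by (induction xs arbitrary: G) (simp_all add: z d)
  show 2: "\<phi> (alt_sum2 G2 xs) = alt_sum2 (\<lambda>y z ys. \<phi> (G2 y z ys)) xs" for G2 xs
    by (induction xs arbitrary: G2) (simp_all add: z d 1)
  show "\<phi> (alt_sum3 G3 xs) = alt_sum3 (\<lambda>y z w ys. \<phi> (G3 y z w ys)) xs"
    by (induction xs arbitrary: G3) (simp_all add: z d m 2)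
  show "\<phi> (pick_sum G xs) = pick_sum (\<lambda>y ys. \<phi> (G y ys)) xs"
    by (induction xs arbitrary: G) (simp_all add: z add)
  show 3: "\<phi> (der_sum \<delta> g xs) = der_sum \<delta> (\<lambda>ys. \<phi> (g ys)) xs" for \<delta> g xs
    by (induction xs arbitrary: g) (simp_all add: z add)
  show "\<phi> (bracket_sum b g xs) = bracket_sum b (\<lambda>ys. \<phi> (g ys)) xs"
    by (induction xs arbitrary: g) (simp_all add: z d m 3)
qed

lemma alt_sum_minus: "alt_sum (\<lambda>y ys. - G y ys) xs = - alt_sum G xs"
  by (rule additive_alt_sum[of uminus, symmetric]) simp

lemma alt_sum_diff: "alt_sum (\<lambda>y ys. G y ys - H y ys) xs = alt_sum G xs - alt_sum H xs"
  by (induction xs arbitrary: G H) (simp_all add: algebra_simps)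

lemma alt_sum2_minus: "alt_sum2 (\<lambda>y z ys. - G y z ys) xs = - alt_sum2 G xs"
  by (rule additive_alt_sum2[of uminus, symmetric]) simp

lemma alt_sum2_diff: "alt_sum2 (\<lambda>y z ys. G y z ys - H y z ys) xs = alt_sum2 G xs - alt_sum2 H xs"
  by (induction xs arbitrary: G H) (simp_all add: algebra_simps alt_sum_diff)

lemma alt_sum3_diff:
  "alt_sum3 (\<lambda>y z w ys. G y z w ys - H y z w ys) xs = alt_sum3 G xs - alt_sum3 H xs"
  by (induction xs arbitrary: G H) (simp_all add: algebra_simps alt_sum2_diff)

lemma pick_sum_diff: "pick_sum (\<lambda>y ys. G y ys - H y ys) xs = pick_sum G xs - pick_sum H xs"
  by (induction xs arbitrary: G H) (simp_all add: algebra_simps)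

lemma der_sum_diff: "der_sum \<delta> (\<lambda>ys. G ys - H ys) xs = der_sum \<delta> G xs - der_sum \<delta> H xs"
  by (induction xs arbitrary: G H) (simp_all add: algebra_simps)

text \<open>
  Removing \<open>a\<close> and then \<open>y\<close> from a list gives opposite signs for the two orders in which \<open>a\<close> and \<open>y\<close> occur in it.
\<close>

lemma alt_sum_alt_sum:
  "alt_sum (\<lambda>a ws. alt_sum (\<lambda>y vs. G a y vs) ws) xs = - alt_sum2 (\<lambda>a y vs. G a y vs - G y a vs) xs"
  by (induction xs arbitrary: G) (simp_all add: alt_sum_diff)

lemma alt_sum_swap:
  "alt_sum (\<lambda>a ws. alt_sum (\<lambda>y vs. G a y vs) ws) xs =
     - alt_sum (\<lambda>y ws. alt_sum (\<lambda>a vs. G a y vs) ws) xs"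
  unfolding alt_sum_alt_sum by (simp add: alt_sum2_diff)

text \<open>
  Removing one entry before or after an even number of others gives the same sign, since the
  number of removed entries in front of it and behind it have the same parity; for an odd number, as in
  \<open>alt_sum_swap\<close> and \<open>alt_sum3_alt_sum\<close>, the signs are opposite.
\<close>

lemma alt_sum2_alt_sum:
  "alt_sum2 (\<lambda>a b ws. alt_sum (\<lambda>y vs. G a b y vs) ws) xs =
     alt_sum (\<lambda>y ws. alt_sum2 (\<lambda>a b vs. G a b y vs) ws) xs"
proof (induction xs arbitrary: G)
  case (Cons x xs)
  show ?case
    using alt_sum_swap[of "\<lambda>b y. G x b y" xs] Cons.IH[of "\<lambda>a b y vs. G a b y (x # vs)"]
    by (simp add: alt_sum_diff alt_sum2_diff)
qed simp

lemma alt_sum3_alt_sum: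
  "alt_sum3 (\<lambda>a b c ws. alt_sum (\<lambda>y vs. G a b c y vs) ws) xs =
     - alt_sum (\<lambda>y ws. alt_sum3 (\<lambda>a b c vs. G a b c y vs) ws) xs"
proof (induction xs arbitrary: G)
  case (Cons x xs)
  show ?case
    using alt_sum2_alt_sum[of "\<lambda>b c y. G x b c y" xs] Cons.IH[of "\<lambda>a b c y vs. G a b c y (x # vs)"]
    by (simp add: alt_sum_diff alt_sum3_diff alt_sum_minus)
qed simp

lemma pick_sum_swap:
  "pick_sum (\<lambda>a ws. pick_sum (\<lambda>y vs. G a y vs) ws) xs =
     pick_sum (\<lambda>y ws. pick_sum (\<lambda>a vs. G a y vs) ws) xs"
  by (induction xs arbitrary: G) (simp_all add: pick_sum_add)

lemma alt_sum_pick_sum: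
  "alt_sum (\<lambda>y zs. pick_sum (\<lambda>\<alpha> bs. G y zs \<alpha> bs) as) xs =
     pick_sum (\<lambda>\<alpha> bs. alt_sum (\<lambda>y zs. G y zs \<alpha> bs) xs) as"
  by (induction as arbitrary: G) (simp_all add: alt_sum_add)

lemma alt_sum_der_sum:
  "alt_sum (\<lambda>y zs. der_sum \<delta> (\<lambda>bs. G y zs bs) as) xs =
     der_sum \<delta> (\<lambda>bs. alt_sum (\<lambda>y zs. G y zs bs) xs) as"
  by (induction as arbitrary: G) (simp_all add: alt_sum_add)

lemma der_sum_alt_sum:
  "der_sum \<delta> (alt_sum G) xs = alt_sum (\<lambda>y zs. G (\<delta> y) zs + der_sum \<delta> (G y) zs) xs"
  by (induction xs arbitrary: G) (simp_all add: alt_sum_add der_sum_diff)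

lemma der_sum_pick_sum:
  "der_sum \<delta> (pick_sum G) xs = pick_sum (\<lambda>y zs. G (\<delta> y) zs + der_sum \<delta> (G y) zs) xs"
  by (induction xs arbitrary: G) (simp_all add: pick_sum_add der_sum_add)

lemma der_sum_swap:
  "der_sum \<delta> (\<lambda>xs. der_sum \<epsilon> (\<lambda>ys. G xs ys) as) bs = der_sum \<epsilon> (\<lambda>ys. der_sum \<delta> (\<lambda>xs. G xs ys) bs) as"
  by (induction bs arbitrary: G) (simp_all add: der_sum_add)

lemma alt_sum_cong:
  "(\<And>y zs. length xs = Suc (length zs) \<Longrightarrow> G y zs = H y zs) \<Longrightarrow> alt_sum G xs = alt_sum H xs"
proof (induction xs arbitrary: G H)
  case (Cons x xs)
  have "alt_sum (\<lambda>y ys. G y (x # ys)) xs = alt_sum (\<lambda>y ys. H y (x # ys)) xs"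
    by (rule Cons.IH) (simp add: Cons.prems)
  then show ?case using Cons.prems by simp
qed simp

lemma pick_sum_cong:
  "(\<And>y ys. y \<in> set xs \<Longrightarrow> set ys \<subseteq> set xs \<Longrightarrow> length xs = Suc (length ys) \<Longrightarrow> G y ys = G' y ys) \<Longrightarrow>
     pick_sum G xs = pick_sum G' xs"
proof (induction xs arbitrary: G G')
  case (Cons x xs)
  have "pick_sum (\<lambda>y ys. G y (x # ys)) xs = pick_sum (\<lambda>y ys. G' y (x # ys)) xs"
    by (rule Cons.IH, rule Cons.prems) auto
  then show ?case using Cons.prems[of x xs] by auto
qed simp

text \<open>
  A symmetric function may be fed the changed entry in front; this turns a statement about an
  arbitrary argument into one about the first.
\<close>

lemma pick_sum_der_sum:
  assumes "\<And>as bs. mset as = mset bs \<Longrightarrow> g as = g bs"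
  shows "pick_sum (\<lambda>\<alpha> bs. g (\<delta> \<alpha> # bs)) as = der_sum \<delta> g as"
  using assms
proof (induction as arbitrary: g)
  case (Cons a as)
  have "g (\<delta> \<alpha> # a # bs) = g (a # \<delta> \<alpha> # bs)" for \<alpha> bs
    by (rule Cons.prems) simp
  moreover have "pick_sum (\<lambda>\<alpha> bs. g (a # \<delta> \<alpha> # bs)) as = der_sum \<delta> (\<lambda>bs. g (a # bs)) as"
    by (rule Cons.IH) (simp add: Cons.prems)
  ultimately show ?case by simp
qed simp

text \<open>
  This shows that the sum is invariant under permutations of the list.
\<close>

lemma pick_sum_mset:
  "pick_sum (\<lambda>y ys. H y (mset ys)) xs = (\<Sum>a\<in>#mset xs. H a (mset xs - {#a#}))"
proof (induction xs arbitrary: H)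
  case (Cons x xs)
  have "(\<Sum>a\<in>#mset xs. H a (add_mset x (mset xs - {#a#}))) = (\<Sum>a\<in>#mset xs. H a (add_mset x (mset xs) - {#a#}))"
    by (intro arg_cong[where f = sum_mset] image_mset_cong) auto
  with Cons.IH[of "\<lambda>y M. H y (add_mset x M)"] show ?case by simp
qed simp

lemma pick_sum_sym:
  assumes "\<And>y as bs. mset as = mset bs \<Longrightarrow> G y as = G y bs" "mset as = mset bs"
  shows "pick_sum G as = pick_sum G bs"
proof -
  \<comment> \<open>the value of \<open>G\<close> on any list with the given entries\<close>
  define H where "H y M = G y (SOME ys. mset ys = M)" for y M
  have "G y ys = H y (mset ys)" for y ys
  proof -
    have "mset (SOME zs. mset zs = mset ys) = mset ys" by (rule someI) (rule refl)
    then show ?thesis unfolding H_def by (intro assms(1)) simp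
  qed
  then have "G = (\<lambda>y ys. H y (mset ys))" by (simp add: fun_eq_iff)
  then show ?thesis by (simp only: pick_sum_mset assms(2))
qed

lemma der_sum_append:
  "der_sum \<delta> g (us @ ws) = der_sum \<delta> (\<lambda>zs. g (zs @ ws)) us + der_sum \<delta> (\<lambda>zs. g (us @ zs)) ws"
  by (induction us arbitrary: g) (simp_all add: add.assoc)

lemma der_sum_commutator:
  "der_sum \<delta> (der_sum \<epsilon> g) xs - der_sum \<epsilon> (der_sum \<delta> g) xs =
     der_sum (\<lambda>z. \<epsilon> (\<delta> z)) g xs - der_sum (\<lambda>z. \<delta> (\<epsilon> z)) g xs"
proof (induction xs arbitrary: g)
  case (Cons x xs)
  show ?case using Cons.IH[of "\<lambda>ys. g (x # ys)"] by (simp add: der_sum_add algebra_simps)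
qed simp

lemma alt_sum_map: "alt_sum G (map c xs) = alt_sum (\<lambda>x ys. G (c x) (map c ys)) xs"
  by (induction xs arbitrary: G) simp_all

lemma alt_sum2_map: "alt_sum2 G (map c xs) = alt_sum2 (\<lambda>x y ys. G (c x) (c y) (map c ys)) xs"
  by (induction xs arbitrary: G) (simp_all add: alt_sum_map)

section \<open>Cosets of a subspace\<close>

context vector_space
begin

lemma mem_coset_iff: "z \<in> x +o W \<longleftrightarrow> z - x \<in> W" for W :: "'b set"
proof -
  have "z \<in> x +o W \<longleftrightarrow> (\<exists>b\<in>W. z = x + b)" by (simp add: elt_set_plus_def)
  also have "\<dots> \<longleftrightarrow> z - x \<in> W" by (metis add.commute diff_add_cancel add_diff_cancel_left')
  finally show ?thesis .
qed

lemma subspace_coset_eq: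
  assumes W: "subspace W"
  shows "x +o W = y +o W \<longleftrightarrow> x - y \<in> W"
proof
  assume "x +o W = y +o W"
  moreover have "x \<in> x +o W" by (simp add: mem_coset_iff subspace_0[OF W])
  ultimately show "x - y \<in> W" by (simp add: mem_coset_iff)
next
  assume d: "x - y \<in> W"
  show "x +o W = y +o W"
  proof (intro set_eqI)
    fix z
    have "z - y = (z - x) + (x - y)" "z - x = (z - y) - (x - y)" by simp_all
    then show "z \<in> x +o W \<longleftrightarrow> z \<in> y +o W"
      unfolding mem_coset_iff using d subspace_add[OF W] subspace_diff[OF W] by metis
  qed
qed

lemma subspace_coset_add:
  assumes W: "subspace W"
  shows "(x +o W) + (y +o W) = (x + y) +o W"
proof (intro set_eqI iffI)
  fix z assume "z \<in> (x +o W) + (y +o W)"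
  then obtain a b where ab: "a - x \<in> W" "b - y \<in> W" "z = a + b"
    by (auto simp: set_plus_def mem_coset_iff)
  have e: "z - (x + y) = (a - x) + (b - y)" by (simp add: ab)
  show "z \<in> (x + y) +o W" unfolding mem_coset_iff e by (rule subspace_add[OF W ab(1,2)])
next
  fix z assume z: "z \<in> (x + y) +o W"
  have "x \<in> x +o W" "z - x \<in> y +o W"
    using z by (simp_all add: mem_coset_iff subspace_0[OF W] diff_diff_eq)
  then show "z \<in> (x +o W) + (y +o W)"
    unfolding set_plus_def by (intro CollectI bexI[of _ x] bexI[of _ "z - x"]) simp_all
qed

lemma subspace_coset_scale:
  assumes W: "subspace W"
  shows "quotient_scale scale W c (x +o W) = scale c x +o W"
  unfolding quotient_scale_def
proof (intro set_eqI iffI)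
  fix z assume "z \<in> scale c ` (x +o W) + W"
  then obtain a b where ab: "a - x \<in> W" "b \<in> W" "z = scale c a + b"
    by (auto simp: set_plus_def mem_coset_iff)
  have e: "z - scale c x = scale c (a - x) + b" by (simp add: ab scale_right_diff_distrib)
  show "z \<in> scale c x +o W"
    unfolding mem_coset_iff e by (rule subspace_add[OF W subspace_scale[OF W ab(1)] ab(2)])
next
  fix z assume z: "z \<in> scale c x +o W"
  have "scale c x \<in> scale c ` (x +o W)" by (rule imageI) (simp add: mem_coset_iff subspace_0[OF W])
  moreover have "z - scale c x \<in> W" using z by (simp add: mem_coset_iff)
  ultimately show "z \<in> scale c ` (x +o W) + W"
    unfolding set_plus_def by (intro CollectI bexI[of _ "scale c x"] bexI[of _ "z - scale c x"]) simp_all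
qed

end

section \<open>Families of multilinear maps\<close>

text \<open>
  One component of a representation on which the Leibniz kernel acts by zero.
\<close>

locale leibniz_module = leibniz_algebra s br + V: vector_space sV
  for s :: "'k::field_char_0 \<Rightarrow> 'g::ab_group_add \<Rightarrow> 'g" and br :: "'g \<Rightarrow> 'g \<Rightarrow> 'g"
    and sV :: "'k \<Rightarrow> 'v::ab_group_add \<Rightarrow> 'v" +
  fixes \<rho> :: "'g \<Rightarrow> 'v \<Rightarrow> 'v"
  assumes \<rho>_add_left: "\<rho> (x + y) v = \<rho> x v + \<rho> y v"
    and \<rho>_scale_left: "\<rho> (s c x) v = sV c (\<rho> x v)"
    and \<rho>_add: "\<rho> x (u + v) = \<rho> x u + \<rho> x v"
    and \<rho>_scale: "\<rho> x (sV c v) = sV c (\<rho> x v)"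
    and \<rho>_br: "\<rho> (br x y) v = \<rho> x (\<rho> y v) - \<rho> y (\<rho> x v)"
    and \<rho>_kernel: "\<alpha> \<in> leibniz_kernel s br \<Longrightarrow> \<rho> \<alpha> v = 0"
begin

abbreviation K :: "'g set" where "K \<equiv> leibniz_kernel s br"

abbreviation h :: "'g \<Rightarrow> 'g \<Rightarrow> 'g" where "h x y \<equiv> br x y + br y x"

abbreviation dom :: "int \<Rightarrow> nat \<Rightarrow> 'g list \<Rightarrow> 'g list \<Rightarrow> bool" where
  "dom N k \<equiv> multi_dom UNIV K (N - 2 * int k) k"

text \<open>
  The conditions that semistrict and hemistrict families share: multilinearity, symmetry in the
  arguments from \<open>K\<close>, and vanishing off the domain. The latter makes most identities below
  valid for all arguments, inside the domain or not.
\<close>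

definition tensors :: "int \<Rightarrow> ('g, 'g, 'v) family set" where
  "tensors N = {f. \<forall>k. f k \<in> Hom_tensor_sym UNIV s K s sV (N - 2 * int k) k}"

abbreviation semi :: "int \<Rightarrow> ('g, 'g, 'v) family set" where
  "semi N \<equiv> semi_component (G_of s br) sV N"

abbreviation hemi :: "int \<Rightarrow> ('g, 'g, 'v) family set" where
  "hemi N \<equiv> hemi_component (L_of s br) sV N"

definition multilin :: "('g list \<Rightarrow> 'v) \<Rightarrow> bool" where
  "multilin g \<longleftrightarrow>
     (\<forall>us x y vs. g (us @ (x + y) # vs) = g (us @ x # vs) + g (us @ y # vs)) \<and>
     (\<forall>us c x vs. g (us @ s c x # vs) = sV c (g (us @ x # vs)))"

definition skew :: "('g list \<Rightarrow> 'v) \<Rightarrow> bool" where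
  "skew g \<longleftrightarrow> (\<forall>us x y vs. g (us @ x # y # vs) = - g (us @ y # x # vs))"

definition scale_family :: "'k \<Rightarrow> ('g, 'g, 'v) family \<Rightarrow> ('g, 'g, 'v) family" where
  "scale_family c f = (\<lambda>k xs as. sV c (f k xs as))"

lemma K_subspace: "subspace K"
  by (simp add: leibniz_kernel_def subspace_span)

lemmas K_closed = subspace_add[OF K_subspace] subspace_scale[OF K_subspace] subspace_0[OF K_subspace]
  subspace_neg[OF K_subspace] subspace_diff[OF K_subspace]

lemma h_simps:
  "h (x + y) z = h x z + h y z" "h z (x + y) = h z x + h z y"
  "h (s c x) z = s c (h x z)" "h z (s c x) = s c (h z x)"
  by (simp_all add: br_simps scale_right_distrib)

lemma br_h: "br x (h y z) = h (br x y) z + h y (br x z)"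
  using leibniz[of x y z] leibniz[of x z y] by (simp add: br_simps algebra_simps)

lemma \<rho>_simps: "\<rho> x 0 = 0" "\<rho> x (- v) = - \<rho> x v" "\<rho> x (u - v) = \<rho> x u - \<rho> x v"
proof -
  show z: "\<rho> x 0 = 0" using \<rho>_add[of x 0 0] by simp
  show m: "\<rho> x (- v) = - \<rho> x v" for v
    using \<rho>_add[of x v "- v"] z by (simp add: eq_neg_iff_add_eq_0 add.commute)
  show "\<rho> x (u - v) = \<rho> x u - \<rho> x v" using \<rho>_add[of x u "- v"] m by simp
qed

lemma double_zero: "v = - v \<Longrightarrow> v = 0" for v :: 'v
proof -
  assume "v = - v"
  then have "sV 2 v = 0"
    using V.scale_left_distrib[of 1 1 v] by (metis V.scale_one add.right_inverse one_add_one)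
  then show ?thesis by simp
qed

lemma dom_simps:
  "multi_dom UNIV K m k xs as \<longleftrightarrow> int (length xs) = m \<and> length as = k \<and> set as \<subseteq> K"
  by (auto simp: multi_dom_def)

lemma dom_Cons: "dom N k (x # xs) as \<longleftrightarrow> dom (N - 1) k xs as"
  unfolding dom_simps by auto

lemma dom_Suc: "\<alpha> \<in> K \<Longrightarrow> dom N (Suc k) xs (\<alpha> # as) \<longleftrightarrow> dom (N - 2) k xs as"
  unfolding dom_simps by auto

lemma domE: "\<not> dom N k xs as \<Longrightarrow> f \<in> tensors N \<Longrightarrow> f k xs as = 0"
  by (auto simp: tensors_def Hom_tensor_sym_def)

lemma tensorD:
  assumes "f \<in> tensors N" "dom N k xs as"
  shows "i < length xs \<Longrightarrow> linear_on UNIV s sV (\<lambda>x. f k (xs[i := x]) as)"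
    and "j < length as \<Longrightarrow> linear_on K s sV (\<lambda>\<alpha>. f k xs (as[j := \<alpha>]))"
    and "mset bs = mset as \<Longrightarrow> f k xs bs = f k xs as"
proof -
  have "f k \<in> Hom_tensor_sym UNIV s K s sV (N - 2 * int k) k"
    using assms(1) by (simp add: tensors_def)
  then have *: "\<forall>xs as. dom N k xs as \<longrightarrow>
      (\<forall>i<length xs. linear_on UNIV s sV (\<lambda>x. f k (xs[i := x]) as)) \<and>
      (\<forall>j<length as. linear_on K s sV (\<lambda>\<alpha>. f k xs (as[j := \<alpha>]))) \<and>
      (\<forall>bs. mset bs = mset as \<longrightarrow> f k xs bs = f k xs as)"
    unfolding Hom_tensor_sym_def mem_Collect_eq by (rule conjunct2)
  note * = mp[OF spec[OF spec[OF *]] assms(2)]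
  show "i < length xs \<Longrightarrow> linear_on UNIV s sV (\<lambda>x. f k (xs[i := x]) as)"
    by (rule *[THEN conjunct1, rule_format])
  show "j < length as \<Longrightarrow> linear_on K s sV (\<lambda>\<alpha>. f k xs (as[j := \<alpha>]))"
    by (rule *[THEN conjunct2, THEN conjunct1, rule_format])
  show "mset bs = mset as \<Longrightarrow> f k xs bs = f k xs as"
    by (rule *[THEN conjunct2, THEN conjunct2, rule_format])
qed

lemma multilin_Cons: "multilin g \<Longrightarrow> multilin (\<lambda>xs. g (x # xs))"
  unfolding multilin_def by (metis append_Cons)

lemma skew_Cons: "skew g \<Longrightarrow> skew (\<lambda>xs. g (x # xs))"
  unfolding skew_def by (metis append_Cons)

lemma multilin_head:
  assumes "multilin g"
  shows "g ((x + y) # xs) = g (x # xs) + g (y # xs)" "g (s c x # xs) = sV c (g (x # xs))"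
  using assms[unfolded multilin_def, THEN conjunct1, rule_format, of "[]"]
    assms[unfolded multilin_def, THEN conjunct2, rule_format, of "[]"] by simp_all

lemma tensor_multilin:
  assumes f: "f \<in> tensors N"
  shows "multilin (\<lambda>xs. f k xs as)"
proof -
  have *: "f k (us @ (x + y) # vs) as = f k (us @ x # vs) as + f k (us @ y # vs) as \<and>
           f k (us @ s c x # vs) as = sV c (f k (us @ x # vs) as)" for us vs x y c
  proof (cases "dom N k (us @ x # vs) as")
    case True
    then have "linear_on UNIV s sV (\<lambda>z. f k ((us @ x # vs)[length us := z]) as)"
      by (rule tensorD(1)[OF f]) simp
    then show ?thesis by (simp add: linear_on_def)
  next
    case False
    then have "\<not> dom N k (us @ z # vs) as" for z by (simp add: dom_simps)
    then show ?thesis by (simp add: domE[OF _ f])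
  qed
  then show ?thesis by (simp add: multilin_def)
qed

lemma tensor_linear_head:
  assumes "f \<in> tensors N"
  shows "f k ((x + y) # xs) as = f k (x # xs) as + f k (y # xs) as"
    and "f k (s c x # xs) as = sV c (f k (x # xs) as)"
  using multilin_head[OF tensor_multilin[OF assms, of k as]] by simp_all

lemma tensor_sym:
  assumes f: "f \<in> tensors N" and m: "mset as = mset bs"
  shows "f k xs as = f k xs bs"
proof (cases "dom N k xs as")
  case True
  then show ?thesis using tensorD(3)[OF f _ m[symmetric]] by simp
next
  case False
  moreover have "\<not> dom N k xs bs"
    using False mset_eq_length[OF m] mset_eq_setD[OF m] by (simp add: dom_simps)
  ultimately show ?thesis by (simp add: domE[OF _ f])
qed

lemma tensor_linear_sym:
  assumes f: "f \<in> tensors N"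
  shows "\<alpha> \<in> K \<Longrightarrow> \<beta> \<in> K \<Longrightarrow> f k xs ((\<alpha> + \<beta>) # as) = f k xs (\<alpha> # as) + f k xs (\<beta> # as)"
    and "\<alpha> \<in> K \<Longrightarrow> f k xs (s c \<alpha> # as) = sV c (f k xs (\<alpha> # as))"
proof -
  have *: "(\<forall>\<beta>\<in>K. f k xs ((\<alpha> + \<beta>) # as) = f k xs (\<alpha> # as) + f k xs (\<beta> # as)) \<and>
        f k xs (s c \<alpha> # as) = sV c (f k xs (\<alpha> # as))" if \<alpha>: "\<alpha> \<in> K"
  proof (cases "dom N k xs (\<alpha> # as)")
    case True
    then have "linear_on K s sV (\<lambda>z. f k xs ((\<alpha> # as)[0 := z]))"
      by (rule tensorD(2)[OF f]) simp
    then show ?thesis using \<alpha> by (simp add: linear_on_def)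
  next
    case False
    then have "\<not> dom N k xs (z # as)" if "z \<in> K" for z using that \<alpha> by (simp add: dom_simps)
    then show ?thesis using \<alpha> by (simp add: domE[OF _ f] K_closed)
  qed
  show "\<alpha> \<in> K \<Longrightarrow> \<beta> \<in> K \<Longrightarrow> f k xs ((\<alpha> + \<beta>) # as) = f k xs (\<alpha> # as) + f k xs (\<beta> # as)"
    "\<alpha> \<in> K \<Longrightarrow> f k xs (s c \<alpha> # as) = sV c (f k xs (\<alpha> # as))" using * by simp_all
qed

lemma tensorI:
  assumes off: "\<And>k xs as. \<not> dom N k xs as \<Longrightarrow> f k xs as = 0"
    and lin: "\<And>k as. multilin (\<lambda>xs. f k xs as)"
    and sym: "\<And>k xs as bs. mset as = mset bs \<Longrightarrow> f k xs as = f k xs bs"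
    and add: "\<And>k xs \<alpha> \<beta> as. \<alpha> \<in> K \<Longrightarrow> \<beta> \<in> K \<Longrightarrow>
       f k xs ((\<alpha> + \<beta>) # as) = f k xs (\<alpha> # as) + f k xs (\<beta> # as)"
    and sc: "\<And>k xs \<alpha> c as. \<alpha> \<in> K \<Longrightarrow> f k xs (s c \<alpha> # as) = sV c (f k xs (\<alpha> # as))"
  shows "f \<in> tensors N"
proof -
  have 1: "linear_on UNIV s sV (\<lambda>x. f k (xs[i := x]) as)" if "i < length xs" for k xs i as
    using lin[of k as] by (simp add: linear_on_def multilin_def upd_conv_take_nth_drop[OF that])
  have 2: "linear_on K s sV (\<lambda>\<alpha>. f k xs (as[j := \<alpha>]))" if j: "j < length as" for k xs j as
  proof -
    have "f k xs (as[j := \<alpha>]) = f k xs (\<alpha> # take j as @ drop (Suc j) as)" for \<alpha>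
      by (rule sym) (simp add: upd_conv_take_nth_drop[OF j])
    then show ?thesis by (simp add: linear_on_def add sc)
  qed
  show ?thesis
    unfolding tensors_def Hom_tensor_sym_def by (intro CollectI allI conjI impI off 1 2 sym)
qed

lemma alt_sum_multilin:
  assumes "\<And>x y zs. G (x + y) zs = G x zs + G y zs" "\<And>c x zs. G (s c x) zs = sV c (G x zs)"
    "\<And>z. multilin (G z)"
  shows "multilin (alt_sum G)"
proof -
  have 1: "alt_sum G (us @ (x + y) # vs) = alt_sum G (us @ x # vs) + alt_sum G (us @ y # vs)"
    for us x y vs using assms
  proof (induction us arbitrary: G)
    case Nil
    have "G z ((x + y) # ys) = G z (x # ys) + G z (y # ys)" for z ys
      by (rule multilin_head[OF Nil(3)])
    with Nil(1) show ?case by (simp add: alt_sum_add)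
  next
    case (Cons u us)
    have "alt_sum (\<lambda>z zs. G z (u # zs)) (us @ (x + y) # vs) =
        alt_sum (\<lambda>z zs. G z (u # zs)) (us @ x # vs) + alt_sum (\<lambda>z zs. G z (u # zs)) (us @ y # vs)"
      by (rule Cons.IH) (rule Cons.prems(1) Cons.prems(2) multilin_Cons[OF Cons.prems(3)])+
    moreover have "G u (us @ (x + y) # vs) = G u (us @ x # vs) + G u (us @ y # vs)"
      using Cons.prems by (simp add: multilin_def)
    ultimately show ?case by simp
  qed
  have 2: "alt_sum G (us @ s c x # vs) = sV c (alt_sum G (us @ x # vs))"
    for us x c vs using assms
  proof (induction us arbitrary: G)
    case Nil
    have "G z (s c x # ys) = sV c (G z (x # ys))" for z ys
      by (rule multilin_head[OF Nil(3)])
    with Nil(2) show ?case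
      by (simp add: V.scale_right_diff_distrib additive_alt_sum[of "sV c", OF V.scale_right_distrib])
  next
    case (Cons u us)
    have "alt_sum (\<lambda>z zs. G z (u # zs)) (us @ s c x # vs) =
        sV c (alt_sum (\<lambda>z zs. G z (u # zs)) (us @ x # vs))"
      by (rule Cons.IH) (rule Cons.prems(1) Cons.prems(2) multilin_Cons[OF Cons.prems(3)])+
    moreover have "G u (us @ s c x # vs) = sV c (G u (us @ x # vs))"
      using Cons.prems by (simp add: multilin_def)
    ultimately show ?case by (simp add: V.scale_right_diff_distrib)
  qed
  show ?thesis using 1 2 by (simp add: multilin_def)
qed

lemma skew_head: "skew g \<Longrightarrow> g (x # y # xs) = - g (y # x # xs)"
  unfolding skew_def by (metis append_Nil)

lemma skew_alt_sum:
  assumes "\<And>z. skew (G z)"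
  shows "skew (alt_sum G)"
proof -
  have "alt_sum G (us @ x # y # vs) = - alt_sum G (us @ y # x # vs)" for us x y vs
    using assms
  proof (induction us arbitrary: G)
    case Nil
    have "alt_sum (\<lambda>z zs. G z (x # y # zs)) vs = - alt_sum (\<lambda>z zs. G z (y # x # zs)) vs"
      by (subst skew_head[OF Nil]) (rule alt_sum_minus)
    then show ?case by (simp add: alt_sum_diff)
  next
    case (Cons u us)
    have "G u (us @ x # y # vs) = - G u (us @ y # x # vs)"
      using Cons.prems unfolding skew_def by blast
    moreover have "skew (\<lambda>zs. G z (u # zs))" for z
      by (rule skew_Cons[of "G z", OF Cons.prems])
    then have "alt_sum (\<lambda>z zs. G z (u # zs)) (us @ x # y # vs) =
        - alt_sum (\<lambda>z zs. G z (u # zs)) (us @ y # x # vs)"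
      by (rule Cons.IH)
    ultimately show ?case by simp
  qed
  then show ?thesis unfolding skew_def by blast
qed

lemma skew_repeat: 
  assumes "skew g" shows "g (us @ a # vs @ a # ws) = 0"
proof (induction vs arbitrary: us)
  case Nil
  have "g (us @ a # a # ws) = - g (us @ a # a # ws)" using assms unfolding skew_def by blast
  then show ?case using double_zero by simp
next
  case (Cons v vs)
  have "g (us @ a # v # vs @ a # ws) = - g (us @ v # a # vs @ a # ws)"
    using assms unfolding skew_def by blast
  then show ?case using Cons.IH[of "us @ [v]"] by simp
qed

lemma skew_der_sum:
  "skew g \<Longrightarrow> alt_sum (\<lambda>y zs. g (\<delta> y # zs)) xs = der_sum \<delta> g xs"
proof (induction xs arbitrary: g)
  case (Cons x xs)
  have "alt_sum (\<lambda>y zs. g (\<delta> y # x # zs)) xs = - alt_sum (\<lambda>y zs. g (x # \<delta> y # zs)) xs"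
    by (subst skew_head[OF Cons.prems]) (rule alt_sum_minus)
  then show ?case using Cons.IH[OF skew_Cons[OF Cons.prems]] by simp
qed simp

text \<open>
  In characteristic 0, vanishing on lists with repetitions amounts to a sign change under adjacent transpositions, which
  is much easier to check for the constructions below.
\<close>

lemma semi_iff: "f \<in> semi N \<longleftrightarrow> f \<in> tensors N \<and> (\<forall>k as. skew (\<lambda>xs. f k xs as))"
proof
  assume f: "f \<in> semi N"
  then have T: "f \<in> tensors N" and a: "\<not> distinct xs \<Longrightarrow> f k xs as = 0" for k xs as
    by (auto simp: semi_component_def Hom_wedge_sym_def tensors_def G_of_def Let_def)
  have "f k (us @ x # y # vs) as = - f k (us @ y # x # vs) as" for k us x y vs as
  proof -
    note m = tensor_multilin[OF T, of k as, unfolded multilin_def]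
    have r: "f k (us @ z # z # vs) as = 0" for z by (rule a) simp
    \<comment> \<open>polarization\<close>
    have "0 = f k (us @ (x + y) # (x + y) # vs) as" using r by simp
    also have "\<dots> = f k (us @ x # (x + y) # vs) as + f k (us @ y # (x + y) # vs) as"
      using m by blast
    also have "\<dots> = f k (us @ x # y # vs) as + f k (us @ y # x # vs) as"
      using m[THEN conjunct1, rule_format, of "us @ [x]" x y vs]
        m[THEN conjunct1, rule_format, of "us @ [y]" x y vs] r by simp
    finally show ?thesis by (simp add: eq_neg_iff_add_eq_0)
  qed
  with T show "f \<in> tensors N \<and> (\<forall>k as. skew (\<lambda>xs. f k xs as))" unfolding skew_def by blast
next
  assume f: "f \<in> tensors N \<and> (\<forall>k as. skew (\<lambda>xs. f k xs as))"
  have "f k xs as = 0" if nd: "\<not> distinct xs" for k xs as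
  proof -
    obtain us a vs ws where xs: "xs = us @ [a] @ vs @ [a] @ ws"
      using not_distinct_decomp[OF nd] by blast
    have "skew (\<lambda>xs. f k xs as)" using f by blast
    from skew_repeat[OF this, of us a vs ws] show ?thesis by (simp add: xs)
  qed
  with f show "f \<in> semi N"
    by (auto simp: semi_component_def Hom_wedge_sym_def tensors_def G_of_def Let_def)
qed

lemma hemi_iff: "f \<in> hemi N \<longleftrightarrow> f \<in> tensors N \<and> (\<forall>k us x y vs as.
    f k (us @ x # y # vs) as + f k (us @ y # x # vs) as = - f (Suc k) (us @ vs) (h x y # as))"
proof -
  have om: "omit {length us, Suc (length us)} (us @ x # y # vs) = us @ vs" for us vs :: "'g list" and x y
    by (induction us) (simp_all add: omit_Cons(3)[of _ 0, simplified])
  have up: "(us @ x # y # vs)[length us := z, Suc (length us) := w] = us @ z # w # vs"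
    for us vs :: "'g list" and x y z w
    by (simp add: list_update_append)
  have up': "(us @ x # y # vs)[Suc (length us) := w] = us @ x # w # vs"
    for us vs :: "'g list" and x y w
    by (simp add: list_update_append)
  have nt: "(us @ x # y # vs) ! Suc (length us) = y" for us vs :: "'g list" and x y
    by (simp add: nth_append)
  have "(h2_skew (L_of s br) N f) \<longleftrightarrow> (\<forall>k us x y vs as.
    f k (us @ x # y # vs) as + f k (us @ y # x # vs) as = - f (Suc k) (us @ vs) (h x y # as))"
    (is "?l \<longleftrightarrow> ?r") if T: "f \<in> tensors N"
  proof
    assume l: ?l
    show ?r
    proof (intro allI)
      fix k us x y vs as
      show "f k (us @ x # y # vs) as + f k (us @ y # x # vs) as = - f (Suc k) (us @ vs) (h x y # as)"
      proof (cases "dom N k (us @ x # y # vs) as")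
        case True
        then show ?thesis
          using l[unfolded h2_skew_def, rule_format, of k "us @ x # y # vs" as "length us"]
          by (simp add: L_of_def om up' nt)
      next
        case False
        then have "\<not> dom N k (us @ y # x # vs) as" "\<not> dom N (Suc k) (us @ vs) (h x y # as)"
          unfolding dom_simps by auto
        with False show ?thesis by (simp add: domE[OF _ T])
      qed
    qed
  next
    assume r: ?r
    show ?l
      unfolding h2_skew_def
    proof (intro allI impI, elim conjE)
      fix k i and xs as :: "'g list"
      assume i: "Suc i < length xs"
      define us vs where "us = take i xs" and "vs = drop (Suc (Suc i)) xs"
      have xs: "xs = us @ xs ! i # xs ! Suc i # vs" and l: "length us = i"
        using i by (simp_all add: us_def vs_def Cons_nth_drop_Suc)
      define x y where "x = xs ! i" and "y = xs ! Suc i"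
      have xs: "xs = us @ x # y # vs" using xs by (simp add: x_def y_def)
      show "f k xs as + f k (xs[i := xs ! Suc i, Suc i := xs ! i]) as =
            - f (Suc k) (omit {i, Suc i} xs) (h2 (L_of s br) (xs ! i) (xs ! Suc i) # as)"
        unfolding x_def[symmetric] y_def[symmetric] unfolding xs l[symmetric] om up
        using r by (simp add: L_of_def)
    qed
  qed
  moreover have "f \<in> hemi N \<longleftrightarrow> f \<in> tensors N \<and> h2_skew (L_of s br) N f"
    by (simp add: hemi_component_def tensors_def L_of_def)
  ultimately show ?thesis by blast
qed

definition insertion :: "'g \<Rightarrow> ('g, 'g, 'v) family \<Rightarrow> ('g, 'g, 'v) family" where
  "insertion x f = (\<lambda>k xs as. f k (x # xs) as)"

definition evaluation :: "'g \<Rightarrow> ('g, 'g, 'v) family \<Rightarrow> ('g, 'g, 'v) family" where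
  "evaluation \<alpha> f = (\<lambda>k xs as. f (Suc k) xs (\<alpha> # as))"

text \<open>
  Contraction with \<open>\<delta> : \<gg> \<rightarrow> K\<close>: it moves an argument from the exterior to the symmetric part. It occurs with
  \<open>\<delta> = h(x, _)\<close> in the Clifford action and with a projection \<open>\<delta>\<close> onto \<open>K\<close> in the Koszul homotopy.
\<close>

definition contraction :: "('g \<Rightarrow> 'g) \<Rightarrow> ('g, 'g, 'v) family \<Rightarrow> ('g, 'g, 'v) family" where
  "contraction \<delta> f = (\<lambda>k xs as. alt_sum (\<lambda>y zs. f (Suc k) zs (\<delta> y # as)) xs)"

text \<open>
  The transpose of the action of a generator \<open>x\<close> on \<open>\<Lambda>\<gg> \<otimes> S K\<close>.
\<close>

definition clifford :: "'g \<Rightarrow> ('g, 'g, 'v) family \<Rightarrow> ('g, 'g, 'v) family" where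
  "clifford x f = insertion x f - scale_family (1 / 2) (contraction (h x) f)"

text \<open>
  The value of \<open>f\<close> on the product \<open>x\<^sub>1 \<cdots> x\<^sub>m\<close> in the Clifford-like algebra. Expanding the recursion gives
  Wick's formula, a sum over partial matchings of the \<open>x\<^sub>i\<close> with a factor \<open>- h(x\<^sub>i, x\<^sub>j) / 2\<close> for every matched pair.
\<close>

primrec wick :: "('g, 'g, 'v) family \<Rightarrow> nat \<Rightarrow> 'g list \<Rightarrow> 'g list \<Rightarrow> 'v" where
  "wick f k [] = f k []"
| "wick f k (x # xs) = wick (clifford x f) k xs"

lemma h_in_K: "h x y \<in> K" by (rule sym_in_kernel)

lemma h_commute: "h x y = h y x" by (rule add.commute)


lemma multilin_add: "multilin g \<Longrightarrow> multilin g' \<Longrightarrow> multilin (\<lambda>xs. g xs + g' xs)"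
  by (simp add: multilin_def V.scale_right_distrib)

lemma multilin_scale: "multilin g \<Longrightarrow> multilin (\<lambda>xs. sV c (g xs))"
  by (simp add: multilin_def V.scale_right_distrib mult.commute)

lemma tensor_add:
  assumes f: "f \<in> tensors N" and g: "g \<in> tensors N"
  shows "f + g \<in> tensors N"
proof (rule tensorI)
  show "(f + g) k xs as = 0" if "\<not> dom N k xs as" for k xs as
    using that by (simp add: domE[OF _ f] domE[OF _ g])
  show "multilin (\<lambda>xs. (f + g) k xs as)" for k as
    unfolding plus_fun_apply by (rule multilin_add[OF tensor_multilin[OF f] tensor_multilin[OF g]])
  show "(f + g) k xs as = (f + g) k xs bs" if "mset as = mset bs" for k xs as bs
    using tensor_sym[OF f that] tensor_sym[OF g that] by simp
qed (simp_all add: tensor_linear_sym[OF f] tensor_linear_sym[OF g] V.scale_right_distrib)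

lemma tensor_scale:
  assumes f: "f \<in> tensors N"
  shows "scale_family c f \<in> tensors N"
  unfolding scale_family_def
proof (rule tensorI)
  show "sV c (f k xs as) = 0" if "\<not> dom N k xs as" for k xs as
    using that by (simp add: domE[OF _ f])
  show "multilin (\<lambda>xs. sV c (f k xs as))" for k as
    by (rule multilin_scale[OF tensor_multilin[OF f]])
  show "sV c (f k xs as) = sV c (f k xs bs)" if "mset as = mset bs" for k xs as bs
    using tensor_sym[OF f that] by simp
qed (simp_all add: tensor_linear_sym[OF f] V.scale_right_distrib mult.commute)

lemma tensor_zero: "0 \<in> tensors N"
  by (rule tensorI) (simp_all add: multilin_def)

lemma scale_family_minus_one: "scale_family (- 1) f = - f"
  by (simp add: scale_family_def fun_eq_iff)

lemma tensor_minus: "f \<in> tensors N \<Longrightarrow> - f \<in> tensors N"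
  using tensor_scale[of f N "- 1"] by (simp add: scale_family_minus_one)

lemma tensor_diff: "f \<in> tensors N \<Longrightarrow> g \<in> tensors N \<Longrightarrow> f - g \<in> tensors N"
  using tensor_add[of f N "- g"] tensor_minus[of g N] by simp

lemma skew_add: "skew g \<Longrightarrow> skew g' \<Longrightarrow> skew (\<lambda>xs. g xs + g' xs)"
  unfolding skew_def by (metis minus_add_distrib)

lemma skew_scale: "skew g \<Longrightarrow> skew (\<lambda>xs. sV c (g xs))"
  unfolding skew_def by (metis V.scale_minus_right)

lemma skew_zero: "skew (\<lambda>xs. 0)"
  by (simp add: skew_def)

lemma semi_add: "f \<in> semi N \<Longrightarrow> g \<in> semi N \<Longrightarrow> f + g \<in> semi N"
  unfolding semi_iff by (auto simp: tensor_add intro!: skew_add)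

lemma semi_scale: "f \<in> semi N \<Longrightarrow> scale_family c f \<in> semi N"
  unfolding semi_iff by (auto simp: tensor_scale) (auto simp: scale_family_def intro: skew_scale)

lemma semi_zero: "0 \<in> semi N"
  unfolding semi_iff by (simp add: tensor_zero skew_def)

lemma semi_minus: "f \<in> semi N \<Longrightarrow> - f \<in> semi N"
  using semi_scale[of f N "- 1"] by (simp add: scale_family_minus_one)

lemma semi_diff: "f \<in> semi N \<Longrightarrow> g \<in> semi N \<Longrightarrow> f - g \<in> semi N"
  using semi_add[of f N "- g"] semi_minus[of g N] by simp

lemma hemi_add:
  assumes "f \<in> hemi N" "g \<in> hemi N" shows "f + g \<in> hemi N"
proof -
  have "f k (us @ x # y # vs) as + g k (us @ x # y # vs) as +
      (f k (us @ y # x # vs) as + g k (us @ y # x # vs) as) =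
      - (f (Suc k) (us @ vs) (h x y # as) + g (Suc k) (us @ vs) (h x y # as))" for k us vs x y as
  proof -
    have "f k (us @ x # y # vs) as + f k (us @ y # x # vs) as = - f (Suc k) (us @ vs) (h x y # as)"
      "g k (us @ x # y # vs) as + g k (us @ y # x # vs) as = - g (Suc k) (us @ vs) (h x y # as)"
      using assms unfolding hemi_iff by blast+
    then show ?thesis by (simp add: algebra_simps)
  qed
  with assms show ?thesis
    unfolding hemi_iff by (auto simp: tensor_add)
qed

lemma hemi_scale:
  assumes "f \<in> hemi N" shows "scale_family c f \<in> hemi N"
proof -
  have "sV c (f k (us @ x # y # vs) as) + sV c (f k (us @ y # x # vs) as) =
      - sV c (f (Suc k) (us @ vs) (h x y # as))" for k us vs x y as
  proof -
    have "f k (us @ x # y # vs) as + f k (us @ y # x # vs) as = - f (Suc k) (us @ vs) (h x y # as)"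
      using assms unfolding hemi_iff by blast
    then show ?thesis by (simp add: V.scale_right_distrib[symmetric])
  qed
  with assms show ?thesis
    unfolding hemi_iff by (auto simp: tensor_scale) (simp add: scale_family_def)
qed

lemma hemi_zero: "0 \<in> hemi N"
  unfolding hemi_iff by (simp add: tensor_zero)

lemma hemi_minus: "f \<in> hemi N \<Longrightarrow> - f \<in> hemi N"
  using hemi_scale[of f N "- 1"] by (simp add: scale_family_minus_one)

lemma hemi_diff_closed: "f \<in> hemi N \<Longrightarrow> g \<in> hemi N \<Longrightarrow> f - g \<in> hemi N"
  using hemi_add[of f N "- g"] hemi_minus[of g N] by simp

lemma insertion_tensor:
  assumes f: "f \<in> tensors N"
  shows "insertion x f \<in> tensors (N - 1)"
  unfolding insertion_def
proof (rule tensorI)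
  show "f k (x # xs) as = 0" if "\<not> dom (N - 1) k xs as" for k xs as
    by (rule domE[OF _ f]) (unfold dom_Cons, rule that)
  show "multilin (\<lambda>xs. f k (x # xs) as)" for k as
    by (rule multilin_Cons[OF tensor_multilin[OF f]])
  show "f k (x # xs) as = f k (x # xs) bs" if "mset as = mset bs" for k xs as bs
    by (rule tensor_sym[OF f that])
qed (simp_all add: tensor_linear_sym[OF f])

lemma evaluation_tensor:
  assumes f: "f \<in> tensors N" and \<alpha>: "\<alpha> \<in> K"
  shows "evaluation \<alpha> f \<in> tensors (N - 2)"
  unfolding evaluation_def
proof (rule tensorI)
  show "f (Suc k) xs (\<alpha> # as) = 0" if "\<not> dom (N - 2) k xs as" for k xs as
    by (rule domE[OF _ f]) (unfold dom_Suc[OF \<alpha>], rule that)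
  show "multilin (\<lambda>xs. f (Suc k) xs (\<alpha> # as))" for k as
    by (rule tensor_multilin[OF f])
  show "f (Suc k) xs (\<alpha> # as) = f (Suc k) xs (\<alpha> # bs)" if "mset as = mset bs" for k xs as bs
    by (rule tensor_sym[OF f]) (simp add: that)
  have *: "f (Suc k) xs (\<alpha> # \<gamma> # as) = f (Suc k) xs (\<gamma> # \<alpha> # as)" for k xs \<gamma> as
    by (rule tensor_sym[OF f]) simp
  show "f (Suc k) xs (\<alpha> # (\<gamma> + \<beta>) # as) = f (Suc k) xs (\<alpha> # \<gamma> # as) + f (Suc k) xs (\<alpha> # \<beta> # as)"
    if "\<gamma> \<in> K" "\<beta> \<in> K" for k xs \<gamma> \<beta> as
    unfolding *[of _ _ "\<gamma> + \<beta>"] *[of _ _ \<gamma>] *[of _ _ \<beta>] by (rule tensor_linear_sym(1)[OF f that])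
  show "f (Suc k) xs (\<alpha> # s c \<gamma> # as) = sV c (f (Suc k) xs (\<alpha> # \<gamma> # as))"
    if "\<gamma> \<in> K" for k xs \<gamma> c as
    unfolding *[of _ _ "s c \<gamma>"] *[of _ _ \<gamma>] by (rule tensor_linear_sym(2)[OF f that])
qed

definition K_linear :: "('g \<Rightarrow> 'g) \<Rightarrow> bool" where
  "K_linear \<delta> \<longleftrightarrow> (\<forall>x y. \<delta> (x + y) = \<delta> x + \<delta> y) \<and> (\<forall>c x. \<delta> (s c x) = s c (\<delta> x)) \<and> (\<forall>x. \<delta> x \<in> K)"

lemma K_linear_h: "K_linear (h x)"
  by (simp add: K_linear_def h_in_K br_simps scale_right_distrib)

lemma contraction_tensor:
  assumes f: "f \<in> tensors N" and \<delta>: "K_linear \<delta>"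
  shows "contraction \<delta> f \<in> tensors (N - 1)"
  unfolding contraction_def
proof (rule tensorI)
  note E = evaluation_tensor[OF f, unfolded evaluation_def]
  have \<delta>K: "\<delta> y \<in> K" for y using \<delta> by (simp add: K_linear_def)
  show "alt_sum (\<lambda>y zs. f (Suc k) zs (\<delta> y # as)) xs = 0" if "\<not> dom (N - 1) k xs as" for k xs as
  proof -
    have "alt_sum (\<lambda>y zs. f (Suc k) zs (\<delta> y # as)) xs = alt_sum (\<lambda>y zs. 0) xs"
    proof (rule alt_sum_cong)
      fix y and zs :: "'g list"
      assume "length xs = Suc (length zs)"
      with that have "\<not> dom (N - 2) k zs as" by (auto simp: dom_simps)
      then show "f (Suc k) zs (\<delta> y # as) = 0" by (rule domE[OF _ E[OF \<delta>K]])
    qed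
    then show ?thesis by simp
  qed
  show "multilin (alt_sum (\<lambda>y zs. f (Suc k) zs (\<delta> y # as)))" for k as
  proof (rule alt_sum_multilin)
    show "f (Suc k) zs (\<delta> (x + y) # as) = f (Suc k) zs (\<delta> x # as) + f (Suc k) zs (\<delta> y # as)" for x y zs
      using \<delta> by (simp add: K_linear_def tensor_linear_sym[OF f])
    show "f (Suc k) zs (\<delta> (s c x) # as) = sV c (f (Suc k) zs (\<delta> x # as))" for c x zs
      using \<delta> by (simp add: K_linear_def tensor_linear_sym[OF f])
    show "multilin (\<lambda>zs. f (Suc k) zs (\<delta> z # as))" for z
      by (rule tensor_multilin[OF f])
  qed
  show "alt_sum (\<lambda>y zs. f (Suc k) zs (\<delta> y # as)) xs = alt_sum (\<lambda>y zs. f (Suc k) zs (\<delta> y # bs)) xs"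
    if "mset as = mset bs" for k xs as bs
    by (rule alt_sum_cong, rule tensor_sym[OF E[OF \<delta>K] that])
  show "alt_sum (\<lambda>y zs. f (Suc k) zs (\<delta> y # (\<alpha> + \<beta>) # as)) xs =
      alt_sum (\<lambda>y zs. f (Suc k) zs (\<delta> y # \<alpha> # as)) xs + alt_sum (\<lambda>y zs. f (Suc k) zs (\<delta> y # \<beta> # as)) xs"
    if "\<alpha> \<in> K" "\<beta> \<in> K" for k xs \<alpha> \<beta> as
    unfolding alt_sum_add[symmetric] by (rule alt_sum_cong, rule tensor_linear_sym(1)[OF E[OF \<delta>K] that])
  show "alt_sum (\<lambda>y zs. f (Suc k) zs (\<delta> y # s c \<alpha> # as)) xs =
      sV c (alt_sum (\<lambda>y zs. f (Suc k) zs (\<delta> y # \<alpha> # as)) xs)"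
    if "\<alpha> \<in> K" for k xs \<alpha> c as
    unfolding additive_alt_sum[of "sV c", OF V.scale_right_distrib]
    by (rule alt_sum_cong, rule tensor_linear_sym(2)[OF E[OF \<delta>K] that])
qed

lemma insertion_semi: "f \<in> semi N \<Longrightarrow> insertion x f \<in> semi (N - 1)"
  unfolding semi_iff by (auto simp: insertion_tensor) (auto simp: insertion_def intro: skew_Cons)

lemma contraction_semi: "f \<in> semi N \<Longrightarrow> K_linear \<delta> \<Longrightarrow> contraction \<delta> f \<in> semi (N - 1)"
  unfolding semi_iff by (auto simp: contraction_tensor) (auto simp: contraction_def intro!: skew_alt_sum)

lemma clifford_tensor: "f \<in> tensors N \<Longrightarrow> clifford x f \<in> tensors (N - 1)"
  unfolding clifford_def by (intro tensor_diff insertion_tensor tensor_scale contraction_tensor K_linear_h)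

lemma clifford_semi: "f \<in> semi N \<Longrightarrow> clifford x f \<in> semi (N - 1)"
  unfolding clifford_def by (intro semi_diff insertion_semi semi_scale contraction_semi K_linear_h)

lemma insertion_hemi:
  assumes "f \<in> hemi N" shows "insertion x f \<in> hemi (N - 1)"
proof -
  have "f k (x # us @ y # z # vs) as + f k (x # us @ z # y # vs) as =
      - f (Suc k) (x # us @ vs) (h y z # as)" for k us y z vs as
    using assms unfolding hemi_iff by (metis append_Cons)
  with assms show ?thesis unfolding hemi_iff by (auto simp: insertion_tensor) (simp add: insertion_def)
qed

lemma hemi_skew: "f \<in> hemi N \<Longrightarrow> f k (x # y # vs) as + f k (y # x # vs) as = - f (Suc k) vs (h x y # as)"
  unfolding hemi_iff by (metis append_Nil)

section \<open>The Wick isomorphism\<close>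

lemma clifford_apply:
  "clifford x f k xs as = f k (x # xs) as - sV (1 / 2) (alt_sum (\<lambda>y zs. f (Suc k) zs (h x y # as)) xs)"
  by (simp add: clifford_def insertion_def contraction_def scale_family_def)

lemma clifford_add: "clifford x (f + g) = clifford x f + clifford x g"
  by (simp add: fun_eq_iff clifford_apply alt_sum_add V.scale_right_distrib)

lemma clifford_scale: "clifford x (scale_family c f) = scale_family c (clifford x f)"
  by (simp add: fun_eq_iff clifford_apply scale_family_def V.scale_right_diff_distrib
      additive_alt_sum[of "sV c", OF V.scale_right_distrib, symmetric] mult.commute)

lemma wick_add: "wick (f + g) k xs as = wick f k xs as + wick g k xs as"
  by (induction xs arbitrary: f g) (simp_all add: clifford_add)

lemma wick_scale: "wick (scale_family c f) k xs as = sV c (wick f k xs as)"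
proof (induction xs arbitrary: f)
  case Nil
  then show ?case by (simp add: scale_family_def)
qed (simp add: clifford_scale)

lemma wick_minus: "wick (- f) k xs as = - wick f k xs as"
  using wick_scale[of "- 1" f k xs as] by (simp add: scale_family_minus_one)

lemma wick_diff: "wick (f - g) k xs as = wick f k xs as - wick g k xs as"
  using wick_add[of f "- g" k xs as] by (simp add: wick_minus)

lemma clifford_add_left: "f \<in> tensors N \<Longrightarrow> clifford (x + y) f = clifford x f + clifford y f"
  by (simp add: fun_eq_iff clifford_apply tensor_linear_head tensor_linear_sym h_simps h_in_K alt_sum_add
      V.scale_right_distrib)

lemma clifford_scale_left: "f \<in> tensors N \<Longrightarrow> clifford (s c x) f = scale_family c (clifford x f)"
  by (simp add: fun_eq_iff clifford_apply tensor_linear_head tensor_linear_sym h_simps h_in_K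
      scale_family_def V.scale_right_diff_distrib
      additive_alt_sum[of "sV c", OF V.scale_right_distrib, symmetric] mult.commute)

lemma half_add: "sV (1 / 2) v + sV (1 / 2) v = v"
  by (simp flip: V.scale_left_distrib)

text \<open>
  The defining relation \<open>x y + y x = - h(x, y)\<close> holds in the Clifford action: insertions anticommute, contractions
  anticommute, and an insertion of \<open>x\<close> and a contraction with \<open>h(y, _)\<close> anticommute up to \<open>h(x, y)\<close>.
\<close>

lemma clifford_anticommute:
  assumes f: "f \<in> semi N"
  shows "clifford y (clifford x f) + clifford x (clifford y f) = - evaluation (h x y) f"
proof (intro ext)
  fix k zs as
  have T: "f \<in> tensors N" and sk: "skew (\<lambda>xs. f k xs as)" using f by (simp_all add: semi_iff)
  define c where "c = sV (1 / 2)"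
  have c: "c (u - v) = c u - c v" "c (- u) = - c u" for u v by (simp_all add: c_def V.scale_right_diff_distrib)
  define A where "A x y = alt_sum (\<lambda>z ws. f (Suc k) (x # ws) (h y z # as)) zs" for x y
  define B where "B x y = alt_sum (\<lambda>z ws. alt_sum (\<lambda>w vs. f (Suc (Suc k)) vs (h x w # h y z # as)) ws) zs" for x y
  have *: "clifford y (clifford x f) k zs as =
      f k (x # y # zs) as - c (f (Suc k) zs (h x y # as)) + c (A y x) - c (A x y) + c (c (B x y))" for x y
    unfolding A_def B_def
    by (simp add: clifford_apply c_def[symmetric] alt_sum_diff c additive_alt_sum[of c, symmetric]
        additive_alt_sum[of "sV (1/2)", OF V.scale_right_distrib, folded c_def, symmetric])
  have "B x y = - alt_sum (\<lambda>w ws. alt_sum (\<lambda>z vs. f (Suc (Suc k)) vs (h x w # h y z # as)) ws) zs"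
    unfolding B_def by (rule alt_sum_swap)
  also have "\<dots> = - B y x"
    unfolding B_def by (intro arg_cong[where f = uminus] alt_sum_cong tensor_sym[OF T]) simp
  finally have B: "B x y = - B y x" .
  have "f k (x # y # zs) as = - f k (y # x # zs) as" by (rule skew_head[OF sk])
  moreover have "f (Suc k) zs (h y x # as) = f (Suc k) zs (h x y # as)" by (simp only: h_commute)
  moreover have "c v + c v = v" for v by (simp add: c_def half_add)
  ultimately show "(clifford y (clifford x f) + clifford x (clifford y f)) k zs as = (- evaluation (h x y) f) k zs as"
    unfolding plus_fun_apply * by (simp add: B c evaluation_def add_eq_0_iff algebra_simps)
qed

lemma clifford_evaluation: "f \<in> tensors N \<Longrightarrow> clifford x (evaluation \<alpha> f) = evaluation \<alpha> (clifford x f)"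
proof (intro ext)
  fix k xs as
  assume T: "f \<in> tensors N"
  have "f (Suc (Suc k)) zs (\<alpha> # h x y # as) = f (Suc (Suc k)) zs (h x y # \<alpha> # as)" for y zs
    by (rule tensor_sym[OF T]) simp
  then show "clifford x (evaluation \<alpha> f) k xs as = evaluation \<alpha> (clifford x f) k xs as"
    by (simp add: clifford_apply evaluation_def)
qed

lemma wick_evaluation: "f \<in> tensors N \<Longrightarrow> wick (evaluation \<alpha> f) k xs as = wick f (Suc k) xs (\<alpha> # as)"
proof (induction xs arbitrary: f N)
  case Nil
  then show ?case by (simp add: evaluation_def)
next
  case (Cons x xs)
  then show ?case using Cons.IH[OF clifford_tensor[OF Cons.prems]] by (simp add: clifford_evaluation)
qed

lemma wick_tensor:
  assumes f: "f \<in> tensors N"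
  shows "wick f \<in> tensors N"
proof (rule tensorI)
  show "wick f k xs as = 0" if "\<not> dom N k xs as" for k xs as using f that
  proof (induction xs arbitrary: f N)
    case (Cons x xs)
    have "\<not> dom (N - 1) k xs as" using Cons.prems(2) by (auto simp: dom_simps)
    from Cons.IH[OF clifford_tensor[OF Cons.prems(1)] this] show ?case by simp
  qed (simp add: domE)
  show "multilin (\<lambda>xs. wick f k xs as)" for k as
    unfolding multilin_def
  proof (intro conjI allI)
    show "wick f k (us @ (x + y) # vs) as = wick f k (us @ x # vs) as + wick f k (us @ y # vs) as"
      for us x y vs using f
    proof (induction us arbitrary: f N)
      case Nil
      then show ?case by (simp add: clifford_add_left wick_add)
    next
      case (Cons u us)
      from Cons.IH[OF clifford_tensor[OF Cons.prems]] show ?case by simp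
    qed
    show "wick f k (us @ s c x # vs) as = sV c (wick f k (us @ x # vs) as)"
      for us c x vs using f
    proof (induction us arbitrary: f N)
      case Nil
      then show ?case by (simp add: clifford_scale_left wick_scale)
    next
      case (Cons u us)
      from Cons.IH[OF clifford_tensor[OF Cons.prems]] show ?case by simp
    qed
  qed
  show "wick f k xs as = wick f k xs bs" if "mset as = mset bs" for k xs as bs using f
  proof (induction xs arbitrary: f N)
    case Nil
    show ?case using tensor_sym[OF Nil that] by simp
  next
    case (Cons x xs)
    from Cons.IH[OF clifford_tensor[OF Cons.prems]] show ?case by simp
  qed
  show "wick f k xs ((\<alpha> + \<beta>) # as) = wick f k xs (\<alpha> # as) + wick f k xs (\<beta> # as)"
    if "\<alpha> \<in> K" "\<beta> \<in> K" for k xs \<alpha> \<beta> as using f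
  proof (induction xs arbitrary: f N)
    case Nil
    show ?case using tensor_linear_sym(1)[OF Nil that] by simp
  next
    case (Cons x xs)
    from Cons.IH[OF clifford_tensor[OF Cons.prems]] show ?case by simp
  qed
  show "wick f k xs (s c \<alpha> # as) = sV c (wick f k xs (\<alpha> # as))"
    if "\<alpha> \<in> K" for k xs \<alpha> c as using f
  proof (induction xs arbitrary: f N)
    case Nil
    show ?case using tensor_linear_sym(2)[OF Nil that] by simp
  next
    case (Cons x xs)
    from Cons.IH[OF clifford_tensor[OF Cons.prems]] show ?case by simp
  qed
qed

text \<open>
  Exchanging two adjacent arguments of \<open>wick f\<close> amounts to the relation of the algebra, multiplied from both sides by
  the remaining arguments.
\<close>

lemma wick_hemi:
  assumes f: "f \<in> semi N"
  shows "wick f \<in> hemi N"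
proof -
  have "wick f k (us @ x # y # vs) as + wick f k (us @ y # x # vs) as =
      - wick f (Suc k) (us @ vs) (h x y # as)" for k us x y vs as
    using f
  proof (induction us arbitrary: f N)
    case Nil
    have "wick f k (x # y # vs) as + wick f k (y # x # vs) as =
        wick (clifford y (clifford x f) + clifford x (clifford y f)) k vs as"
      by (simp add: wick_add)
    also have "\<dots> = - wick (evaluation (h x y) f) k vs as"
      unfolding clifford_anticommute[OF Nil] by (rule wick_minus)
    also have "\<dots> = - wick f (Suc k) vs (h x y # as)"
      using Nil wick_evaluation[of f N "h x y"] unfolding semi_iff by simp
    finally show ?case by simp
  next
    case (Cons u us)
    from Cons.IH[OF clifford_semi[OF Cons.prems]] show ?case by simp
  qed
  moreover have "wick f \<in> tensors N" using f by (simp add: semi_iff wick_tensor)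
  ultimately show ?thesis unfolding hemi_iff by blast
qed

text \<open>
  Contractions raise the number of arguments from \<open>K\<close>, so they do not contribute to the
  component with the most such arguments. Hence \<open>wick\<close> is unitriangular.
\<close>

lemma wick_top:
  "(\<And>l xs as. k < l \<Longrightarrow> f l xs as = 0) \<Longrightarrow> wick f k xs as = f k xs as"
proof (induction xs arbitrary: f)
  case (Cons x xs)
  have "wick (clifford x f) k xs as = clifford x f k xs as"
    by (rule Cons.IH) (simp add: clifford_apply Cons.prems)
  then show ?case by (simp add: clifford_apply Cons.prems)
qed simp

lemma dom_bound: "dom N k xs as \<Longrightarrow> k \<le> nat N"
  by (auto simp: dom_simps)

lemma wick_injective:
  assumes off: "\<And>k xs as. \<not> dom N k xs as \<Longrightarrow> f k xs as = 0" and 0: "wick f = 0"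
  shows "f = 0"
proof -
  \<comment> \<open>downward induction on \<open>k\<close>, starting above all components of the domain\<close>
  have "\<forall>k xs as. nat N < k + j \<longrightarrow> f k xs as = 0" for j
  proof (induction j)
    case 0
    then show ?case using off dom_bound by (metis add.right_neutral leD)
  next
    case (Suc j)
    show ?case
    proof (intro allI impI)
      fix k xs as
      assume k: "nat N < k + Suc j"
      have "wick f k xs as = f k xs as"
        by (rule wick_top) (use Suc k in simp)
      then show "f k xs as = 0" by (simp add: 0)
    qed
  qed
  from this[of "Suc (nat N)"] show ?thesis by (simp add: fun_eq_iff)
qed

text \<open>
  The component of a hemistrict family with the most arguments from \<open>K\<close> is skew-symmetric, so it is a
  semistrict family by itself. Subtracting its image leaves a family with fewer components.
\<close>

lemma wick_surjective:
  assumes "g \<in> hemi N"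
  shows "\<exists>f \<in> semi N. wick f = g"
proof -
  have "\<exists>f \<in> semi N. wick f = g" if "g \<in> hemi N" "\<And>k xs as. b \<le> k \<Longrightarrow> g k xs as = 0" for b g
    using that
  proof (induction b arbitrary: g)
    case 0
    have "wick 0 = 0"
      using wick_scale[of 0 0] by (auto simp: fun_eq_iff scale_family_def zero_fun_def)
    moreover have "g = 0" using 0 by (simp add: fun_eq_iff)
    ultimately show ?case using semi_zero by blast
  next
    case (Suc b)
    \<comment> \<open>the top component of \<open>g\<close>, extended by zero\<close>
    define f where "f = (\<lambda>k. if k = b then g b else 0)"
    have T: "g \<in> tensors N" using Suc.prems(1) by (simp add: hemi_iff)
    have sk: "skew (\<lambda>xs. g b xs as)" for as
      using Suc.prems(1) Suc.prems(2)[of "Suc b"] unfolding hemi_iff skew_def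
      by (metis (no_types, lifting) eq_neg_iff_add_eq_0 neg_0_equal_iff_equal order_refl)
    have fT: "f \<in> tensors N"
      using T tensor_zero[of N] by (simp add: tensors_def f_def)
    have f: "f \<in> semi N"
      unfolding semi_iff
    proof (intro conjI allI fT)
      show "skew (\<lambda>xs. f k xs as)" for k as
        using sk by (cases "k = b") (simp_all add: f_def skew_zero)
    qed
    have w: "wick f k xs as = g k xs as" if "b \<le> k" for k xs as
    proof -
      have "wick f k xs as = f k xs as" using that by (intro wick_top) (simp add: f_def)
      then show ?thesis using that Suc.prems(2)[of k xs as] by (auto simp: f_def)
    qed
    have "g - wick f \<in> hemi N"
      by (intro hemi_diff_closed Suc.prems(1) wick_hemi f)
    moreover have "(g - wick f) k xs as = 0" if "b \<le> k" for k xs as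
      using w[OF that] by simp
    ultimately have "\<exists>f' \<in> semi N. wick f' = g - wick f" by (rule Suc.IH)
    then obtain f' where f': "f' \<in> semi N" "wick f' = g - wick f" by blast
    have "wick (f + f') = g"
      using f'(2) by (simp add: fun_eq_iff wick_add)
    then show ?case using semi_add[OF f f'(1)] by blast
  qed
  moreover have "g k xs as = 0" if "Suc (nat N) \<le> k" for k xs as
    using that assms dom_bound[of N k xs as] domE[of N k xs as g] by (auto simp: hemi_iff)
  ultimately show ?thesis using assms by blast
qed

section \<open>The two differentials\<close>

text \<open>
  The binary and the ternary bracket of the semistrict Lie 2-algebra.
\<close>

definition skew_br :: "'g \<Rightarrow> 'g \<Rightarrow> 'g" where
  "skew_br x y = s (1 / 2) (br x y - br y x)"

definition jac3 :: "'g \<Rightarrow> 'g \<Rightarrow> 'g \<Rightarrow> 'g" where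
  "jac3 x y z = - s (1 / 12) (h (br x y - br y x) z + h (br y z - br z y) x + h (br z x - br x z) y)"

text \<open>
  The five parts of the semistrict differential; the first two also occur in the hemistrict one.
\<close>

definition act_part :: "('g, 'g, 'v) family \<Rightarrow> ('g, 'g, 'v) family" where
  "act_part f k xs as = alt_sum (\<lambda>x ys. \<rho> x (f k ys as)) xs"

definition koszul_part :: "('g, 'g, 'v) family \<Rightarrow> ('g, 'g, 'v) family" where
  "koszul_part f k xs as = pick_sum (\<lambda>\<alpha> bs. f (k - 1) (\<alpha> # xs) bs) as"

definition bracket_part :: "('g, 'g, 'v) family \<Rightarrow> ('g, 'g, 'v) family" where
  "bracket_part f k xs as = alt_sum2 (\<lambda>x y ys. f k (skew_br x y # ys) as) xs"

definition mixed_part :: "('g, 'g, 'v) family \<Rightarrow> ('g, 'g, 'v) family" where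
  "mixed_part f k xs as = alt_sum (\<lambda>x ys. der_sum (\<lambda>\<alpha>. - s (1 / 2) (br x \<alpha>)) (f k ys) as) xs"

definition ternary_part :: "('g, 'g, 'v) family \<Rightarrow> ('g, 'g, 'v) family" where
  "ternary_part f k xs as = alt_sum3 (\<lambda>x y z ys. f (Suc k) ys (jac3 x y z # as)) xs"

definition semi_raw :: "('g, 'g, 'v) family \<Rightarrow> ('g, 'g, 'v) family" where
  "semi_raw f k xs as = koszul_part f k xs as + act_part f k xs as + bracket_part f k xs as + mixed_part f k xs as + ternary_part f k xs as"

definition hemi_raw :: "('g, 'g, 'v) family \<Rightarrow> ('g, 'g, 'v) family" where
  "hemi_raw f k xs as = koszul_part f k xs as + act_part f k xs as + bracket_sum br (\<lambda>ys. f k ys as) xs"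

text \<open>
  The Lie derivative of a family along \<open>x\<close>, for the adjoint action \<open>[x, _]\<close> on both kinds of arguments.
\<close>

definition lie_der :: "'g \<Rightarrow> ('g, 'g, 'v) family \<Rightarrow> ('g, 'g, 'v) family" where
  "lie_der x f k xs as = \<rho> x (f k xs as) - der_sum (br x) (\<lambda>zs. f k zs as) xs - der_sum (br x) (f k xs) as"

lemma semi_diff_part_eq: "semi_diff_part (G_of s br) sV \<rho> f k xs as = semi_raw f k xs as"
proof -
  have G: "dL (G_of s br) = (\<lambda>\<alpha>. \<alpha>)" "l2_00 (G_of s br) = skew_br" "l2_m0 (G_of s br) = (\<lambda>\<alpha> x. - s (1 / 2) (br x \<alpha>))"
    "semistrict.l3 (G_of s br) = jac3"
    by (simp_all add: G_of_def L_of_def Let_def skew_br_def jac3_def fun_eq_iff)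
  show ?thesis
    unfolding semi_diff_part_def semi_raw_def koszul_part_def act_part_def bracket_part_def mixed_part_def ternary_part_def G
    unfolding V.alt_sum_eq[symmetric] V.alt_sum2_eq[symmetric] V.alt_sum3_eq[symmetric]
      pick_sum_eq[symmetric] der_sum_eq[symmetric] V.scale_sum_right
    by (rule refl)
qed

lemma tensor_zero_arg:
  assumes f: "f \<in> tensors N" and j: "j < length as"
  shows "f k xs (as[j := 0]) = 0"
proof -
  have "f k xs (as[j := 0]) = f k xs (0 # take j as @ drop (Suc j) as)"
    by (rule tensor_sym[OF f]) (simp add: upd_conv_take_nth_drop[OF j])
  also have "\<dots> = 0"
    using tensor_linear_sym(2)[OF f K_closed(3), where c = 0] by simp
  finally show ?thesis .
qed

text \<open>
  Since \<open>[K, \<gg>] = 0\<close>, the terms of the differential with \<open>[\<alpha>\<^sub>j, x\<^sub>i]\<close> vanish.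
\<close>

lemma hemi_diff_part_eq:
  assumes f: "f \<in> tensors N" and as: "set as \<subseteq> K"
  shows "hemi_diff_part (L_of s br) sV \<rho> f k xs as = hemi_raw f k xs as"
proof -
  have L: "dL (L_of s br) = (\<lambda>\<alpha>. \<alpha>)" "br_00 (L_of s br) = br" "br_m0 (L_of s br) = br"
    by (simp_all add: L_of_def)
  have "(\<Sum>i<length xs. \<Sum>j<length as. sV ((-1) ^ i)
        (f k (omit {i} xs) (as[j := br (as ! j) (xs ! i)]))) = 0"
    using as by (intro sum.neutral ballI) (simp add: kernel_br subset_iff tensor_zero_arg[OF f])
  then show ?thesis
    unfolding hemi_diff_part_def hemi_raw_def koszul_part_def act_part_def L
    unfolding V.alt_sum_eq[symmetric] V.bracket_sum_eq[symmetric] pick_sum_eq[symmetric]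
    by simp
qed

text \<open>
  For \<open>\<alpha> \<in> K\<close>, \<open>h(x, \<alpha>) = [x, \<alpha>]\<close> because \<open>[\<alpha>, x] = 0\<close>.
\<close>

lemma pick_sum_h:
  assumes f: "f \<in> tensors N" and as: "set as \<subseteq> K"
  shows "pick_sum (\<lambda>\<alpha> bs. f k xs (h x \<alpha> # bs)) as = der_sum (br x) (f k xs) as"
proof -
  have "pick_sum (\<lambda>\<alpha> bs. f k xs (h x \<alpha> # bs)) as = pick_sum (\<lambda>\<alpha> bs. f k xs (br x \<alpha> # bs)) as"
    using as by (intro pick_sum_cong) (simp add: kernel_br subset_iff)
  also have "\<dots> = der_sum (br x) (f k xs) as"
    by (rule pick_sum_der_sum[OF tensor_sym[OF f]])
  finally show ?thesis .
qed

lemma der_sum_plus: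
  assumes "multilin g"
  shows "der_sum (\<lambda>y. \<delta> y + \<epsilon> y) g xs = der_sum \<delta> g xs + der_sum \<epsilon> g xs"
  using assms
proof (induction xs arbitrary: g)
  case (Cons x xs)
  then show ?case
    using Cons.IH[OF multilin_Cons[OF Cons.prems]] multilin_head(1)[OF Cons.prems] by (simp add: algebra_simps)
qed simp

lemma der_sum_scale:
  assumes "multilin g"
  shows "der_sum (\<lambda>y. s c (\<delta> y)) g xs = sV c (der_sum \<delta> g xs)"
  using assms
proof (induction xs arbitrary: g)
  case (Cons x xs)
  then show ?case
    using Cons.IH[OF multilin_Cons[OF Cons.prems]] multilin_head(2)[OF Cons.prems]
    by (simp add: V.scale_right_distrib)
qed simp

section \<open>Cartan formulas\<close>

text \<open>
  All terms involving the first argument \<open>x\<close> make up the Lie derivative. Its part on arguments from \<open>K\<close> arises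
  when \<open>\<alpha>\<close> is moved behind \<open>x\<close>, which costs \<open>h(\<alpha>, x) = [x, \<alpha>]\<close>.
\<close>

lemma hemi_cartan:
  assumes f: "f \<in> hemi N" and as: "length as = k" "set as \<subseteq> K"
  shows "hemi_raw f k (x # xs) as = lie_der x f k xs as - hemi_raw (insertion x f) k xs as"
proof -
  have T: "f \<in> tensors N" using f unfolding hemi_iff by blast
  have "koszul_part f k (x # xs) as = - koszul_part (insertion x f) k xs as - der_sum (br x) (f k xs) as"
  proof (cases "as = []")
    case False
    then have k: "Suc (k - 1) = k" using as by (cases k) auto
    have "f (k - 1) (\<alpha> # x # xs) bs = - f (k - 1) (x # \<alpha> # xs) bs - f k xs (h x \<alpha> # bs)" for \<alpha> bs
      using hemi_skew[OF f, of "k - 1" x \<alpha> xs bs] unfolding k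
      by (simp add: eq_diff_eq eq_neg_iff_add_eq_0 add_ac)
    then have "koszul_part f k (x # xs) as = - koszul_part (insertion x f) k xs as - pick_sum (\<lambda>\<alpha> bs. f k xs (h x \<alpha> # bs)) as"
      by (simp add: koszul_part_def insertion_def pick_sum_diff additive_pick_sum[of uminus, OF minus_add_distrib, symmetric])
    then show ?thesis by (simp only: pick_sum_h[OF T as(2)])
  qed (simp add: koszul_part_def)
  then show ?thesis
    by (simp add: hemi_raw_def lie_der_def act_part_def insertion_def)
qed

lemma skew_br_plus_half_h: "skew_br x y + s (1 / 2) (h x y) = br x y"
proof -
  have "skew_br x y + s (1 / 2) (h x y) = s (1 / 2) (br x y) + s (1 / 2) (br x y)"
    by (simp add: skew_br_def scale_right_distrib scale_right_diff_distrib)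
  also have "\<dots> = br x y" by (simp flip: scale_left_distrib)
  finally show ?thesis .
qed

text \<open>
  The insertion half of the Cartan formula: only terms that involve \<open>x\<close> survive. They
  contain the skew-symmetrized bracket, half the action on \<open>K\<close>, and the ternary bracket.
\<close>

lemma semi_raw_insertion:
  assumes f: "f \<in> semi N"
  shows "semi_raw f k (x # xs) as + semi_raw (insertion x f) k xs as =
      \<rho> x (f k xs as) - der_sum (skew_br x) (\<lambda>zs. f k zs as) xs
      + der_sum (\<lambda>\<alpha>. - s (1 / 2) (br x \<alpha>)) (f k xs) as
      - alt_sum2 (\<lambda>y z zs. f (Suc k) zs (jac3 x y z # as)) xs"
proof -
  have sk: "skew (\<lambda>xs. f k xs as)" for k as using f by (simp add: semi_iff)
  have "koszul_part f k (x # xs) as = pick_sum (\<lambda>\<alpha> bs. - f (k - 1) (x # \<alpha> # xs) bs) as"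
    unfolding koszul_part_def by (rule pick_sum_cong) (rule skew_head[OF sk])
  then have 0: "koszul_part f k (x # xs) as + koszul_part (insertion x f) k xs as = 0"
    by (simp add: koszul_part_def insertion_def additive_pick_sum[of uminus, OF minus_add_distrib, symmetric])
  have 1: "act_part f k (x # xs) as + act_part (insertion x f) k xs as = \<rho> x (f k xs as)"
    by (simp add: act_part_def insertion_def)
  have "alt_sum2 (\<lambda>y z zs. f k (skew_br y z # x # zs) as) xs = alt_sum2 (\<lambda>y z zs. - f k (x # skew_br y z # zs) as) xs"
    by (subst skew_head[OF sk]) (rule refl)
  moreover have "alt_sum (\<lambda>y zs. f k (skew_br x y # zs) as) xs = der_sum (skew_br x) (\<lambda>zs. f k zs as) xs"
    by (rule skew_der_sum[OF sk])
  ultimately have 2: "bracket_part f k (x # xs) as + bracket_part (insertion x f) k xs as = - der_sum (skew_br x) (\<lambda>zs. f k zs as) xs"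
    by (simp add: bracket_part_def insertion_def alt_sum2_minus)
  have 3: "mixed_part f k (x # xs) as + mixed_part (insertion x f) k xs as = der_sum (\<lambda>\<alpha>. - s (1 / 2) (br x \<alpha>)) (f k xs) as"
    by (simp add: mixed_part_def insertion_def)
  have 4: "ternary_part f k (x # xs) as + ternary_part (insertion x f) k xs as = - alt_sum2 (\<lambda>y z zs. f (Suc k) zs (jac3 x y z # as)) xs"
    by (simp add: ternary_part_def insertion_def)
  have "semi_raw f k (x # xs) as + semi_raw (insertion x f) k xs as =
      (koszul_part f k (x # xs) as + koszul_part (insertion x f) k xs as) + (act_part f k (x # xs) as + act_part (insertion x f) k xs as)
      + (bracket_part f k (x # xs) as + bracket_part (insertion x f) k xs as) + (mixed_part f k (x # xs) as + mixed_part (insertion x f) k xs as)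
      + (ternary_part f k (x # xs) as + ternary_part (insertion x f) k xs as)"
    by (simp add: semi_raw_def)
  then show ?thesis by (simp only: 0 1 2 3 4) simp
qed

text \<open>
  The contraction half of the Cartan formula. Terms in which the contraction does not interact with the
  differential cancel by the Fubini rules for alternating sums. What remains are the terms in which the argument
  produced by one operation is consumed by the other.
\<close>

lemma semi_raw_contraction:
  assumes f: "f \<in> semi N" and as: "length as = k" "set as \<subseteq> K"
  shows "semi_raw (contraction (h x) f) k xs as + alt_sum (\<lambda>y zs. semi_raw f (Suc k) zs (h x y # as)) xs =
      der_sum (br x) (f k xs) as + der_sum (h x) (\<lambda>zs. f k zs as) xs
      + alt_sum2 (\<lambda>y z zs. f (Suc k) zs (h x (skew_br y z) # as)) xs
      - alt_sum2 (\<lambda>y z zs. f (Suc k) zs (- s (1 / 2) (br z (h x y)) # as)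
                       - f (Suc k) zs (- s (1 / 2) (br y (h x z)) # as)) xs"
proof -
  have T: "f \<in> tensors N" and sk: "skew (\<lambda>xs. f k xs as)" for k as using f by (simp_all add: semi_iff)
  let ?S = "alt_sum :: ('g \<Rightarrow> 'g list \<Rightarrow> 'v) \<Rightarrow> 'g list \<Rightarrow> 'v"
  have 0: "koszul_part (contraction (h x) f) k xs as + ?S (\<lambda>y zs. koszul_part f (Suc k) zs (h x y # as)) xs =
      der_sum (br x) (f k xs) as + der_sum (h x) (\<lambda>zs. f k zs as) xs"
  proof -
    have "koszul_part (contraction (h x) f) k xs as = pick_sum (\<lambda>\<alpha> bs. f k xs (h x \<alpha> # bs)
        - ?S (\<lambda>y zs. f k (\<alpha> # zs) (h x y # bs)) xs) as"
    proof (cases "as = []")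
      case False
      then have "Suc (k - 1) = k" using as by (cases k) auto
      then show ?thesis by (simp add: koszul_part_def contraction_def)
    qed (simp add: koszul_part_def)
    also have "\<dots> = der_sum (br x) (f k xs) as - ?S (\<lambda>y zs. pick_sum (\<lambda>\<alpha> bs. f k (\<alpha> # zs) (h x y # bs)) as) xs"
      by (simp only: pick_sum_diff pick_sum_h[OF T as(2)] alt_sum_pick_sum)
    finally show ?thesis
      by (simp add: koszul_part_def alt_sum_add skew_der_sum[OF sk])
  qed
  have 1: "act_part (contraction (h x) f) k xs as + ?S (\<lambda>y zs. act_part f (Suc k) zs (h x y # as)) xs = 0"
  proof -
    have "act_part (contraction (h x) f) k xs as =
        ?S (\<lambda>y zs. ?S (\<lambda>w vs. \<rho> y (f (Suc k) vs (h x w # as))) zs) xs"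
      by (simp add: act_part_def contraction_def additive_alt_sum[of "\<rho> y" for y, OF \<rho>_add])
    also have "\<dots> = - ?S (\<lambda>w zs. ?S (\<lambda>y vs. \<rho> y (f (Suc k) vs (h x w # as))) zs) xs"
      by (rule alt_sum_swap)
    finally show ?thesis by (simp add: act_part_def)
  qed
  have 2: "bracket_part (contraction (h x) f) k xs as + ?S (\<lambda>y zs. bracket_part f (Suc k) zs (h x y # as)) xs =
      alt_sum2 (\<lambda>y z zs. f (Suc k) zs (h x (skew_br y z) # as)) xs"
    using alt_sum2_alt_sum[of "\<lambda>y z w vs. f (Suc k) (skew_br y z # vs) (h x w # as)" xs]
    by (simp add: bracket_part_def contraction_def alt_sum2_diff)
  have 3: "mixed_part (contraction (h x) f) k xs as + ?S (\<lambda>y zs. mixed_part f (Suc k) zs (h x y # as)) xs =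
      - alt_sum2 (\<lambda>y z zs. f (Suc k) zs (- s (1 / 2) (br z (h x y)) # as)
                       - f (Suc k) zs (- s (1 / 2) (br y (h x z)) # as)) xs"
  proof -
    have "mixed_part (contraction (h x) f) k xs as = ?S (\<lambda>y zs. ?S (\<lambda>w vs. der_sum (\<lambda>\<alpha>. - s (1 / 2) (br y \<alpha>))
        (\<lambda>bs. f (Suc k) vs (h x w # bs)) as) zs) xs"
      unfolding mixed_part_def contraction_def alt_sum_der_sum by (rule refl)
    also have "\<dots> = - ?S (\<lambda>w zs. ?S (\<lambda>y vs. der_sum (\<lambda>\<alpha>. - s (1 / 2) (br y \<alpha>))
        (\<lambda>bs. f (Suc k) vs (h x w # bs)) as) zs) xs"
      by (rule alt_sum_swap)
    finally show ?thesis
      using alt_sum_alt_sum[of "\<lambda>y z zs. f (Suc k) zs (- s (1 / 2) (br z (h x y)) # as)" xs]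
      by (simp add: mixed_part_def alt_sum_add)
  qed
  have 4: "ternary_part (contraction (h x) f) k xs as + ?S (\<lambda>y zs. ternary_part f (Suc k) zs (h x y # as)) xs = 0"
  proof -
    have "f (Suc (Suc k)) vs (jac3 a b c # h x w # as) = f (Suc (Suc k)) vs (h x w # jac3 a b c # as)"
      for vs a b c w by (rule tensor_sym[OF T]) simp
    then show ?thesis
      using alt_sum3_alt_sum[of "\<lambda>a b c w vs. f (Suc (Suc k)) vs (h x w # jac3 a b c # as)" xs]
      by (simp add: ternary_part_def contraction_def)
  qed
  have "semi_raw (contraction (h x) f) k xs as + ?S (\<lambda>y zs. semi_raw f (Suc k) zs (h x y # as)) xs =
      (koszul_part (contraction (h x) f) k xs as + ?S (\<lambda>y zs. koszul_part f (Suc k) zs (h x y # as)) xs)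
      + (act_part (contraction (h x) f) k xs as + ?S (\<lambda>y zs. act_part f (Suc k) zs (h x y # as)) xs)
      + (bracket_part (contraction (h x) f) k xs as + ?S (\<lambda>y zs. bracket_part f (Suc k) zs (h x y # as)) xs)
      + (mixed_part (contraction (h x) f) k xs as + ?S (\<lambda>y zs. mixed_part f (Suc k) zs (h x y # as)) xs)
      + (ternary_part (contraction (h x) f) k xs as + ?S (\<lambda>y zs. ternary_part f (Suc k) zs (h x y # as)) xs)"
    by (simp add: semi_raw_def alt_sum_add)
  then show ?thesis by (simp only: 0 1 2 3 4) simp
qed

text \<open>
  The terms with two arguments removed in the two halves of the Cartan formula cancel. Expanding everything into the
  iterated brackets \<open>[x, [y, z]]\<close>, which the Leibniz identity allows, leaves a linear identity.
\<close>

lemma jac3_identity: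
  "jac3 x y z + s (1 / 2) (h x (skew_br y z)) + s (1 / 4) (br z (h x y)) - s (1 / 4) (br y (h x z)) = 0"
proof -
  \<comment> \<open>\<open>1 / 4 = 3 / 12\<close>, so everything is an integral combination of values of \<open>u\<close>\<close>
  define u where "u = s (1 / 12)"
  have u: "u (a + b) = u a + u b" "u (a - b) = u a - u b" "u (- a) = - u a" for a b
    by (simp_all add: u_def scale_right_distrib scale_right_diff_distrib)
  have q: "s (1 / 4) a = u a + u a + u a" for a
    by (simp add: u_def flip: scale_left_distrib)
  have L: "br (br a b) c = br a (br b c) - br b (br a c)" for a b c
    using leibniz[of a b c] by simp
  have m: "br a (b - c) = br a b - br a c" "br (b - c) a = br b a - br c a" for a b c
    using br_simps(2)[of a "b - c" c] br_simps(1)[of "b - c" c a] by (simp_all add: eq_diff_eq)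
  have "s (1 / 2) (h x (skew_br y z)) = s (1 / 4) (h x (br y z - br z y))"
    by (simp add: skew_br_def br_simps scale_right_distrib)
  then show ?thesis
    unfolding jac3_def u_def[symmetric] q by (simp add: q br_simps m L u algebra_simps)
qed

lemma semi_raw_diff: "semi_raw (f - g) k xs as = semi_raw f k xs as - semi_raw g k xs as"
  by (simp add: semi_raw_def koszul_part_def act_part_def bracket_part_def mixed_part_def ternary_part_def \<rho>_simps pick_sum_diff
      alt_sum_diff alt_sum2_diff alt_sum3_diff der_sum_diff fun_diff_def)

lemma semi_raw_scale: "semi_raw (scale_family c f) k xs as = sV c (semi_raw f k xs as)"
  by (simp add: semi_raw_def koszul_part_def act_part_def bracket_part_def mixed_part_def ternary_part_def scale_family_def \<rho>_scale
      V.scale_right_distrib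
      additive_alt_sum[of "sV c", OF V.scale_right_distrib]
      additive_alt_sum2[of "sV c", OF V.scale_right_distrib]
      additive_alt_sum3[of "sV c", OF V.scale_right_distrib]
      additive_pick_sum[of "sV c", OF V.scale_right_distrib]
      additive_der_sum[of "sV c", OF V.scale_right_distrib])

lemma values_in_K: "h x y \<in> K" "jac3 x y z \<in> K" "br x (h y z) \<in> K" "s c (h x y) \<in> K"
  by (simp_all add: h_in_K jac3_def K_closed br_kernel del: scale_right_distrib)

text \<open>
  Half the contraction part completes the three terms of the insertion part: \<open>l\<^sub>2(x, y) + h(x, y) / 2 = [x, y]\<close>,
  the two halves of the action on \<open>K\<close> add up, and the ternary terms cancel.
\<close>

lemma semi_cartan:
  assumes f: "f \<in> semi N" and as: "length as = k" "set as \<subseteq> K"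
  shows "clifford x (semi_raw f) k xs as + semi_raw (clifford x f) k xs as = lie_der x f k xs as"
proof -
  have T: "f \<in> tensors N" using f by (simp add: semi_iff)
  define c where "c = sV (1 / 2)"
  have c: "c (u + v) = c u + c v" "c (u - v) = c u - c v" "c (- u) = - c u" for u v
    by (simp_all add: c_def V.scale_right_diff_distrib V.scale_right_distrib)
  define F where "F zs \<alpha> = f (Suc k) zs (\<alpha> # as)" for zs \<alpha>
  have F: "F zs (\<alpha> + \<beta>) = F zs \<alpha> + F zs \<beta>" "F zs (s t \<alpha>) = sV t (F zs \<alpha>)"
    if "\<alpha> \<in> K" "\<beta> \<in> K" for zs \<alpha> \<beta> t
    using that by (simp_all add: F_def tensor_linear_sym[OF T])
  have F': "F zs (- \<alpha>) = - F zs \<alpha>" "F zs 0 = 0" if "\<alpha> \<in> K" for zs \<alpha>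
    using F(2)[OF that that, of zs "- 1"] F(2)[OF that that, of zs 0] by simp_all
  have "clifford x (semi_raw f) k xs as + semi_raw (clifford x f) k xs as =
      (semi_raw f k (x # xs) as + semi_raw (insertion x f) k xs as)
      - c (semi_raw (contraction (h x) f) k xs as + alt_sum (\<lambda>y zs. semi_raw f (Suc k) zs (h x y # as)) xs)"
    unfolding clifford_apply[of x "semi_raw f"] clifford_def[of x f] semi_raw_diff semi_raw_scale c_def[symmetric]
    by (simp add: c)
  also have "\<dots> = \<rho> x (f k xs as)
      - (der_sum (skew_br x) (\<lambda>zs. f k zs as) xs + c (der_sum (h x) (\<lambda>zs. f k zs as) xs))
      + (der_sum (\<lambda>\<alpha>. - s (1 / 2) (br x \<alpha>)) (f k xs) as - c (der_sum (br x) (f k xs) as))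
      - (alt_sum2 (\<lambda>y z zs. F zs (jac3 x y z)) xs + c (alt_sum2 (\<lambda>y z zs. F zs (h x (skew_br y z))) xs)
         - c (alt_sum2 (\<lambda>y z zs. F zs (- s (1 / 2) (br z (h x y))) - F zs (- s (1 / 2) (br y (h x z)))) xs))"
    unfolding semi_raw_insertion[OF f] semi_raw_contraction[OF f as] F_def by (simp add: c)
  also have "der_sum (skew_br x) (\<lambda>zs. f k zs as) xs + c (der_sum (h x) (\<lambda>zs. f k zs as) xs) =
      der_sum (br x) (\<lambda>zs. f k zs as) xs"
    unfolding c_def der_sum_scale[OF tensor_multilin[OF T], symmetric] der_sum_plus[OF tensor_multilin[OF T], symmetric]
      skew_br_plus_half_h by (rule refl)
  also have "der_sum (\<lambda>\<alpha>. - s (1 / 2) (br x \<alpha>)) (f k xs) as - c (der_sum (br x) (f k xs) as) =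
      - der_sum (br x) (f k xs) as"
  proof -
    have "der_sum (\<lambda>\<alpha>. - s (1 / 2) (br x \<alpha>)) (f k xs) as
        = pick_sum (\<lambda>\<alpha> bs. f k xs (- s (1 / 2) (br x \<alpha>) # bs)) as"
      by (rule pick_sum_der_sum[OF tensor_sym[OF T], symmetric])
    also have "\<dots> = pick_sum (\<lambda>\<alpha> bs. - c (f k xs (br x \<alpha> # bs))) as"
    proof (rule pick_sum_cong)
      fix \<alpha> bs assume "\<alpha> \<in> set as"
      then have "br x \<alpha> \<in> K" using as by (auto intro: br_kernel)
      then show "f k xs (- s (1 / 2) (br x \<alpha>) # bs) = - c (f k xs (br x \<alpha> # bs))"
        using tensor_linear_sym(2)[OF T, of "br x \<alpha>" k xs "- (1 / 2)" bs] by (simp add: c_def)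
    qed
    also have "\<dots> = - c (pick_sum (\<lambda>\<alpha> bs. f k xs (br x \<alpha> # bs)) as)"
      by (rule additive_pick_sum[of "\<lambda>v. - c v", symmetric]) (simp add: c)
    also have "pick_sum (\<lambda>\<alpha> bs. f k xs (br x \<alpha> # bs)) as = der_sum (br x) (f k xs) as"
      by (rule pick_sum_der_sum[OF tensor_sym[OF T]])
    finally have "der_sum (\<lambda>\<alpha>. - s (1 / 2) (br x \<alpha>)) (f k xs) as = - c (der_sum (br x) (f k xs) as)" .
    moreover have "- c v - c v = - v" for v
      using half_add[of v] unfolding c_def by (metis minus_add_distrib add_uminus_conv_diff)
    ultimately show ?thesis by (simp only:)
  qed
  also have "alt_sum2 (\<lambda>y z zs. F zs (jac3 x y z)) xs + c (alt_sum2 (\<lambda>y z zs. F zs (h x (skew_br y z))) xs)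
         - c (alt_sum2 (\<lambda>y z zs. F zs (- s (1 / 2) (br z (h x y))) - F zs (- s (1 / 2) (br y (h x z)))) xs) = 0"
  proof -
    have "F zs (jac3 x y z) + c (F zs (h x (skew_br y z)))
        - c (F zs (- s (1 / 2) (br z (h x y))) - F zs (- s (1 / 2) (br y (h x z)))) = 0" for y z zs
    proof -
      have "0 = F zs (jac3 x y z + s (1 / 2) (h x (skew_br y z)) + s (1 / 4) (br z (h x y)) + - s (1 / 4) (br y (h x z)))"
        using F'(2)[OF K_closed(3)] by (simp only: jac3_identity diff_conv_add_uminus[symmetric])
      also have "\<dots> = F zs (jac3 x y z) + c (F zs (h x (skew_br y z))) + sV (1 / 4) (F zs (br z (h x y)))
          - sV (1 / 4) (F zs (br y (h x z)))"
      proof -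
        have sK: "s t \<alpha> \<in> K" if "\<alpha> \<in> K" for t \<alpha> by (rule K_closed(2)[OF that])
        have m: "- s (1 / 4) v = s (- (1 / 4)) v" for v by simp
        note A = values_in_K(2)[of x y z] and B = sK[OF h_in_K[of x "skew_br y z"], of "1 / 2"]
          and C = sK[OF values_in_K(3)[of z x y], of "1 / 4"] and D = sK[OF values_in_K(3)[of y x z], of "- (1 / 4)"]
        show ?thesis
          unfolding m F(1)[OF K_closed(1)[OF K_closed(1)[OF A B] C] D] F(1)[OF K_closed(1)[OF A B] C]
            F(1)[OF A B] F(2)[OF h_in_K h_in_K] F(2)[OF values_in_K(3) values_in_K(3)] c_def
          by simp
      qed
      also have "\<dots> = F zs (jac3 x y z) + c (F zs (h x (skew_br y z)))
        - c (F zs (- s (1 / 2) (br z (h x y))) - F zs (- s (1 / 2) (br y (h x z))))"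
      proof -
        have "F zs (- s (1 / 2) (br a (h b d))) = - c (F zs (br a (h b d)))" for a b d
          using F(2)[OF values_in_K(3) values_in_K(3), of zs "- (1 / 2)"] by (simp add: c_def)
        then show ?thesis by (simp add: c_def V.scale_right_diff_distrib)
      qed
      finally show ?thesis by simp
    qed
    then show ?thesis
      unfolding additive_alt_sum2[of c, OF c(1)] alt_sum2_add[symmetric] alt_sum2_diff[symmetric]
      by simp
  qed
  finally show ?thesis by (simp add: lie_der_def)
qed

section \<open>Comparison of the two differentials\<close>

text \<open>
  The formulas for the differentials and Lie derivatives make sense for all arguments, but need not vanish outside the
  domain, as cochains are required to do.
\<close>

definition cutoff :: "int \<Rightarrow> ('g, 'g, 'v) family \<Rightarrow> ('g, 'g, 'v) family" where
  "cutoff N f = (\<lambda>k xs as. if dom N k xs as then f k xs as else 0)"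

definition hemiD :: "int \<Rightarrow> ('g, 'g, 'v) family \<Rightarrow> ('g, 'g, 'v) family" where
  "hemiD N f = cutoff (N + 1) (hemi_raw f)"

definition semiD :: "int \<Rightarrow> ('g, 'g, 'v) family \<Rightarrow> ('g, 'g, 'v) family" where
  "semiD N f = cutoff (N + 1) (semi_raw f)"

text \<open>
  \<open>L\<^sub>x\<close> is a derivation of the Clifford action because \<open>[x, _]\<close> is a derivation of \<open>h\<close>.
\<close>

lemma clifford_lie_der:
  assumes f: "f \<in> tensors N"
  shows "clifford y (lie_der x f) = lie_der x (clifford y f) - clifford (br x y) f"
proof (intro ext)
  fix k xs as
  define c where "c = sV (1 / 2)"
  have c: "c (u + v) = c u + c v" "c (u - v) = c u - c v" "c (- u) = - c u" for u v
    by (simp_all add: c_def V.scale_right_diff_distrib V.scale_right_distrib)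
  have \<rho>c: "\<rho> x (c v) = c (\<rho> x v)" for v by (simp add: c_def \<rho>_scale)
  have "f (Suc k) zs (br x (h y z) # as) =
      f (Suc k) zs (h (br x y) z # as) + f (Suc k) zs (h y (br x z) # as)" for zs z
    unfolding br_h by (rule tensor_linear_sym(1)[OF f h_in_K h_in_K])
  moreover have "clifford y f k xs = (\<lambda>as. f k (y # xs) as - c (alt_sum (\<lambda>z zs. f (Suc k) zs (h y z # as)) xs))"
    by (simp add: fun_eq_iff clifford_apply c_def)
  ultimately show "clifford y (lie_der x f) k xs as = (lie_der x (clifford y f) - clifford (br x y) f) k xs as"
    by (simp add: clifford_apply lie_der_def c_def[symmetric] c \<rho>c \<rho>_simps alt_sum_diff alt_sum_add der_sum_diff
        additive_der_sum[of c, OF c(1), symmetric] der_sum_alt_sum alt_sum_der_sum[symmetric]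
        additive_alt_sum[of "\<rho> x", OF \<rho>_add])
qed

lemma lie_der_Cons: "lie_der x f k (y # xs) as = lie_der x (insertion y f) k xs as - f k (br x y # xs) as"
  by (simp add: lie_der_def insertion_def)

lemma wick_lie_der:
  assumes "f \<in> tensors N"
  shows "wick (lie_der x f) k xs as = lie_der x (wick f) k xs as"
  using assms
proof (induction xs arbitrary: f N)
  case Nil
  then show ?case by (simp add: lie_der_def)
next
  case (Cons y xs)
  have "wick (lie_der x f) k (y # xs) as = lie_der x (wick (clifford y f)) k xs as - wick (clifford (br x y) f) k xs as"
    using Cons.IH[OF clifford_tensor[OF Cons.prems]] by (simp add: clifford_lie_der[OF Cons.prems] wick_diff)
  moreover have "insertion y (wick f) = wick (clifford y f)" by (simp add: insertion_def fun_eq_iff)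
  ultimately show ?case by (simp only: lie_der_Cons wick.simps)
qed

lemma clifford_cong:
  assumes "\<And>k ys as. dom M k ys as \<Longrightarrow> f k ys as = g k ys as" and d: "dom (M - 1) k ys as"
  shows "clifford x f k ys as = clifford x g k ys as"
proof -
  have "alt_sum (\<lambda>y zs. f (Suc k) zs (h x y # as)) ys = alt_sum (\<lambda>y zs. g (Suc k) zs (h x y # as)) ys"
  proof (rule alt_sum_cong, rule assms(1))
    show "dom M (Suc k) zs (h x y # as)" if "length ys = Suc (length zs)" for y zs
      unfolding dom_Suc[OF h_in_K] using d that by (auto simp: dom_simps)
  qed
  moreover have "f k (x # ys) as = g k (x # ys) as"
    by (rule assms(1)) (unfold dom_Cons, rule d)
  ultimately show ?thesis by (simp add: clifford_apply)
qed

lemma wick_cong_dom: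
  assumes "\<And>k ys as. dom M k ys as \<Longrightarrow> f k ys as = g k ys as" "dom M k xs as"
  shows "wick f k xs as = wick g k xs as"
  using assms
proof (induction xs arbitrary: f g M)
  case (Cons x xs)
  have "wick (clifford x f) k xs as = wick (clifford x g) k xs as"
  proof (rule Cons.IH)
    show "clifford x f k ys as = clifford x g k ys as" if "dom (M - 1) k ys as" for k ys as
      by (rule clifford_cong[OF Cons.prems(1) that])
    show "dom (M - 1) k xs as" using Cons.prems(2) unfolding dom_Cons .
  qed
  then show ?case by simp
qed simp

lemma clifford_off:
  assumes "\<And>k ys as. \<not> dom M k ys as \<Longrightarrow> f k ys as = 0" and d: "\<not> dom (M - 1) k ys as"
  shows "clifford x f k ys as = 0"
proof -
  have "alt_sum (\<lambda>y zs. f (Suc k) zs (h x y # as)) ys = alt_sum (\<lambda>y zs. 0) ys"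
  proof (rule alt_sum_cong, rule assms(1))
    show "\<not> dom M (Suc k) zs (h x y # as)" if "length ys = Suc (length zs)" for y zs
      unfolding dom_Suc[OF h_in_K] using d that by (auto simp: dom_simps)
  qed
  moreover have "f k (x # ys) as = 0"
    by (rule assms(1)) (unfold dom_Cons, rule d)
  ultimately show ?thesis by (simp add: clifford_apply)
qed

lemma wick_off:
  assumes "\<And>k ys as. \<not> dom M k ys as \<Longrightarrow> f k ys as = 0" "\<not> dom M k xs as"
  shows "wick f k xs as = 0"
  using assms
proof (induction xs arbitrary: f M)
  case (Cons x xs)
  have "wick (clifford x f) k xs as = 0"
  proof (rule Cons.IH)
    show "clifford x f k ys as = 0" if "\<not> dom (M - 1) k ys as" for k ys as
      by (rule clifford_off[OF Cons.prems(1) that])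
    show "\<not> dom (M - 1) k xs as" using Cons.prems(2) unfolding dom_Cons .
  qed
  then show ?case by simp
qed simp

lemma domD: "dom M k xs as \<Longrightarrow> length as = k" "dom M k xs as \<Longrightarrow> set as \<subseteq> K"
  by (simp_all add: dom_simps)

text \<open>
  Induction on the number of arguments. Both differentials are determined by their Cartan formulas, and \<open>wick\<close> takes the
  transposed action of \<open>x\<close> to insertion of \<open>x\<close> and commutes with Lie derivatives.
\<close>

lemma hemi_raw_wick:
  assumes "f \<in> semi N" "dom M k xs as"
  shows "hemi_raw (wick f) k xs as = wick (semi_raw f) k xs as"
  using assms
proof (induction xs arbitrary: f N M)
  case Nil
  then show ?case
    by (simp add: hemi_raw_def semi_raw_def koszul_part_def act_part_def bracket_part_def mixed_part_def ternary_part_def clifford_apply)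
next
  case (Cons x xs)
  have T: "f \<in> tensors N" using Cons.prems by (simp add: semi_iff)
  have d: "dom (M - 1) k xs as" using Cons.prems(2) unfolding dom_Cons .
  have i: "insertion x (wick f) = wick (clifford x f)" by (simp add: insertion_def fun_eq_iff)
  have "hemi_raw (wick f) k (x # xs) as = lie_der x (wick f) k xs as - hemi_raw (wick (clifford x f)) k xs as"
    unfolding i[symmetric] by (rule hemi_cartan[OF wick_hemi[OF Cons.prems(1)] domD[OF d]])
  also have "lie_der x (wick f) k xs as = wick (lie_der x f) k xs as"
    by (rule wick_lie_der[OF T, symmetric])
  also have "\<dots> = wick (clifford x (semi_raw f) + semi_raw (clifford x f)) k xs as"
    by (rule wick_cong_dom[OF _ d]) (simp add: semi_cartan[OF Cons.prems(1)] domD)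
  also have "hemi_raw (wick (clifford x f)) k xs as = wick (semi_raw (clifford x f)) k xs as"
    by (rule Cons.IH[OF clifford_semi[OF Cons.prems(1)] d])
  finally show ?case by (simp only: wick_add wick.simps add_diff_cancel_right')
qed

lemma hemiD_wick:
  assumes "f \<in> semi N"
  shows "hemiD N (wick f) = wick (semiD N f)"
proof (intro ext)
  fix k xs as
  show "hemiD N (wick f) k xs as = wick (semiD N f) k xs as"
  proof (cases "dom (N + 1) k xs as")
    case True
    then have "hemiD N (wick f) k xs as = wick (semi_raw f) k xs as"
      by (simp add: hemiD_def cutoff_def hemi_raw_wick[OF assms True])
    also have "\<dots> = wick (semiD N f) k xs as"
      by (rule wick_cong_dom[OF _ True]) (simp add: semiD_def cutoff_def)
    finally show ?thesis .
  next
    case False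
    have "wick (semiD N f) k xs as = 0"
      by (rule wick_off[OF _ False]) (simp add: semiD_def cutoff_def)
    then show ?thesis using False by (simp add: hemiD_def cutoff_def)
  qed
qed

section \<open>The hemistrict differential squares to zero\<close>

lemma multilin_zero: "multilin (\<lambda>xs. 0)"
  by (simp add: multilin_def)

lemma multilin_minus: "multilin g \<Longrightarrow> multilin (\<lambda>xs. - g xs)"
  using multilin_scale[of g "- 1"] by simp

lemma multilin_diff: "multilin g \<Longrightarrow> multilin g' \<Longrightarrow> multilin (\<lambda>xs. g xs - g' xs)"
  using multilin_add[OF _ multilin_minus, of g g'] by simp

lemma multilin_pick_sum:
  "(\<And>\<alpha> bs. multilin (\<lambda>xs. G xs \<alpha> bs)) \<Longrightarrow> multilin (\<lambda>xs. pick_sum (G xs) as)"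
proof (induction as arbitrary: G)
  case (Cons a as)
  have "multilin (\<lambda>xs. pick_sum (\<lambda>y ys. G xs y (a # ys)) as)"
    by (rule Cons.IH) (rule Cons.prems)
  then show ?case by (simp add: multilin_add[OF Cons.prems])
qed (simp add: multilin_zero)

lemma multilin_der_sum_param:
  "(\<And>bs. multilin (\<lambda>xs. g xs bs)) \<Longrightarrow> multilin (\<lambda>xs. der_sum \<delta> (g xs) as)"
proof (induction as arbitrary: g)
  case (Cons a as)
  have "multilin (\<lambda>xs. der_sum \<delta> (\<lambda>ys. g xs (a # ys)) as)"
    by (rule Cons.IH) (rule Cons.prems)
  then show ?case by (simp add: multilin_add[OF Cons.prems])
qed (simp add: multilin_zero)

lemma der_sum_scale_value: "der_sum \<delta> (\<lambda>ys. sV c (g ys)) xs = sV c (der_sum \<delta> g xs)"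
  by (rule additive_der_sum[symmetric]) (rule V.scale_right_distrib)

lemma multilin_der_sum:
  assumes g: "multilin g" and \<delta>: "\<And>x y. \<delta> (x + y) = \<delta> x + \<delta> y" "\<And>c x. \<delta> (s c x) = s c (\<delta> x)"
  shows "multilin (der_sum \<delta> g)"
  unfolding multilin_def
proof (intro conjI allI)
  have g1: "g (us @ (x + y) # vs) = g (us @ x # vs) + g (us @ y # vs)"
    and g2: "g (us @ s c x # vs) = sV c (g (us @ x # vs))" for us x y c vs
    using g unfolding multilin_def by blast+
  show "der_sum \<delta> g (us @ (x + y) # vs) = der_sum \<delta> g (us @ x # vs) + der_sum \<delta> g (us @ y # vs)"
    for us x y vs
    by (simp add: der_sum_append g1 \<delta> der_sum_add algebra_simps)
  show "der_sum \<delta> g (us @ s c x # vs) = sV c (der_sum \<delta> g (us @ x # vs))" for us c x vs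
    by (simp add: der_sum_append g2 \<delta> der_sum_scale_value V.scale_right_distrib)
qed

lemma multilin_bracket_sum:
  assumes "multilin g"
  shows "multilin (bracket_sum br g)"
proof -
  have d: "multilin (der_sum (br u) g)" if "multilin g" for u g
    by (rule multilin_der_sum[OF that]) (simp_all add: br_simps)
  have 1: "bracket_sum br g (us @ (x + y) # vs) = bracket_sum br g (us @ x # vs) + bracket_sum br g (us @ y # vs)"
    for us x y vs using assms
  proof (induction us arbitrary: g)
    case Nil
    have "br (x + y) = (\<lambda>u. br x u + br y u)" by (simp add: fun_eq_iff br_simps)
    then have "der_sum (br (x + y)) g vs = der_sum (br x) g vs + der_sum (br y) g vs"
      using der_sum_plus[OF Nil, of "br x" "br y" vs] by simp
    moreover have "bracket_sum br (\<lambda>ys. g ((x + y) # ys)) vs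
        = bracket_sum br (\<lambda>ys. g (x # ys)) vs + bracket_sum br (\<lambda>ys. g (y # ys)) vs"
      unfolding multilin_head[OF Nil] by (rule bracket_sum_add)
    ultimately show ?case by simp
  next
    case (Cons u us)
    have "der_sum (br u) g (us @ (x + y) # vs) = der_sum (br u) g (us @ x # vs) + der_sum (br u) g (us @ y # vs)"
      using d[OF Cons.prems] unfolding multilin_def by blast
    with Cons.IH[OF multilin_Cons[OF Cons.prems]] show ?case by simp
  qed
  have 2: "bracket_sum br g (us @ s c x # vs) = sV c (bracket_sum br g (us @ x # vs))"
    for us c x vs using assms
  proof (induction us arbitrary: g)
    case Nil
    have "br (s c x) = (\<lambda>u. s c (br x u))" by (simp add: fun_eq_iff br_simps)
    then have "der_sum (br (s c x)) g vs = sV c (der_sum (br x) g vs)"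
      using der_sum_scale[OF Nil, of c "br x" vs] by simp
    moreover have "bracket_sum br (\<lambda>ys. g (s c x # ys)) vs = sV c (bracket_sum br (\<lambda>ys. g (x # ys)) vs)"
      unfolding multilin_head[OF Nil] by (rule additive_bracket_sum[symmetric]) (rule V.scale_right_distrib)
    ultimately show ?case by (simp add: V.scale_right_diff_distrib)
  next
    case (Cons u us)
    have "der_sum (br u) g (us @ s c x # vs) = sV c (der_sum (br u) g (us @ x # vs))"
      using d[OF Cons.prems] unfolding multilin_def by blast
    with Cons.IH[OF multilin_Cons[OF Cons.prems]] show ?case by (simp add: V.scale_right_diff_distrib)
  qed
  show ?thesis using 1 2 unfolding multilin_def by blast
qed

lemma cutoff_tensor:
  assumes lin: "\<And>k as. multilin (\<lambda>xs. f k xs as)"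
    and sym: "\<And>k xs as bs. mset as = mset bs \<Longrightarrow> f k xs as = f k xs bs"
    and add: "\<And>k xs \<alpha> \<beta> as. \<alpha> \<in> K \<Longrightarrow> \<beta> \<in> K \<Longrightarrow>
       f k xs ((\<alpha> + \<beta>) # as) = f k xs (\<alpha> # as) + f k xs (\<beta> # as)"
    and sc: "\<And>k xs \<alpha> c as. \<alpha> \<in> K \<Longrightarrow> f k xs (s c \<alpha> # as) = sV c (f k xs (\<alpha> # as))"
  shows "cutoff N f \<in> tensors N"
  unfolding cutoff_def
proof (rule tensorI)
  show "(if dom N k xs as then f k xs as else 0) = 0" if "\<not> dom N k xs as" for k xs as
    using that by simp
  show "multilin (\<lambda>xs. if dom N k xs as then f k xs as else 0)" for k as
    using lin[of k as] unfolding multilin_def by (simp add: dom_simps)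
  show "(if dom N k xs as then f k xs as else 0) = (if dom N k xs bs then f k xs bs else 0)"
    if "mset as = mset bs" for k xs as bs
    using sym[OF that] mset_eq_length[OF that] mset_eq_setD[OF that] by (simp add: dom_simps)
qed (simp_all add: dom_simps add sc K_closed)

lemma br_linear: "br x (y + z) = br x y + br x z" "br x (s c y) = s c (br x y)"
  by (simp_all add: br_simps)

lemma lie_der_tensor:
  assumes f: "f \<in> tensors N"
  shows "cutoff M (lie_der x f) \<in> tensors M"
proof (rule cutoff_tensor)
  show "multilin (\<lambda>xs. lie_der x f k xs as)" for k as
    unfolding lie_der_def
  proof (intro multilin_diff)
    show "multilin (\<lambda>xs. \<rho> x (f k xs as))"
      using tensor_multilin[OF f, of k as] by (simp add: multilin_def \<rho>_add \<rho>_scale)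
    show "multilin (der_sum (br x) (\<lambda>zs. f k zs as))"
      by (rule multilin_der_sum[OF tensor_multilin[OF f] br_linear])
    show "multilin (\<lambda>xs. der_sum (br x) (f k xs) as)"
      by (rule multilin_der_sum_param[OF tensor_multilin[OF f]])
  qed
  show "lie_der x f k xs as = lie_der x f k xs bs" if m: "mset as = mset bs" for k xs as bs
  proof -
    have *: "der_sum (br x) (f k xs) cs = pick_sum (\<lambda>\<alpha> bs. f k xs (br x \<alpha> # bs)) cs" for cs
      by (rule pick_sum_der_sum[OF tensor_sym[OF f], symmetric])
    have "der_sum (br x) (f k xs) as = der_sum (br x) (f k xs) bs"
      unfolding *
      by (rule pick_sum_sym[OF _ m]) (rule tensor_sym[OF f], simp)
    then show ?thesis by (simp add: lie_der_def tensor_sym[OF f m])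
  qed
  show "lie_der x f k xs ((\<alpha> + \<beta>) # as) = lie_der x f k xs (\<alpha> # as) + lie_der x f k xs (\<beta> # as)"
    if "\<alpha> \<in> K" "\<beta> \<in> K" for k xs \<alpha> \<beta> as
    using that by (simp add: lie_der_def tensor_linear_sym[OF f] br_linear br_kernel \<rho>_add der_sum_add algebra_simps)
  show "lie_der x f k xs (s c \<alpha> # as) = sV c (lie_der x f k xs (\<alpha> # as))"
    if "\<alpha> \<in> K" for k xs \<alpha> c as
    using that by (simp add: lie_der_def tensor_linear_sym[OF f] br_linear br_kernel \<rho>_scale der_sum_scale_value
        V.scale_right_diff_distrib V.scale_right_distrib)
qed

lemma hemi_raw_tensor:
  assumes f: "f \<in> tensors N"
  shows "cutoff M (hemi_raw f) \<in> tensors M"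
proof (rule cutoff_tensor)
  show "multilin (\<lambda>xs. hemi_raw f k xs as)" for k as
    unfolding hemi_raw_def
  proof (intro multilin_add)
    show "multilin (\<lambda>xs. koszul_part f k xs as)"
      unfolding koszul_part_def by (intro multilin_pick_sum multilin_Cons[OF tensor_multilin[OF f]])
    show "multilin (\<lambda>xs. act_part f k xs as)"
      unfolding act_part_def
    proof (rule alt_sum_multilin)
      show "multilin (\<lambda>xs. \<rho> x (f k xs as))" for x
        using tensor_multilin[OF f, of k as] by (simp add: multilin_def \<rho>_add \<rho>_scale)
    qed (simp_all add: \<rho>_add_left \<rho>_scale_left)
    show "multilin (bracket_sum br (\<lambda>ys. f k ys as))"
      by (rule multilin_bracket_sum[OF tensor_multilin[OF f]])
  qed
  show "hemi_raw f k xs as = hemi_raw f k xs bs" if m: "mset as = mset bs" for k xs as bs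
  proof -
    have "koszul_part f k xs as = koszul_part f k xs bs"
      unfolding koszul_part_def by (rule pick_sum_sym[OF _ m]) (rule tensor_sym[OF f])
    then show ?thesis by (simp add: hemi_raw_def act_part_def tensor_sym[OF f m])
  qed
  show "hemi_raw f k xs ((\<alpha> + \<beta>) # as) = hemi_raw f k xs (\<alpha> # as) + hemi_raw f k xs (\<beta> # as)"
    if "\<alpha> \<in> K" "\<beta> \<in> K" for k xs \<alpha> \<beta> as
    using that by (simp add: hemi_raw_def koszul_part_def act_part_def tensor_linear_sym[OF f] tensor_linear_head[OF f] \<rho>_add
        alt_sum_add pick_sum_add bracket_sum_add algebra_simps)
  show "hemi_raw f k xs (s c \<alpha> # as) = sV c (hemi_raw f k xs (\<alpha> # as))"
    if "\<alpha> \<in> K" for k xs \<alpha> c as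
    using that by (simp add: hemi_raw_def koszul_part_def act_part_def tensor_linear_sym[OF f] tensor_linear_head[OF f] \<rho>_scale
        V.scale_right_distrib
        additive_alt_sum[of "sV c", OF V.scale_right_distrib]
        additive_pick_sum[of "sV c", OF V.scale_right_distrib]
        additive_bracket_sum[of "sV c", OF V.scale_right_distrib])
qed

lemma hemi_skew_append:
  "f \<in> hemi N \<Longrightarrow> f k (us @ x # y # vs) as + f k (us @ y # x # vs) as = - f (Suc k) (us @ vs) (h x y # as)"
  unfolding hemi_iff by blast

lemma cutoff_hemi:
  assumes "cutoff N f \<in> tensors N"
    and "\<And>k us x y vs as. dom N k (us @ x # y # vs) as \<Longrightarrow>
      f k (us @ x # y # vs) as + f k (us @ y # x # vs) as = - f (Suc k) (us @ vs) (h x y # as)"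
  shows "cutoff N f \<in> hemi N"
  unfolding hemi_iff
proof (intro conjI allI assms(1))
  fix k us x y vs as
  have "dom N k (us @ x # y # vs) as \<longleftrightarrow> dom N k (us @ y # x # vs) as"
    "dom N k (us @ x # y # vs) as \<longleftrightarrow> dom N (Suc k) (us @ vs) (h x y # as)"
    unfolding dom_simps using h_in_K by auto
  then show "cutoff N f k (us @ x # y # vs) as + cutoff N f k (us @ y # x # vs) as =
      - cutoff N f (Suc k) (us @ vs) (h x y # as)"
    using assms(2)[of k us x y vs as] by (simp only: cutoff_def) auto
qed

text \<open>
  The defect of skew-symmetry is \<open>h\<close>, and \<open>[x, _]\<close> is a derivation of it.
\<close>

lemma lie_der_skew:
  assumes f: "f \<in> hemi N"
  shows "lie_der u f k (us @ x # y # vs) as + lie_der u f k (us @ y # x # vs) as =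
      - lie_der u f (Suc k) (us @ vs) (h x y # as)"
proof -
  have T: "f \<in> tensors N" using f unfolding hemi_iff by blast
  let ?d = "der_sum (br u)"
  let ?F = "\<lambda>zs \<alpha>. f (Suc k) zs (\<alpha> # as)"
  note sk = hemi_skew_append[OF f]
  have sk': "f k (us @ x # y # vs) as = - f k (us @ y # x # vs) as - ?F (us @ vs) (h x y)" for us x y vs
    using sk[of k us x y vs as] by (simp add: eq_diff_eq eq_neg_iff_add_eq_0 add_ac)
  have m: "?d (\<lambda>zs. - g zs) xs = - ?d g xs" for g :: "'g list \<Rightarrow> 'v" and xs
    by (rule additive_der_sum[of uminus, symmetric]) simp
  have 1: "\<rho> u (f k (us @ x # y # vs) as) + \<rho> u (f k (us @ y # x # vs) as) = - \<rho> u (?F (us @ vs) (h x y))"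
    unfolding \<rho>_add[symmetric] sk by (rule \<rho>_simps)
  have 2: "?d (f k (us @ x # y # vs)) as + ?d (f k (us @ y # x # vs)) as =
      - ?d (\<lambda>bs. f (Suc k) (us @ vs) (h x y # bs)) as"
    unfolding der_sum_add[symmetric] sk m by (rule refl)
  have a: "?d (\<lambda>zs. f k (zs @ x # y # vs) as) us + ?d (\<lambda>zs. f k (zs @ y # x # vs) as) us
      = - ?d (\<lambda>zs. ?F (zs @ vs) (h x y)) us"
    unfolding der_sum_add[symmetric] sk m by (rule refl)
  have b: "?d (\<lambda>zs. f k (us @ x # y # zs) as) vs + ?d (\<lambda>zs. f k (us @ y # x # zs) as) vs
      = - ?d (\<lambda>zs. ?F (us @ zs) (h x y)) vs"
    unfolding der_sum_add[symmetric] sk m by (rule refl)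
  have c: "f k (us @ br u x # y # vs) as + f k (us @ y # br u x # vs) as = - ?F (us @ vs) (h (br u x) y)"
    "f k (us @ x # br u y # vs) as + f k (us @ br u y # x # vs) as = - ?F (us @ vs) (h x (br u y))"
    by (rule sk)+
  have e: "?F (us @ vs) (br u (h x y)) = ?F (us @ vs) (h (br u x) y) + ?F (us @ vs) (h x (br u y))"
    unfolding br_h by (rule tensor_linear_sym(1)[OF T h_in_K h_in_K])
  have "?d (\<lambda>zs. f k zs as) (us @ x # y # vs) + ?d (\<lambda>zs. f k zs as) (us @ y # x # vs) =
     (?d (\<lambda>zs. f k (zs @ x # y # vs) as) us + ?d (\<lambda>zs. f k (zs @ y # x # vs) as) us)
     + (?d (\<lambda>zs. f k (us @ x # y # zs) as) vs + ?d (\<lambda>zs. f k (us @ y # x # zs) as) vs)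
     + (f k (us @ br u x # y # vs) as + f k (us @ y # br u x # vs) as)
     + (f k (us @ x # br u y # vs) as + f k (us @ br u y # x # vs) as)"
    by (simp add: der_sum_append algebra_simps)
  also have "\<dots> = - ?d (\<lambda>zs. ?F zs (h x y)) (us @ vs) - ?F (us @ vs) (br u (h x y))"
    unfolding a b c e by (simp add: der_sum_append)
  finally have 3: "?d (\<lambda>zs. f k zs as) (us @ x # y # vs) + ?d (\<lambda>zs. f k zs as) (us @ y # x # vs) =
      - ?d (\<lambda>zs. ?F zs (h x y)) (us @ vs) - ?F (us @ vs) (br u (h x y))" .
  have "lie_der u f k (us @ x # y # vs) as + lie_der u f k (us @ y # x # vs) as =
      (\<rho> u (f k (us @ x # y # vs) as) + \<rho> u (f k (us @ y # x # vs) as))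
      - (?d (\<lambda>zs. f k zs as) (us @ x # y # vs) + ?d (\<lambda>zs. f k zs as) (us @ y # x # vs))
      - (?d (f k (us @ x # y # vs)) as + ?d (f k (us @ y # x # vs)) as)"
    by (simp add: lie_der_def algebra_simps)
  also have "\<dots> = - lie_der u f (Suc k) (us @ vs) (h x y # as)"
    unfolding 1 2 3 by (simp add: lie_der_def)
  finally show ?thesis .
qed

lemma lie_der_hemi: "f \<in> hemi N \<Longrightarrow> cutoff N (lie_der x f) \<in> hemi N"
  by (rule cutoff_hemi) (auto intro: lie_der_tensor lie_der_skew simp: hemi_iff)

lemma hemi_raw_add: "hemi_raw (f + g) k xs as = hemi_raw f k xs as + hemi_raw g k xs as"
  by (simp add: hemi_raw_def koszul_part_def act_part_def \<rho>_add pick_sum_add alt_sum_add bracket_sum_add)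

lemma hemi_raw_scale: "hemi_raw (scale_family c f) k xs as = sV c (hemi_raw f k xs as)"
  by (simp add: hemi_raw_def koszul_part_def act_part_def scale_family_def \<rho>_scale V.scale_right_distrib
        additive_alt_sum[of "sV c", OF V.scale_right_distrib]
        additive_pick_sum[of "sV c", OF V.scale_right_distrib]
        additive_bracket_sum[of "sV c", OF V.scale_right_distrib])

lemma hemi_raw_minus: "hemi_raw (- f) k xs as = - hemi_raw f k xs as"
  using hemi_raw_scale[of "- 1" f k xs as] by (simp add: scale_family_minus_one)

lemma hemi_raw_diff: "hemi_raw (f - g) k xs as = hemi_raw f k xs as - hemi_raw g k xs as"
  using hemi_raw_add[of f "- g" k xs as] by (simp add: hemi_raw_minus)

lemma hemi_raw_evaluation:
  assumes "length as = k"
  shows "hemi_raw f (Suc k) xs (\<alpha> # as) = f k (\<alpha> # xs) as + hemi_raw (evaluation \<alpha> f) k xs as"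
proof -
  have "koszul_part f (Suc k) xs (\<alpha> # as) = f k (\<alpha> # xs) as + koszul_part (evaluation \<alpha> f) k xs as"
    using assms by (cases as) (auto simp: koszul_part_def evaluation_def)
  then show ?thesis by (simp add: hemi_raw_def act_part_def evaluation_def)
qed

text \<open>
  Expanding both arguments \<open>x\<close>, \<open>y\<close> in front with the Cartan formula, the Lie derivatives cancel up to insertion of
  \<open>[x, y] + [y, x] = h(x, y)\<close>, which is the new term of the Koszul part for the argument \<open>h(x, y)\<close> from \<open>K\<close>.
\<close>

lemma hemi_raw_skew:
  assumes "f \<in> hemi N" and as: "length as = k" "set as \<subseteq> K"
  shows "hemi_raw f k (us @ x # y # vs) as + hemi_raw f k (us @ y # x # vs) as =
      - hemi_raw f (Suc k) (us @ vs) (h x y # as)"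
  using assms(1)
proof (induction us arbitrary: f N)
  case Nil
  have T: "f \<in> tensors N" using Nil unfolding hemi_iff by blast
  have *: "hemi_raw f k (x # y # vs) as = lie_der x (insertion y f) k vs as - f k (br x y # vs) as
      - lie_der y (insertion x f) k vs as + hemi_raw (insertion y (insertion x f)) k vs as" for x y
    unfolding hemi_cartan[OF Nil as] hemi_cartan[OF insertion_hemi[OF Nil] as] lie_der_Cons by simp
  have "insertion y (insertion x f) + insertion x (insertion y f) = - evaluation (h x y) f"
    using hemi_skew[OF Nil] by (simp add: fun_eq_iff insertion_def evaluation_def)
  then have "hemi_raw (insertion y (insertion x f)) k vs as + hemi_raw (insertion x (insertion y f)) k vs as =
      - hemi_raw (evaluation (h x y) f) k vs as"
    by (metis hemi_raw_add hemi_raw_minus)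
  moreover have "f k (br x y # vs) as + f k (br y x # vs) as = f k (h x y # vs) as"
    by (rule tensor_linear_head(1)[OF T, symmetric])
  ultimately show ?case
    unfolding append_Nil * hemi_raw_evaluation[OF as(1)]
    by (simp add: algebra_simps)
next
  case (Cons u us)
  have as': "length (h x y # as) = Suc k" "set (h x y # as) \<subseteq> K" using as h_in_K by auto
  show ?case
    using Cons.IH[OF insertion_hemi[OF Cons.prems], of u] lie_der_skew[OF Cons.prems, of u k us x y vs as]
    unfolding append_Cons hemi_cartan[OF Cons.prems as] hemi_cartan[OF Cons.prems as']
    by (simp add: algebra_simps)
qed

lemma hemiD_hemi: "f \<in> hemi N \<Longrightarrow> hemiD N f \<in> hemi (N + 1)"
  unfolding hemiD_def
  by (rule cutoff_hemi) (auto intro: hemi_raw_tensor hemi_raw_skew simp: hemi_iff dom_simps)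

lemma der_sum_cong:
  assumes "\<And>ys. length ys = length xs \<Longrightarrow> (set xs \<subseteq> K \<Longrightarrow> set ys \<subseteq> K) \<Longrightarrow> g ys = g' ys"
    and \<delta>: "\<And>\<alpha>. \<alpha> \<in> K \<Longrightarrow> \<delta> \<alpha> \<in> K"
  shows "der_sum \<delta> g xs = der_sum \<delta> g' xs"
  using assms(1)
proof (induction xs arbitrary: g g')
  case (Cons x xs)
  have "der_sum \<delta> (\<lambda>ys. g (x # ys)) xs = der_sum \<delta> (\<lambda>ys. g' (x # ys)) xs"
    by (rule Cons.IH, rule Cons.prems) auto
  moreover have "g (\<delta> x # xs) = g' (\<delta> x # xs)"
    by (rule Cons.prems) (auto simp: \<delta>)
  ultimately show ?case by simp
qed simp

lemma lie_der_cong: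
  assumes eq: "\<And>k ys as. dom N k ys as \<Longrightarrow> f k ys as = g k ys as" and d: "dom N k xs as"
  shows "lie_der x f k xs as = lie_der x g k xs as"
proof -
  have "der_sum (br x) (\<lambda>zs. f k zs as) xs = der_sum (br x) (\<lambda>zs. g k zs as) xs"
    by (rule der_sum_cong) (use d in \<open>auto simp: dom_simps br_kernel intro!: eq\<close>)
  moreover have "der_sum (br x) (f k xs) as = der_sum (br x) (g k xs) as"
    by (rule der_sum_cong) (use d in \<open>auto simp: dom_simps br_kernel intro!: eq\<close>)
  ultimately show ?thesis using eq[OF d] by (simp add: lie_der_def)
qed

lemma der_sum_plus_sym:
  assumes f: "f \<in> tensors N" and as: "set as \<subseteq> K"
    and \<delta>: "\<And>\<alpha>. \<alpha> \<in> K \<Longrightarrow> \<delta> \<alpha> \<in> K" "\<And>\<alpha>. \<alpha> \<in> K \<Longrightarrow> \<epsilon> \<alpha> \<in> K"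
  shows "der_sum (\<lambda>z. \<delta> z + \<epsilon> z) (f k xs) as = der_sum \<delta> (f k xs) as + der_sum \<epsilon> (f k xs) as"
proof -
  have *: "der_sum \<gamma> (f k xs) as = pick_sum (\<lambda>\<alpha> bs. f k xs (\<gamma> \<alpha> # bs)) as" for \<gamma>
    by (rule pick_sum_der_sum[OF tensor_sym[OF f], symmetric])
  show ?thesis
    unfolding * pick_sum_add[symmetric]
  proof (rule pick_sum_cong)
    fix \<alpha> bs assume "\<alpha> \<in> set as"
    then have "\<alpha> \<in> K" using as by blast
    show "f k xs ((\<delta> \<alpha> + \<epsilon> \<alpha>) # bs) = f k xs (\<delta> \<alpha> # bs) + f k xs (\<epsilon> \<alpha> # bs)"
      by (rule tensor_linear_sym(1)[OF f \<delta>(1)[OF \<open>\<alpha> \<in> K\<close>] \<delta>(2)[OF \<open>\<alpha> \<in> K\<close>]])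
  qed
qed

text \<open>
  \<open>[L\<^sub>x, L\<^sub>y] = L\<^bsub>[x, y]\<^esub>\<close>, by the Leibniz identity and because \<open>\<rho>\<close> is an action.
\<close>

lemma lie_der_commutator:
  assumes f: "f \<in> tensors N" and as: "set as \<subseteq> K"
  shows "lie_der x (lie_der y f) k xs as - lie_der y (lie_der x f) k xs as = lie_der (br x y) f k xs as"
proof -
  have l: "lie_der y f k xs = (\<lambda>as. \<rho> y (f k xs as) - der_sum (br y) (\<lambda>zs. f k zs as) xs - der_sum (br y) (f k xs) as)"
    for y k xs by (simp add: fun_eq_iff lie_der_def)
  have J: "(\<lambda>z. br x (br y z)) = (\<lambda>z. br (br x y) z + br y (br x z))"
    by (rule ext) (rule leibniz)
  have X: "der_sum (br x) (der_sum (br y) (\<lambda>zs. f k zs as)) xs - der_sum (br y) (der_sum (br x) (\<lambda>zs. f k zs as)) xs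
      = - der_sum (br (br x y)) (\<lambda>zs. f k zs as) xs"
    unfolding der_sum_commutator J der_sum_plus[OF tensor_multilin[OF f]] by simp
  have A: "der_sum (br x) (der_sum (br y) (f k xs)) as - der_sum (br y) (der_sum (br x) (f k xs)) as
      = - der_sum (br (br x y)) (f k xs) as"
    unfolding der_sum_commutator J
    by (subst der_sum_plus_sym[OF f as]) (simp_all add: br_kernel)
  have "lie_der x (lie_der y f) k xs as - lie_der y (lie_der x f) k xs as =
      (\<rho> x (\<rho> y (f k xs as)) - \<rho> y (\<rho> x (f k xs as)))
      + (der_sum (br x) (der_sum (br y) (\<lambda>zs. f k zs as)) xs - der_sum (br y) (der_sum (br x) (\<lambda>zs. f k zs as)) xs)
      + (der_sum (br x) (der_sum (br y) (f k xs)) as - der_sum (br y) (der_sum (br x) (f k xs)) as)"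
    unfolding l
    by (simp add: lie_der_def \<rho>_simps der_sum_diff additive_der_sum[of "\<rho> z" for z, OF \<rho>_add]
        der_sum_swap[of "br x" "br y" _ as xs] der_sum_swap[of "br y" "br x" _ as xs])
  also have "\<dots> = lie_der (br x y) f k xs as"
    unfolding X A by (simp add: lie_der_def \<rho>_br)
  finally show ?thesis .
qed

lemma hemiD_apply: "hemiD N f k xs as = (if dom (N + 1) k xs as then hemi_raw f k xs as else 0)"
  by (simp add: hemiD_def cutoff_def)

lemma dom_insertion: "dom (N + 1) k (x # xs) as \<longleftrightarrow> dom N k xs as"
  unfolding dom_Cons by simp

lemma insertion_hemiD:
  assumes "f \<in> hemi N"
  shows "insertion x (hemiD N f) = cutoff N (lie_der x f) - hemiD (N - 1) (insertion x f)"
proof (intro ext)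
  fix k xs as
  show "insertion x (hemiD N f) k xs as = (cutoff N (lie_der x f) - hemiD (N - 1) (insertion x f)) k xs as"
    using hemi_cartan[OF assms, of as k x xs] domD[of N k xs as]
    by (cases "dom N k xs as") (simp_all add: insertion_def[of x "hemiD N f"] hemiD_apply dom_insertion cutoff_def)
qed

lemma insertion_lie_der:
  assumes f: "f \<in> tensors N"
  shows "insertion y (cutoff N (lie_der x f)) = cutoff (N - 1) (lie_der x (insertion y f)) - insertion (br x y) f"
proof (intro ext)
  fix k xs as
  show "insertion y (cutoff N (lie_der x f)) k xs as = (cutoff (N - 1) (lie_der x (insertion y f)) - insertion (br x y) f) k xs as"
  proof (cases "dom (N - 1) k xs as")
    case True
    have "insertion y (cutoff N (lie_der x f)) k xs as = cutoff N (lie_der x f) k (y # xs) as" by (simp add: insertion_def)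
    also have "\<dots> = lie_der x f k (y # xs) as" using True by (simp add: cutoff_def dom_Cons)
    finally show ?thesis using True
      by (simp only: lie_der_Cons) (simp add: cutoff_def insertion_def[of "br x y"])
  next
    case False
    moreover have "f k (br x y # xs) as = 0"
      by (rule domE[OF _ f]) (unfold dom_Cons, rule False)
    ultimately show ?thesis by (simp add: insertion_def cutoff_def dom_Cons)
  qed
qed

text \<open>
  \<open>[L\<^sub>x, D] = 0\<close>: inserting \<open>y\<close> and using the Cartan formula for \<open>y\<close> reduces this to fewer arguments and to
  \<open>[L\<^sub>x, L\<^sub>y] = L\<^bsub>[x, y]\<^esub>\<close>.
\<close>

lemma hemiD_lie_der:
  assumes "f \<in> hemi N" "dom (N + 1) k xs as"
  shows "lie_der x (hemiD N f) k xs as = hemi_raw (cutoff N (lie_der x f)) k xs as"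
  using assms
proof (induction xs arbitrary: f N)
  case Nil
  have T: "f \<in> tensors N" using Nil unfolding hemi_iff by blast
  have "lie_der x (hemiD N f) k [] as = lie_der x (hemi_raw f) k [] as"
    by (rule lie_der_cong[OF _ Nil(2)]) (simp add: hemiD_apply)
  also have "\<dots> = \<rho> x (pick_sum (\<lambda>\<alpha> bs. f (k - 1) [\<alpha>] bs) as)
      - der_sum (br x) (pick_sum (\<lambda>\<alpha> bs. f (k - 1) [\<alpha>] bs)) as"
  proof -
    have "hemi_raw f k [] = pick_sum (\<lambda>\<alpha> bs. f (k - 1) [\<alpha>] bs)"
      by (simp add: fun_eq_iff hemi_raw_def koszul_part_def act_part_def)
    then show ?thesis by (simp add: lie_der_def)
  qed
  also have "\<dots> = pick_sum (\<lambda>\<alpha> bs. lie_der x f (k - 1) [\<alpha>] bs) as"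
    by (simp add: additive_pick_sum[of "\<rho> x", OF \<rho>_add] der_sum_pick_sum lie_der_def pick_sum_diff pick_sum_add
        algebra_simps)
  also have "\<dots> = pick_sum (\<lambda>\<alpha> bs. cutoff N (lie_der x f) (k - 1) [\<alpha>] bs) as"
    by (rule pick_sum_cong) (use Nil(2) in \<open>auto simp: cutoff_def dom_simps\<close>)
  also have "\<dots> = hemi_raw (cutoff N (lie_der x f)) k [] as"
    by (simp add: hemi_raw_def koszul_part_def act_part_def)
  finally show ?case .
next
  case (Cons y xs)
  note f = Cons.prems(1)
  have T: "f \<in> tensors N" using f unfolding hemi_iff by blast
  have d: "dom N k xs as" using Cons.prems(2) unfolding dom_insertion .
  note as = domD[OF d]
  have lg: "lie_der x (cutoff N u) k xs as = lie_der x u k xs as" for x u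
    by (rule lie_der_cong[OF _ d]) (simp add: cutoff_def)
  have lin: "lie_der x (u - v) k xs as = lie_der x u k xs as - lie_der x v k xs as" for u v
  proof -
    have "(u - v) k xs = (\<lambda>bs. u k xs bs - v k xs bs)" by (simp add: fun_eq_iff)
    then show ?thesis by (simp add: lie_der_def \<rho>_simps der_sum_diff)
  qed
  have "lie_der x (hemiD N f) k (y # xs) as = lie_der x (insertion y (hemiD N f)) k xs as - insertion (br x y) (hemiD N f) k xs as"
    by (simp add: lie_der_Cons) (simp add: insertion_def)
  also have "\<dots> = lie_der x (lie_der y f) k xs as - lie_der x (hemiD (N - 1) (insertion y f)) k xs as
      - (lie_der (br x y) f k xs as - hemi_raw (insertion (br x y) f) k xs as)"
    unfolding insertion_hemiD[OF f] lin lg using d by (simp add: cutoff_def hemiD_apply)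
  also have "lie_der x (hemiD (N - 1) (insertion y f)) k xs as = hemi_raw (cutoff (N - 1) (lie_der x (insertion y f))) k xs as"
    by (rule Cons.IH[OF insertion_hemi[OF f]]) (use d in simp)
  also have "lie_der (br x y) f k xs as = lie_der x (lie_der y f) k xs as - lie_der y (lie_der x f) k xs as"
    by (rule lie_der_commutator[OF T as(2), symmetric])
  finally have "lie_der x (hemiD N f) k (y # xs) as = lie_der y (lie_der x f) k xs as
      - (hemi_raw (cutoff (N - 1) (lie_der x (insertion y f))) k xs as - hemi_raw (insertion (br x y) f) k xs as)"
    by simp
  also have "\<dots> = hemi_raw (cutoff N (lie_der x f)) k (y # xs) as"
    unfolding hemi_cartan[OF lie_der_hemi[OF f] as] insertion_lie_der[OF T] hemi_raw_diff lg by (rule refl)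
  finally show ?case .
qed

text \<open>
  By the Cartan formula, insertion of \<open>x\<close> maps \<open>D\<^sup>2 f\<close> to \<open>[L\<^sub>x, D] f + D\<^sup>2 (\<iota>\<^sub>x f)\<close>, so it suffices to treat the
  case without arguments from \<open>\<gg>\<close>. There \<open>D\<^sup>2 f\<close> is a sum of terms \<open>f(\<alpha>, \<beta>)\<close>, which cancel in pairs because
  \<open>h\<close> vanishes on \<open>K \<times> K\<close>.
\<close>

lemma hemiD_hemiD_raw:
  assumes "f \<in> hemi N" "dom (N + 2) k xs as"
  shows "hemi_raw (hemiD N f) k xs as = 0"
  using assms
proof (induction xs arbitrary: f N)
  case Nil
  note f = Nil(1)
  have T: "f \<in> tensors N" using Nil unfolding hemi_iff by blast
  have as: "length as = k" "set as \<subseteq> K" using Nil(2) by (simp_all add: dom_simps)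
  define P where "P = pick_sum (\<lambda>\<alpha> bs. pick_sum (\<lambda>\<beta> cs. f (k - 2) [\<alpha>, \<beta>] cs) bs) as"
  have 1: "hemiD N f (k - 1) [\<alpha>] bs = - pick_sum (\<lambda>\<beta> cs. f (k - 2) [\<alpha>, \<beta>] cs) bs"
    if "\<alpha> \<in> K" "set bs \<subseteq> K" "length as = Suc (length bs)" for \<alpha> bs
  proof -
    have l: "length bs = k - 1" using as that by simp
    have "dom (N + 1) (k - 1) [\<alpha>] bs" using Nil(2) that by (auto simp: dom_simps)
    then have "hemiD N f (k - 1) [\<alpha>] bs = lie_der \<alpha> f (k - 1) [] bs - hemi_raw (insertion \<alpha> f) (k - 1) [] bs"
      using hemi_cartan[OF f l that(2), of \<alpha> "[]"] by (simp add: hemiD_apply)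
    also have "lie_der \<alpha> f (k - 1) [] bs = 0"
    proof -
      have "der_sum (br \<alpha>) (f (k - 1) []) bs = 0"
        unfolding der_sum_eq[symmetric] kernel_br[OF that(1)]
        by (intro sum.neutral ballI) (simp add: tensor_zero_arg[OF T])
      then show ?thesis by (simp add: lie_der_def \<rho>_kernel[OF that(1)])
    qed
    finally show ?thesis
      by (simp add: hemi_raw_def koszul_part_def act_part_def insertion_def numeral_2_eq_2)
  qed
  have 2: "f (k - 2) [\<alpha>, \<beta>] cs = - f (k - 2) [\<beta>, \<alpha>] cs" if "\<alpha> \<in> K" "\<beta> \<in> K" for \<alpha> \<beta> cs
  proof -
    have "f l xs (0 # cs) = 0" for l xs cs
      using tensor_linear_sym(2)[OF T K_closed(3), where c = 0] by simp
    then show ?thesis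
      using hemi_skew[OF f, of "k - 2" \<alpha> \<beta> "[]" cs] that by (simp add: kernel_br eq_neg_iff_add_eq_0)
  qed
  have m: "pick_sum (\<lambda>\<beta> cs. - G \<beta> cs) bs = - pick_sum G bs" for G :: "'g \<Rightarrow> 'g list \<Rightarrow> 'v" and bs
    by (rule additive_pick_sum[of uminus, symmetric]) simp
  have "P = pick_sum (\<lambda>\<alpha> bs. pick_sum (\<lambda>\<beta> cs. f (k - 2) [\<beta>, \<alpha>] cs) bs) as"
    unfolding P_def by (rule pick_sum_swap)
  also have "\<dots> = pick_sum (\<lambda>\<alpha> bs. - pick_sum (\<lambda>\<beta> cs. f (k - 2) [\<alpha>, \<beta>] cs) bs) as"
    unfolding m[symmetric] by (intro pick_sum_cong 2) (use as in auto)
  also have "\<dots> = - P" by (simp add: m P_def)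
  finally have "P = 0" by (rule double_zero)
  have "hemi_raw (hemiD N f) k [] as = pick_sum (\<lambda>\<alpha> bs. hemiD N f (k - 1) [\<alpha>] bs) as"
    by (simp add: hemi_raw_def koszul_part_def act_part_def)
  also have "\<dots> = pick_sum (\<lambda>\<alpha> bs. - pick_sum (\<lambda>\<beta> cs. f (k - 2) [\<alpha>, \<beta>] cs) bs) as"
    by (rule pick_sum_cong, rule 1) (use as in auto)
  also have "\<dots> = - P" by (simp add: m P_def)
  finally show ?case by (simp add: \<open>P = 0\<close>)
next
  case (Cons x xs)
  note f = Cons.prems(1)
  have d: "dom (N + 1) k xs as" using Cons.prems(2) by (simp add: dom_simps)
  have "hemi_raw (hemiD (N - 1) (insertion x f)) k xs as = 0"
    by (rule Cons.IH[OF insertion_hemi[OF f]]) (use d in \<open>simp add: dom_simps\<close>)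
  then show ?case
    unfolding hemi_cartan[OF hemiD_hemi[OF f] domD[OF d]] insertion_hemiD[OF f] hemi_raw_diff
      hemiD_lie_der[OF f d]
    by simp
qed

lemma hemiD_hemiD: "f \<in> hemi N \<Longrightarrow> hemiD (N + 1) (hemiD N f) = 0"
  using hemiD_hemiD_raw[of f N] by (auto simp: fun_eq_iff hemiD_apply[of "N + 1"] dom_simps)

lemma semiD_off: "\<not> dom (N + 1) k xs as \<Longrightarrow> semiD N f k xs as = 0"
  by (simp add: semiD_def cutoff_def)

text \<open>
  The differential corresponds under \<open>wick\<close> to the hemistrict one, which yields a hemistrict family, so by
  injectivity of \<open>wick\<close> it inherits this property.
\<close>

lemma semiD_semi:
  assumes f: "f \<in> semi N"
  shows "semiD N f \<in> semi (N + 1)"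
proof -
  obtain g where g: "g \<in> semi (N + 1)" "wick g = hemiD N (wick f)"
    using wick_surjective[OF hemiD_hemi[OF wick_hemi[OF f]]] by blast
  have "wick (g - semiD N f) = 0"
    using g(2) by (simp add: fun_eq_iff wick_diff hemiD_wick[OF f])
  moreover have "(g - semiD N f) k xs as = 0" if "\<not> dom (N + 1) k xs as" for k xs as
    using domE[OF that, of g] semiD_off[OF that, of f] g(1) unfolding semi_iff by simp
  ultimately have "g - semiD N f = 0" using wick_injective[of "N + 1" "g - semiD N f"] by blast
  with g(1) show ?thesis by simp
qed

lemma semiD_semiD:
  assumes f: "f \<in> semi N"
  shows "semiD (N + 1) (semiD N f) = 0"
proof (rule wick_injective)
  show "semiD (N + 1) (semiD N f) k xs as = 0" if "\<not> dom (N + 1 + 1) k xs as" for k xs as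
    using that by (rule semiD_off)
  show "wick (semiD (N + 1) (semiD N f)) = 0"
    unfolding hemiD_wick[OF semiD_semi[OF f], symmetric] hemiD_wick[OF f, symmetric]
    by (rule hemiD_hemiD[OF wick_hemi[OF f]])
qed

section \<open>The Koszul complex of the Leibniz kernel\<close>

lemma der_sum_id: "der_sum (\<lambda>x. x) g xs = sV (of_nat (length xs)) (g xs)"
  by (induction xs arbitrary: g) (simp_all add: V.scale_left_distrib)

abbreviation count_K :: "'g list \<Rightarrow> nat" where
  "count_K xs \<equiv> length (filter (\<lambda>x. x \<in> K) xs)"

text \<open>
  If \<open>g\<close> vanishes on lists with more than \<open>r\<close> entries in \<open>K\<close>, then projecting an entry outside \<open>K\<close> of a list with \<open>r\<close>
  entries in \<open>K\<close> gives 0, and projecting an entry in \<open>K\<close> does not change it.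
\<close>

lemma der_sum_projection:
  assumes p: "\<And>x. p x \<in> K" "\<And>\<alpha>. \<alpha> \<in> K \<Longrightarrow> p \<alpha> = \<alpha>"
  shows "(\<And>zs. r < count_K zs \<Longrightarrow> g zs = 0) \<Longrightarrow> r \<le> count_K xs \<Longrightarrow>
    der_sum p g xs = sV (of_nat (count_K xs)) (g xs)"
proof (induction xs arbitrary: g r)
  case (Cons x xs)
  show ?case
  proof (cases "x \<in> K")
    case True
    have "der_sum p (\<lambda>zs. g (x # zs)) xs = sV (of_nat (count_K xs)) (g (x # xs))"
    proof (rule Cons.IH)
      \<comment> \<open>for \<open>r = 0\<close>, truncated subtraction leaves \<open>0\<close>, and \<open>g (x # zs) = 0\<close> holds for all \<open>zs\<close>\<close>
      show "g (x # zs) = 0" if "r - 1 < count_K zs" for zs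
        by (rule Cons.prems(1)) (use True that in auto)
      show "r - 1 \<le> count_K xs" using Cons.prems(2) True by auto
    qed
    then show ?thesis using True by (simp add: p V.scale_left_distrib)
  next
    case False
    have "der_sum p (\<lambda>zs. g (x # zs)) xs = sV (of_nat (count_K xs)) (g (x # xs))"
    proof (rule Cons.IH)
      show "g (x # zs) = 0" if "r < count_K zs" for zs
        by (rule Cons.prems(1)) (use False that in auto)
      show "r \<le> count_K xs" using Cons.prems(2) False by auto
    qed
    moreover have "g (p x # xs) = 0"
      by (rule Cons.prems(1)) (use Cons.prems(2) False p in auto)
    ultimately show ?thesis using False by simp
  qed
qed simp

lemma projection_onto_K: "\<exists>p. K_linear p \<and> (\<forall>\<alpha>\<in>K. p \<alpha> = \<alpha>)"
proof -
  interpret vp: vector_space_pair s s by unfold_locales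
  have "\<exists>g. g ` UNIV \<subseteq> K \<and> Vector_Spaces.linear s s g \<and> (\<forall>v\<in>K. g (id v) = v)"
    by (rule vp.linear_exists_left_inverse_on[OF linear_id K_subspace inj_on_id])
  then obtain p where p: "range p \<subseteq> K" "Vector_Spaces.linear s s p" "\<forall>v\<in>K. p v = v" by auto
  interpret p: Vector_Spaces.linear s s p by (rule p(2))
  show ?thesis
    by (rule exI[of _ p]) (use p in \<open>auto simp: K_linear_def p.add p.scale\<close>)
qed

text \<open>
  On components of \<open>f\<close> above the top one only the Koszul part of the differential can be nonzero, since it is the only part
  that lowers the number of arguments from \<open>K\<close> that \<open>f\<close> sees.
\<close>

lemma semi_raw_top:
  assumes "\<And>l xs as. q < l \<Longrightarrow> f l xs as = 0"
  shows "q < l \<Longrightarrow> semi_raw f l xs as = koszul_part f l xs as"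
proof -
  assume l: "q < l"
  then have "f l = (\<lambda>_ _. 0)" "f (Suc l) = (\<lambda>_ _. 0)" using assms by (simp_all add: fun_eq_iff)
  then show ?thesis by (simp add: semi_raw_def act_part_def bracket_part_def mixed_part_def ternary_part_def \<rho>_simps)
qed

lemma semiD_apply: "semiD N f k xs as = (if dom (N + 1) k xs as then semi_raw f k xs as else 0)"
  by (simp add: semiD_def cutoff_def)

text \<open>
  On Koszul cocycles, contraction with a projection \<open>p\<close> onto \<open>K\<close> followed by the Koszul differential counts
  arguments in \<open>K\<close>: the \<open>q\<close> arguments of the symmetric part, and those of the exterior part through \<open>p\<close>.
\<close>

lemma koszul_homotopy:
  assumes f: "f \<in> semi N" and top: "\<And>l xs as. q < l \<Longrightarrow> f l xs as = 0" and q: "0 < q"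
    and cocycle: "\<And>zs bs. semiD N f (Suc q) zs bs = 0"
    and p: "K_linear p" "\<And>\<alpha>. \<alpha> \<in> K \<Longrightarrow> p \<alpha> = \<alpha>"
    and d: "dom N q xs as"
  shows "semi_raw (contraction p f) q xs as = sV (of_nat q) (f q xs as) + der_sum p (\<lambda>zs. f q zs as) xs"
proof -
  have T: "f \<in> tensors N" and sk: "skew (\<lambda>xs. f k xs as)" for k as using f by (simp_all add: semi_iff)
  have pK: "p x \<in> K" for x using p(1) by (simp add: K_linear_def)
  have as: "length as = q" "set as \<subseteq> K" using d by (simp_all add: dom_simps)
  have Sq: "Suc (q - 1) = q" using q by simp
  have 0: "contraction p f l xs as = 0" if "q - 1 < l" for l xs as
    using that top[of "Suc l"] by (simp add: contraction_def)
  have "semi_raw (contraction p f) q xs as = koszul_part (contraction p f) q xs as"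
    by (rule semi_raw_top[of "q - 1"]) (use 0 q in auto)
  also have "\<dots> = pick_sum (\<lambda>\<alpha> bs. f q xs (p \<alpha> # bs) - alt_sum (\<lambda>y zs. f q (\<alpha> # zs) (p y # bs)) xs) as"
    unfolding koszul_part_def contraction_def alt_sum.simps Sq by (rule refl)
  also have "\<dots> = pick_sum (\<lambda>\<alpha> bs. f q xs (p \<alpha> # bs)) as
      - alt_sum (\<lambda>y zs. pick_sum (\<lambda>\<alpha> bs. f q (\<alpha> # zs) (p y # bs)) as) xs"
    by (simp only: pick_sum_diff alt_sum_pick_sum)
  also have "pick_sum (\<lambda>\<alpha> bs. f q xs (p \<alpha> # bs)) as = pick_sum (\<lambda>\<alpha> bs. f q xs (\<alpha> # bs)) as"
    by (rule pick_sum_cong) (use as p(2) in auto)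
  also have "\<dots> = der_sum (\<lambda>\<alpha>. \<alpha>) (f q xs) as"
    by (rule pick_sum_der_sum[OF tensor_sym[OF T]])
  also have "\<dots> = sV (of_nat q) (f q xs as)"
    by (simp add: der_sum_id as)
  also have "alt_sum (\<lambda>y zs. pick_sum (\<lambda>\<alpha> bs. f q (\<alpha> # zs) (p y # bs)) as) xs =
      alt_sum (\<lambda>y zs. - f q (p y # zs) as) xs"
  proof (rule alt_sum_cong)
    fix y and zs :: "'g list"
    assume "length xs = Suc (length zs)"
    then have "dom (N + 1) (Suc q) zs (p y # as)" using d pK by (auto simp: dom_simps)
    then have "semi_raw f (Suc q) zs (p y # as) = 0" using cocycle[of zs "p y # as"] by (simp add: semiD_apply)
    then have "koszul_part f (Suc q) zs (p y # as) = 0"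
      using semi_raw_top[of q f "Suc q"] top by simp
    then show "pick_sum (\<lambda>\<alpha> bs. f q (\<alpha> # zs) (p y # bs)) as = - f q (p y # zs) as"
      by (simp add: koszul_part_def eq_neg_iff_add_eq_0 add.commute)
  qed
  also have "\<dots> = - der_sum p (\<lambda>zs. f q zs as) xs"
    unfolding alt_sum_minus by (simp add: skew_der_sum[OF sk])
  finally show ?thesis by simp
qed

lemma semiD_diff: "semiD N (f - g) = semiD N f - semiD N g"
  by (simp add: fun_eq_iff semiD_apply semi_raw_diff)

lemma semiD_scale: "semiD N (scale_family c f) = scale_family c (semiD N f)"
  by (simp add: fun_eq_iff semiD_apply semi_raw_scale scale_family_def[of c "semiD N f"])

lemma scale_family_zero: "scale_family 0 f = 0" "scale_family c 0 = 0"
  by (simp_all add: scale_family_def fun_eq_iff)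

lemma semiD_zero: "semiD N 0 = 0"
  using semiD_scale[of N 0 0] by (simp only: scale_family_zero)

lemma semiD_add: "semiD N (f + g) = semiD N f + semiD N g"
  using semiD_diff[of N "f + g" g] by (simp add: diff_eq_eq)

lemma semiD_top:
  assumes "\<And>l xs as. q \<le> l \<Longrightarrow> f l xs as = 0" "q < l"
  shows "semiD N f l xs as = 0"
proof -
  have "semi_raw f l xs as = koszul_part f l xs as"
    by (rule semi_raw_top[of q]) (use assms in auto)
  also have "\<dots> = 0" using assms by (simp add: koszul_part_def)
  finally show ?thesis by (simp add: semiD_apply)
qed

text \<open>
  The operator that counts arguments in \<open>K\<close> is \<open>q\<close> plus the derivation extending \<open>p\<close>, and the latter is not a scalar. But if
  the top component of \<open>f\<close> vanishes on lists with more than \<open>r\<close> entries in \<open>K\<close>, then the derivation is \<open>r\<close> up to a map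
  that vanishes on lists with at least \<open>r\<close> such entries. So the counting operator is \<open>q + r \<noteq> 0\<close> up to a cocycle that is
  a coboundary by induction on \<open>r\<close>.
\<close>

lemma koszul_exact:
  assumes "f \<in> semi N" "\<And>l xs as. q < l \<Longrightarrow> f l xs as = 0" "0 < q"
    and "\<And>zs bs. semiD N f (Suc q) zs bs = 0"
    and "\<And>xs as. r \<le> count_K xs \<Longrightarrow> f q xs as = 0"
  shows "\<exists>\<theta> \<in> semi (N - 1). (\<forall>l xs as. q \<le> l \<longrightarrow> \<theta> l xs as = 0) \<and> semiD (N - 1) \<theta> q = f q"
  using assms
proof (induction r arbitrary: f)
  case 0
  then have "f q = 0" by (simp add: fun_eq_iff)
  show ?case
  proof (intro bexI[OF _ semi_zero] conjI allI impI)
    show "semiD (N - 1) 0 q = f q" unfolding \<open>f q = 0\<close> semiD_zero by simp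
  qed simp
next
  case (Suc r)
  note f = Suc.prems(1) and top = Suc.prems(2) and q = Suc.prems(3)
  obtain p where p: "K_linear p" "\<And>\<alpha>. \<alpha> \<in> K \<Longrightarrow> p \<alpha> = \<alpha>" using projection_onto_K by blast
  have pK: "p x \<in> K" for x using p(1) by (simp add: K_linear_def)
  define \<kappa> where "\<kappa> = contraction p f"
  define c where "c = (of_nat (q + r) :: 'k)"
  define g where "g = semiD (N - 1) \<kappa> - scale_family c f"
  have \<kappa>: "\<kappa> \<in> semi (N - 1)" unfolding \<kappa>_def by (rule contraction_semi[OF f p(1)])
  have \<kappa>0: "\<kappa> l xs as = 0" if "q \<le> l" for l xs as
    using that top[of "Suc l"] by (simp add: \<kappa>_def contraction_def)
  \<comment> \<open>the part of the coboundary of \<open>\<kappa>\<close> that vanishes on more lists than \<open>f\<close> does\<close>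
  have b: "semiD (N - 1) \<kappa> \<in> semi N" using semiD_semi[OF \<kappa>] by simp
  have bb: "semiD N (semiD (N - 1) \<kappa>) = 0" using semiD_semiD[OF \<kappa>] by simp
  have "\<exists>\<theta> \<in> semi (N - 1). (\<forall>l xs as. q \<le> l \<longrightarrow> \<theta> l xs as = 0) \<and> semiD (N - 1) \<theta> q = g q"
  proof (rule Suc.IH)
    show "g \<in> semi N" unfolding g_def by (intro semi_diff b semi_scale f)
    show "g l xs as = 0" if "q < l" for l xs as
      using semiD_top[OF \<kappa>0 that] top[OF that] by (simp add: g_def scale_family_def)
    show "semiD N g (Suc q) zs bs = 0" for zs bs
      using Suc.prems(4)[of zs bs] unfolding g_def semiD_diff bb semiD_scale by (simp add: scale_family_def)
    show "g q xs as = 0" if r: "r \<le> count_K xs" for xs as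
    proof (cases "dom N q xs as")
      case True
      have "g q xs as = sV (of_nat q) (f q xs as) + der_sum p (\<lambda>zs. f q zs as) xs - sV c (f q xs as)"
        using True koszul_homotopy[OF f top q Suc.prems(4) p True]
        by (simp add: g_def semiD_apply \<kappa>_def scale_family_def)
      also have "der_sum p (\<lambda>zs. f q zs as) xs = sV (of_nat (count_K xs)) (f q xs as)"
        by (rule der_sum_projection[OF pK p(2) Suc.prems(5) r]) simp_all
      also have "\<dots> = sV (of_nat r) (f q xs as)"
        using r Suc.prems(5)[of xs as] by (cases "count_K xs = r") auto
      finally show ?thesis by (simp add: c_def V.scale_left_distrib)
    next
      case False
      have "semiD (N - 1) \<kappa> q xs as = 0" using False by (simp add: semiD_apply)
      moreover have "f q xs as = 0" using domE[OF False] f unfolding semi_iff by blast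
      ultimately show ?thesis by (simp add: g_def scale_family_def)
    qed
  qed (rule q)
  then obtain \<theta> where \<theta>: "\<theta> \<in> semi (N - 1)" "\<And>l xs as. q \<le> l \<Longrightarrow> \<theta> l xs as = 0"
    "semiD (N - 1) \<theta> q = g q" by blast
  have c0: "c \<noteq> 0" using q unfolding c_def by (simp only: of_nat_eq_0_iff)
  show ?case
  proof (intro bexI conjI allI impI)
    show "scale_family (1 / c) (\<kappa> - \<theta>) \<in> semi (N - 1)"
      by (intro semi_scale semi_diff \<kappa> \<theta>(1))
    show "scale_family (1 / c) (\<kappa> - \<theta>) l xs as = 0" if "q \<le> l" for l xs as
      using that by (simp add: scale_family_def \<kappa>0 \<theta>(2))
    show "semiD (N - 1) (scale_family (1 / c) (\<kappa> - \<theta>)) q = f q"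
    proof (intro ext)
      fix xs as
      have "(semiD (N - 1) \<kappa> - semiD (N - 1) \<theta>) q xs as = sV c (f q xs as)"
        using \<theta>(3) by (simp add: g_def scale_family_def)
      then show "semiD (N - 1) (scale_family (1 / c) (\<kappa> - \<theta>)) q xs as = f q xs as"
        unfolding semiD_scale semiD_diff unfolding scale_family_def using c0 by (simp add: divide_inverse)
    qed
  qed
qed

text \<open>
  The families that come from \<open>\<gg> / K\<close>.
\<close>

definition basic :: "int \<Rightarrow> ('g, 'g, 'v) family set" where
  "basic N = {f \<in> semi N. (\<forall>k>0. \<forall>xs as. f k xs as = 0) \<and> (\<forall>\<alpha>\<in>K. \<forall>xs as. f 0 (\<alpha> # xs) as = 0)}"

text \<open>
  The component of \<open>D f\<close> with one argument \<open>\<alpha>\<close> from \<open>K\<close> is \<open>f(\<alpha>, _)\<close>.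
\<close>

lemma degree_zero_cocycle_basic:
  assumes f: "f \<in> semi N" "semiD N f \<in> basic (N + 1)" "\<And>l xs as. 0 < l \<Longrightarrow> f l xs as = 0"
  shows "f \<in> basic N"
proof -
  have T: "f \<in> tensors N" using f unfolding semi_iff by blast
  have "f 0 (\<alpha> # xs) as = 0" if \<alpha>: "\<alpha> \<in> K" for \<alpha> xs as
  proof (cases "dom N 0 (\<alpha> # xs) as")
    case True
    then have d: "dom (N + 1) (Suc 0) xs [\<alpha>]" and as: "as = []" using \<alpha> by (auto simp: dom_simps)
    have "f 0 (\<alpha> # xs) [] = koszul_part f (Suc 0) xs [\<alpha>]" by (simp add: koszul_part_def)
    also have "\<dots> = semi_raw f (Suc 0) xs [\<alpha>]"
      using semi_raw_top[of 0 f "Suc 0"] f(3) by simp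
    also have "\<dots> = semiD N f (Suc 0) xs [\<alpha>]" using d by (simp add: semiD_apply)
    also have "\<dots> = 0" using f(2) by (simp add: basic_def)
    finally show ?thesis by (simp add: as)
  qed (rule domE[OF _ T])
  with f show ?thesis by (simp add: basic_def)
qed

text \<open>
  Remove the components with arguments from \<open>S K\<close> one after the other, starting from the top: the top component is a Koszul
  cocycle since \<open>D f\<close> is basic, hence it is the top component of a coboundary.
\<close>

lemma cohomologous_to_basic:
  assumes "f \<in> semi N" "semiD N f \<in> basic (N + 1)"
  shows "\<exists>\<theta> \<in> semi (N - 1). f - semiD (N - 1) \<theta> \<in> basic N"
proof -
  have "\<exists>\<theta> \<in> semi (N - 1). f - semiD (N - 1) \<theta> \<in> basic N"
    if "f \<in> semi N" "semiD N f \<in> basic (N + 1)" "\<And>l xs as. q < l \<Longrightarrow> f l xs as = 0" for q f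
    using that
  proof (induction q arbitrary: f)
    case 0
    have "f \<in> basic N" by (rule degree_zero_cocycle_basic[OF 0])
    then have "f - semiD (N - 1) 0 \<in> basic N" by (simp only: semiD_zero diff_zero)
    then show ?case using semi_zero by blast
  next
    case (Suc q)
    note f = Suc.prems(1)
    have T: "f \<in> tensors N" using f unfolding semi_iff by blast
    have "\<exists>\<theta> \<in> semi (N - 1). (\<forall>l xs as. Suc q \<le> l \<longrightarrow> \<theta> l xs as = 0) \<and> semiD (N - 1) \<theta> (Suc q) = f (Suc q)"
    \<comment> \<open>no list in the domain has more than \<open>N\<close> entries\<close>
    proof (rule koszul_exact[OF f Suc.prems(3), where r = "Suc (nat N)"])
      show "semiD N f (Suc (Suc q)) zs bs = 0" for zs bs using Suc.prems(2) by (simp add: basic_def)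
      show "f (Suc q) xs as = 0" if "Suc (nat N) \<le> count_K xs" for xs as
      proof (rule domE[OF _ T])
        have "count_K xs \<le> length xs" by simp
        with that have "Suc (nat N) \<le> length xs" by linarith
        then show "\<not> dom N (Suc q) xs as" by (auto simp: dom_simps)
      qed
    qed auto
    then obtain \<theta> where \<theta>: "\<theta> \<in> semi (N - 1)" "\<And>l xs as. Suc q \<le> l \<Longrightarrow> \<theta> l xs as = 0"
      "semiD (N - 1) \<theta> (Suc q) = f (Suc q)" by blast
    define f' where "f' = f - semiD (N - 1) \<theta>"
    have D\<theta>: "semiD (N - 1) \<theta> \<in> semi N" "semiD N (semiD (N - 1) \<theta>) = 0"
      using semiD_semi[OF \<theta>(1)] semiD_semiD[OF \<theta>(1)] by simp_all
    have "\<exists>\<theta>' \<in> semi (N - 1). f' - semiD (N - 1) \<theta>' \<in> basic N"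
    proof (rule Suc.IH)
      show "f' \<in> semi N" unfolding f'_def by (rule semi_diff[OF f D\<theta>(1)])
      show "semiD N f' \<in> basic (N + 1)" using Suc.prems(2) by (simp add: f'_def semiD_diff D\<theta>(2))
      show "f' l xs as = 0" if "q < l" for l xs as
      proof (cases "l = Suc q")
        case True
        then show ?thesis using \<theta>(3) by (simp add: f'_def)
      next
        case False
        then have l: "Suc q < l" using that by simp
        show ?thesis using semiD_top[OF \<theta>(2) l] Suc.prems(3)[OF l] by (simp add: f'_def)
      qed
    qed
    then obtain \<theta>' where \<theta>': "\<theta>' \<in> semi (N - 1)" "f' - semiD (N - 1) \<theta>' \<in> basic N" by blast
    have "f - semiD (N - 1) (\<theta> + \<theta>') \<in> basic N"
      using \<theta>'(2) by (simp only: f'_def semiD_add diff_diff_eq)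
    then show ?case using semi_add[OF \<theta>(1) \<theta>'(1)] by blast
  qed
  moreover have "f l xs as = 0" if "nat N < l" for l xs as
    using that assms(1) dom_bound[of N l xs as] domE[of N l xs as f] by (auto simp: semi_iff)
  ultimately show ?thesis using assms by blast
qed

section \<open>Cochains of the quotient Lie algebra\<close>

abbreviation coset :: "'g \<Rightarrow> 'g set" where "coset x \<equiv> x +o K"

abbreviation Q :: "'g set set" where "Q \<equiv> quotient_space UNIV K"

abbreviation sQ :: "'k \<Rightarrow> 'g set \<Rightarrow> 'g set" where "sQ \<equiv> quotient_scale s K"

abbreviation ce :: "int \<Rightarrow> ('g set list \<Rightarrow> 'v) set" where
  "ce N \<equiv> Hom_wedge Q sQ sV N"

definition ceD :: "int \<Rightarrow> ('g set list \<Rightarrow> 'v) \<Rightarrow> 'g set list \<Rightarrow> 'v" where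
  "ceD N \<eta> = (\<lambda>Xs. if int (length Xs) = N + 1 \<and> set Xs \<subseteq> Q
     then ce_diff_part (lie_bracket s br) sV (coset_action \<rho>) \<eta> Xs else 0)"

definition pullback :: "('g set list \<Rightarrow> 'v) \<Rightarrow> ('g, 'g, 'v) family" where
  "pullback \<eta> = (\<lambda>k xs as. if k = 0 \<and> as = [] then \<eta> (map coset xs) else 0)"

lemma coset_in_Q: "coset x \<in> Q"
  by (simp add: quotient_space_def)

lemma coset_eq: "coset x = coset y \<longleftrightarrow> x - y \<in> K"
  by (rule subspace_coset_eq[OF K_subspace])

lemma coset_add: "coset x + coset y = coset (x + y)"
  by (rule subspace_coset_add[OF K_subspace])

lemma coset_scale: "sQ c (coset x) = coset (s c x)"
  by (rule subspace_coset_scale[OF K_subspace])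

lemma coset_action: "coset_action \<rho> (coset x) v = \<rho> x v"
proof -
  have "\<rho> z v = \<rho> x v" if "z \<in> coset x" for z
  proof -
    have "\<rho> (z - x) v = 0" using that unfolding mem_coset_iff by (rule \<rho>_kernel)
    then show ?thesis using \<rho>_add_left[of "z - x" x v] by simp
  qed
  moreover have "x \<in> coset x" by (simp add: mem_coset_iff K_closed)
  ultimately have "(\<lambda>z. \<rho> z v) ` coset x = {\<rho> x v}" by blast
  then show ?thesis by (simp add: coset_action_def)
qed

lemma coset_bracket: "lie_bracket s br (coset x) (coset y) = coset (br x y)"
proof -
  have m: "br (a + b) c = br a c + br b c" "br a (b + c) = br a b + br a c" for a b c
    by (simp_all add: br_simps)
  show ?thesis
    unfolding lie_bracket_def
  proof (intro set_eqI iffI)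
    fix z assume "z \<in> {br x' y' |x' y'. x' \<in> coset x \<and> y' \<in> coset y} + K"
    then obtain a b c where abc: "a - x \<in> K" "b - y \<in> K" "c \<in> K" "z = br a b + c"
      by (auto simp: set_plus_def mem_coset_iff)
    have "br a b = br x y + br x (b - y)"
      using m(1)[of "a - x" x b] m(2)[of x "b - y" y] kernel_br[OF abc(1), of b] by (simp add: add.commute)
    then have e: "z - br x y = br x (b - y) + c" by (simp add: abc)
    show "z \<in> coset (br x y)"
      unfolding mem_coset_iff e by (rule K_closed(1)[OF br_kernel[OF abc(2)] abc(3)])
  next
    fix z assume z: "z \<in> coset (br x y)"
    have "br x y \<in> {br x' y' |x' y'. x' \<in> coset x \<and> y' \<in> coset y}"
    proof -
      have "x \<in> coset x" "y \<in> coset y" by (simp_all add: mem_coset_iff K_closed)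
      then show ?thesis by blast
    qed
    moreover have "z - br x y \<in> K" using z by (simp add: mem_coset_iff)
    ultimately show "z \<in> {br x' y' |x' y'. x' \<in> coset x \<and> y' \<in> coset y} + K"
      unfolding set_plus_def by (intro CollectI bexI[of _ "br x y"] bexI[of _ "z - br x y"]) simp_all
  qed
qed

lemma coset_skew_br: "coset (skew_br x y) = coset (br x y)"
proof -
  have "skew_br x y - br x y = - s (1 / 2) (h x y)"
    using skew_br_plus_half_h[of x y] by (simp add: algebra_simps)
  then show ?thesis unfolding coset_eq by (simp add: K_closed h_in_K del: scale_right_distrib)
qed

lemma coset_kernel: "\<alpha> \<in> K \<Longrightarrow> coset \<alpha> = coset 0"
  unfolding coset_eq by simp

lemma ce_off: "\<eta> \<in> ce N \<Longrightarrow> \<not> (int (length Xs) = N \<and> set Xs \<subseteq> Q) \<Longrightarrow> \<eta> Xs = 0"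
  by (auto simp: Hom_wedge_def)

lemma ce_linear:
  assumes "\<eta> \<in> ce N"
  shows "\<eta> (map coset (us @ (x + y) # vs)) = \<eta> (map coset (us @ x # vs)) + \<eta> (map coset (us @ y # vs))"
    and "\<eta> (map coset (us @ s c x # vs)) = sV c (\<eta> (map coset (us @ x # vs)))"
proof -
  have "\<eta> (map coset (us @ (x + y) # vs)) = \<eta> (map coset (us @ x # vs)) + \<eta> (map coset (us @ y # vs)) \<and>
    \<eta> (map coset (us @ s c x # vs)) = sV c (\<eta> (map coset (us @ x # vs)))"
  proof (cases "int (length (us @ x # vs)) = N")
    case True
    let ?Xs = "map coset (us @ x # vs)"
    have "int (length ?Xs) = N \<and> set ?Xs \<subseteq> Q" using True by (auto simp: coset_in_Q)
    moreover have "length us < length ?Xs" by simp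
    ultimately have l: "linear_on Q sQ sV (\<lambda>X. \<eta> (?Xs[length us := X]))"
      using assms unfolding Hom_wedge_def by blast
    have u: "?Xs[length us := X] = map coset us @ X # map coset vs" for X
      by (simp add: list_update_append)
    show ?thesis
      using l unfolding linear_on_def u by (simp add: coset_in_Q coset_add[symmetric] coset_scale[symmetric])
  next
    case False
    then show ?thesis using ce_off[OF assms] by (simp del: map_append)
  qed
  then show "\<eta> (map coset (us @ (x + y) # vs)) = \<eta> (map coset (us @ x # vs)) + \<eta> (map coset (us @ y # vs))"
    "\<eta> (map coset (us @ s c x # vs)) = sV c (\<eta> (map coset (us @ x # vs)))" by auto
qed

lemma ce_kernel: "\<eta> \<in> ce N \<Longrightarrow> \<alpha> \<in> K \<Longrightarrow> \<eta> (map coset (\<alpha> # xs)) = 0"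
  using ce_linear(2)[of \<eta> N "[]" 0 0 xs] coset_kernel[of \<alpha>] by simp

lemma pullback_basic:
  assumes \<eta>: "\<eta> \<in> ce N"
  shows "pullback \<eta> \<in> basic N"
proof -
  have T: "pullback \<eta> \<in> tensors N"
  proof (rule tensorI)
    show "pullback \<eta> k xs as = 0" if "\<not> dom N k xs as" for k xs as
      using that ce_off[OF \<eta>, of "map coset xs"] by (auto simp: pullback_def dom_simps)
    show "multilin (\<lambda>xs. pullback \<eta> k xs as)" for k as
      unfolding multilin_def pullback_def using ce_linear[OF \<eta>] by simp
    show "pullback \<eta> k xs as = pullback \<eta> k xs bs" if "mset as = mset bs" for k xs as bs
      using mset_eq_length[OF that] by (auto simp: pullback_def)
  qed (simp_all add: pullback_def)
  moreover have "pullback \<eta> q xs as = 0" if "\<not> distinct xs" for q xs as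
  proof -
    have "\<not> distinct (map coset xs)" using that by (simp add: distinct_map)
    then show ?thesis using \<eta> by (simp add: pullback_def Hom_wedge_def)
  qed
  ultimately have "pullback \<eta> \<in> semi N"
    by (simp add: semi_component_def Hom_wedge_sym_def tensors_def G_of_def Let_def)
  then show ?thesis
    unfolding basic_def using ce_kernel[OF \<eta>] by (auto simp: pullback_def)
qed

lemma skew_vanish:
  assumes "skew g" "\<And>xs. g (\<alpha> # xs) = 0"
  shows "g (us @ \<alpha> # vs) = 0"
proof (induction us arbitrary: vs rule: rev_induct)
  case (snoc u us)
  have "g (us @ u # \<alpha> # vs) = - g (us @ \<alpha> # u # vs)"
    using assms(1) unfolding skew_def by blast
  with snoc[of "u # vs"] show ?case by simp
qed (simp add: assms)

lemma basic_invariant: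
  assumes f: "f \<in> basic N" and "list_all2 (\<lambda>x y. x - y \<in> K) xs ys"
  shows "f 0 (us @ xs) [] = f 0 (us @ ys) []"
  using assms(2)
proof (induction arbitrary: us rule: list_all2_induct)
  case (Cons x xs y ys)
  have T: "f \<in> tensors N" and sk: "skew (\<lambda>xs. f 0 xs [])" using f by (auto simp: basic_def semi_iff)
  have "f 0 (us @ (x - y) # xs) [] = 0"
    by (rule skew_vanish[OF sk]) (use f Cons.hyps(1) in \<open>simp add: basic_def\<close>)
  moreover have "f 0 (us @ ((x - y) + y) # xs) [] = f 0 (us @ (x - y) # xs) [] + f 0 (us @ y # xs) []"
    using tensor_multilin[OF T, of 0 "[]"] unfolding multilin_def by blast
  ultimately show ?case using Cons.IH[of "us @ [y]"] by simp
qed simp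

definition rep :: "'g set \<Rightarrow> 'g" where
  "rep X = (SOME x. x \<in> X)"

lemma coset_rep: "X \<in> Q \<Longrightarrow> coset (rep X) = X"
proof -
  assume "X \<in> Q"
  then obtain x where X: "X = coset x" by (auto simp: quotient_space_def)
  have "x \<in> X" by (simp add: X mem_coset_iff K_closed)
  then have "rep X \<in> X" unfolding rep_def by (rule someI)
  then show ?thesis unfolding X by (simp add: mem_coset_iff coset_eq)
qed

lemma map_coset_rep: "set Xs \<subseteq> Q \<Longrightarrow> map coset (map rep Xs) = Xs"
  by (induction Xs) (simp_all add: coset_rep)

lemma map_rep_coset: "list_all2 (\<lambda>x y. x - y \<in> K) (map rep (map coset xs)) xs"
  by (induction xs) (simp_all add: coset_rep[OF coset_in_Q] flip: coset_eq)

text \<open>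
  A basic family does not change if an argument is changed by an element of \<open>K\<close>, so it can be evaluated on representatives of
  cosets.
\<close>

lemma basic_descends:
  assumes f: "f \<in> basic N"
  shows "\<exists>\<eta> \<in> ce N. pullback \<eta> = f"
proof -
  have T: "f \<in> tensors N" and S: "f \<in> semi N" using f by (auto simp: basic_def semi_iff)
  define \<eta> where "\<eta> Xs = (if set Xs \<subseteq> Q then f 0 (map rep Xs) [] else 0)" for Xs
  have \<eta>c: "\<eta> (map coset xs) = f 0 xs []" for xs
    using basic_invariant[OF f map_rep_coset, of "[]" xs] by (auto simp: \<eta>_def coset_in_Q)
  have "\<eta> \<in> ce N"
    unfolding Hom_wedge_def
  proof (intro CollectI conjI allI impI)
    show "\<eta> Xs = 0" if "\<not> (int (length Xs) = N \<and> set Xs \<subseteq> Q)" for Xs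
      using that domE[OF _ T, of 0 "map rep Xs" "[]"] by (auto simp: \<eta>_def dom_simps)
    show "\<eta> Xs = 0" if "\<not> distinct Xs" for Xs
    proof -
      have "\<not> distinct (map rep Xs)" using that by (simp add: distinct_map)
      then have "f 0 (map rep Xs) [] = 0"
        using S by (simp add: semi_component_def Hom_wedge_sym_def)
      then show ?thesis by (simp add: \<eta>_def)
    qed
    show "linear_on Q sQ sV (\<lambda>X. \<eta> (Xs[i := X]))"
      if "int (length Xs) = N \<and> set Xs \<subseteq> Q" "i < length Xs" for Xs i
    proof -
      define us vs where "us = map rep (take i Xs)" and "vs = map rep (drop (Suc i) Xs)"
      have "map coset us = take i Xs" "map coset vs = drop (Suc i) Xs"
        unfolding us_def vs_def using that set_take_subset[of i Xs] set_drop_subset[of "Suc i" Xs]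
        by (blast intro: map_coset_rep)+
      then have u: "\<eta> (Xs[i := coset x]) = f 0 (us @ x # vs) []" for x
        using \<eta>c[of "us @ x # vs"] by (simp add: upd_conv_take_nth_drop[OF that(2)])
      note m = tensor_multilin[OF T, of 0 "[]", unfolded multilin_def]
      show ?thesis
        unfolding linear_on_def
      proof (intro conjI ballI allI)
        fix X Y assume "X \<in> Q" "Y \<in> Q"
        then obtain x y where "X = coset x" "Y = coset y" by (auto simp: quotient_space_def)
        then show "\<eta> (Xs[i := X + Y]) = \<eta> (Xs[i := X]) + \<eta> (Xs[i := Y])"
          using m by (simp add: coset_add u)
      next
        fix c X assume "X \<in> Q"
        then obtain x where "X = coset x" by (auto simp: quotient_space_def)
        then show "\<eta> (Xs[i := sQ c X]) = sV c (\<eta> (Xs[i := X]))"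
          using m by (simp add: coset_scale u)
      qed
    qed
  qed
  moreover have "pullback \<eta> = f"
  proof (intro ext)
    fix k xs as
    show "pullback \<eta> k xs as = f k xs as"
      using f domE[OF _ T, of k xs as] by (cases "k = 0") (auto simp: pullback_def \<eta>c basic_def dom_simps)
  qed
  ultimately show ?thesis by blast
qed

lemma pullback_injective:
  assumes "\<And>Xs. \<not> (set Xs \<subseteq> Q) \<Longrightarrow> \<eta> Xs = 0" "\<And>Xs. \<not> (set Xs \<subseteq> Q) \<Longrightarrow> \<eta>' Xs = 0" "pullback \<eta> = pullback \<eta>'"
  shows "\<eta> = \<eta>'"
proof
  fix Xs
  show "\<eta> Xs = \<eta>' Xs"
  proof (cases "set Xs \<subseteq> Q")
    case True
    have "pullback \<eta> 0 (map rep Xs) [] = pullback \<eta>' 0 (map rep Xs) []" by (simp only: assms(3))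
    then have "\<eta> (map coset (map rep Xs)) = \<eta>' (map coset (map rep Xs))" by (simp add: pullback_def del: map_map)
    then show ?thesis by (simp only: map_coset_rep[OF True])
  qed (simp add: assms)
qed

lemma ce_diff_part_coset:
  "ce_diff_part (lie_bracket s br) sV (coset_action \<rho>) \<eta> (map coset xs) =
     alt_sum (\<lambda>x ys. \<rho> x (\<eta> (map coset ys))) xs + alt_sum2 (\<lambda>x y ys. \<eta> (map coset (skew_br x y # ys))) xs"
proof -
  have "ce_diff_part (lie_bracket s br) sV (coset_action \<rho>) \<eta> Xs =
      alt_sum (\<lambda>X Ys. coset_action \<rho> X (\<eta> Ys)) Xs + alt_sum2 (\<lambda>X Y Zs. \<eta> (lie_bracket s br X Y # Zs)) Xs"
    for Xs
    unfolding ce_diff_part_def V.alt_sum_eq[symmetric] V.alt_sum2_eq[symmetric] by (rule refl)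
  then show ?thesis
    unfolding alt_sum_map alt_sum2_map by (simp add: alt_sum_map alt_sum2_map coset_action coset_bracket coset_skew_br)
qed

text \<open>
  Modulo \<open>K\<close>, the skew-symmetrized bracket agrees with the bracket, and the terms with arguments from \<open>S K\<close> vanish.
\<close>

lemma semiD_pullback:
  assumes \<eta>: "\<eta> \<in> ce N"
  shows "semiD N (pullback \<eta>) = pullback (ceD N \<eta>)"
proof (intro ext)
  fix k xs as
  have p0: "pullback \<eta> 0 ys [] = \<eta> (map coset ys)" for ys by (simp add: pullback_def)
  have pS: "pullback \<eta> (Suc k) ys bs = 0" for k ys bs by (simp add: pullback_def)
  have b: "pullback \<eta> \<in> basic N" by (rule pullback_basic[OF \<eta>])
  show "semiD N (pullback \<eta>) k xs as = pullback (ceD N \<eta>) k xs as"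
  proof (cases "dom (N + 1) k xs as")
    case False
    then show ?thesis by (auto simp: semiD_apply pullback_def ceD_def dom_simps)
  next
    case d: True
    show ?thesis
    proof (cases k)
      case 0
      then have as: "as = []" using d by (simp add: dom_simps)
      have "semi_raw (pullback \<eta>) 0 xs [] = alt_sum (\<lambda>x ys. \<rho> x (\<eta> (map coset ys))) xs
          + alt_sum2 (\<lambda>x y ys. \<eta> (map coset (skew_br x y # ys))) xs"
        by (simp add: semi_raw_def koszul_part_def act_part_def bracket_part_def mixed_part_def ternary_part_def p0 pS del: list.map)
      then show ?thesis
        using d 0 as by (simp add: semiD_apply pullback_def ceD_def ce_diff_part_coset dom_simps coset_in_Q image_subset_iff)
    next
      case (Suc l)
      have "semi_raw (pullback \<eta>) k xs as = koszul_part (pullback \<eta>) k xs as"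
        by (rule semi_raw_top[of 0]) (simp_all add: pullback_def Suc)
      also have "\<dots> = pick_sum (\<lambda>\<alpha> bs. 0) as"
        unfolding koszul_part_def
      proof (rule pick_sum_cong)
        fix \<alpha> bs assume "\<alpha> \<in> set as"
        then have "\<alpha> \<in> K" using d by (auto simp: dom_simps)
        then show "pullback \<eta> (k - 1) (\<alpha> # xs) bs = 0"
          using b Suc by (cases l) (auto simp: basic_def)
      qed
      finally show ?thesis using Suc by (simp add: semiD_apply) (simp add: pullback_def)
    qed
  qed
qed

lemma vector_space_family: "vector_space scale_family"
  by unfold_locales (simp_all add: scale_family_def fun_eq_iff V.scale_right_distrib V.scale_left_distrib)

definition scale_ce :: "'k \<Rightarrow> ('g set list \<Rightarrow> 'v) \<Rightarrow> 'g set list \<Rightarrow> 'v" where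
  "scale_ce c \<eta> = (\<lambda>Xs. sV c (\<eta> Xs))"

lemma vector_space_ce: "vector_space scale_ce"
  by unfold_locales (simp_all add: scale_ce_def fun_eq_iff V.scale_right_distrib V.scale_left_distrib)

lemma subspace_semi: "module.subspace scale_family (semi N)"
proof -
  interpret F: vector_space scale_family by (rule vector_space_family)
  show ?thesis unfolding F.subspace_def using semi_zero semi_add semi_scale by blast
qed

lemma subspace_hemi: "module.subspace scale_family (hemi N)"
proof -
  interpret F: vector_space scale_family by (rule vector_space_family)
  show ?thesis unfolding F.subspace_def using hemi_zero hemi_add hemi_scale by blast
qed

lemma subspace_ce: "module.subspace scale_ce (ce N)"
proof -
  interpret F: vector_space scale_ce by (rule vector_space_ce)
  show ?thesis
    unfolding F.subspace_def
    by (auto simp: Hom_wedge_def linear_on_def scale_ce_def V.scale_right_distrib mult.commute add_ac)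
qed

lemma pullback_add: "pullback (\<eta> + \<eta>') = pullback \<eta> + pullback \<eta>'"
  by (simp add: pullback_def fun_eq_iff)

lemma pullback_scale: "pullback (scale_ce c \<eta>) = scale_family c (pullback \<eta>)"
  by (simp add: pullback_def fun_eq_iff scale_ce_def scale_family_def)

lemma ceD_off: "\<not> set Xs \<subseteq> Q \<Longrightarrow> ceD N \<eta> Xs = 0"
  by (simp add: ceD_def)

lemma ce_add: "\<eta> \<in> ce N \<Longrightarrow> \<eta>' \<in> ce N \<Longrightarrow> \<eta> + \<eta>' \<in> ce N"
proof -
  interpret F: vector_space scale_ce by (rule vector_space_ce)
  show "\<eta> \<in> ce N \<Longrightarrow> \<eta>' \<in> ce N \<Longrightarrow> \<eta> + \<eta>' \<in> ce N" by (rule F.subspace_add[OF subspace_ce])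
qed

lemma ce_scale: "\<eta> \<in> ce N \<Longrightarrow> scale_ce c \<eta> \<in> ce N"
proof -
  interpret F: vector_space scale_ce by (rule vector_space_ce)
  show "\<eta> \<in> ce N \<Longrightarrow> scale_ce c \<eta> \<in> ce N" by (rule F.subspace_scale[OF subspace_ce])
qed

lemma ceD_linear: "linear_on (ce N) scale_ce scale_ce (ceD N)"
  unfolding linear_on_def
proof (intro conjI ballI allI)
  fix \<eta> \<eta>' assume \<eta>: "\<eta> \<in> ce N" "\<eta>' \<in> ce N"
  show "ceD N (\<eta> + \<eta>') = ceD N \<eta> + ceD N \<eta>'"
  proof (rule pullback_injective)
    show "pullback (ceD N (\<eta> + \<eta>')) = pullback (ceD N \<eta> + ceD N \<eta>')"
      unfolding pullback_add semiD_pullback[OF ce_add[OF \<eta>], symmetric] semiD_pullback[OF \<eta>(1), symmetric]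
        semiD_pullback[OF \<eta>(2), symmetric]
      by (rule semiD_add)
  qed (simp_all add: ceD_off)
next
  fix c \<eta> assume \<eta>: "\<eta> \<in> ce N"
  show "ceD N (scale_ce c \<eta>) = scale_ce c (ceD N \<eta>)"
  proof (rule pullback_injective)
    show "pullback (ceD N (scale_ce c \<eta>)) = pullback (scale_ce c (ceD N \<eta>))"
      unfolding pullback_scale semiD_pullback[OF ce_scale[OF \<eta>], symmetric] semiD_pullback[OF \<eta>, symmetric]
      by (rule semiD_scale)
  qed (simp_all add: ceD_off scale_ce_def)
qed

lemma pullback_inj_on: "inj_on pullback (ce N)"
  by (rule inj_onI, rule pullback_injective) (auto intro: ce_off)

text \<open>
  The differential of the pullback is a cocycle without arguments from \<open>S K\<close>, so it is basic and descends.
\<close>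

lemma ceD_closed:
  assumes \<eta>: "\<eta> \<in> ce N"
  shows "ceD N \<eta> \<in> ce (N + 1)"
proof -
  have S: "pullback \<eta> \<in> semi N" using pullback_basic[OF \<eta>] by (simp add: basic_def)
  have "semiD N (pullback \<eta>) \<in> basic (N + 1)"
  proof (rule degree_zero_cocycle_basic)
    show "semiD N (pullback \<eta>) \<in> semi (N + 1)" by (rule semiD_semi[OF S])
    show "semiD (N + 1) (semiD N (pullback \<eta>)) \<in> basic (N + 1 + 1)"
      unfolding semiD_semiD[OF S] by (simp add: basic_def semi_zero)
    show "semiD N (pullback \<eta>) l xs as = 0" if "0 < l" for l xs as
      unfolding semiD_pullback[OF \<eta>] using that by (simp add: pullback_def)
  qed
  then obtain \<eta>' where \<eta>': "\<eta>' \<in> ce (N + 1)" "pullback \<eta>' = pullback (ceD N \<eta>)"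
    using basic_descends semiD_pullback[OF \<eta>] by metis
  have "\<eta>' = ceD N \<eta>"
    by (rule pullback_injective[OF ce_off[OF \<eta>'(1)] ceD_off \<eta>'(2)]) auto
  with \<eta>'(1) show ?thesis by simp
qed

lemma hemiD_linear: "linear_on (hemi N) scale_family scale_family (hemiD N)"
  by (simp add: linear_on_def fun_eq_iff hemiD_apply hemi_raw_add hemi_raw_scale)
    (simp add: scale_family_def hemiD_apply)

lemma semiD_linear: "linear_on (semi N) scale_family scale_family (semiD N)"
  by (simp add: linear_on_def semiD_add semiD_scale)

lemma wick_inj_on: "inj_on wick (semi N)"
proof (rule inj_onI)
  fix f g assume fg: "f \<in> semi N" "g \<in> semi N" "wick f = wick g"
  have "f - g = 0"
  proof (rule wick_injective)
    show "(f - g) k xs as = 0" if "\<not> dom N k xs as" for k xs as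
      using domE[OF that, of f] domE[OF that, of g] fg(1,2) unfolding semi_iff by simp
    show "wick (f - g) = 0"
      using fg(3) by (simp add: fun_eq_iff wick_diff)
  qed
  then show "f = g" by simp
qed

end

section \<open>Cochain maps and isomorphisms in cohomology\<close>

locale linear_cochains =
  fixes X :: "('k::field, 'c::ab_group_add) cochain_complex"
  assumes vector_space_scale: "vector_space (cscale X)"
    and subspace_space: "module.subspace (cscale X) (cspace X n)"
    and linear_diff: "linear_on (cspace X n) (cscale X) (cscale X) (cdiff X n)"

sublocale linear_cochains \<subseteq> vector_space "cscale X"
  by (rule vector_space_scale)

context linear_cochains
begin

lemma diff_add: "x \<in> cspace X n \<Longrightarrow> y \<in> cspace X n \<Longrightarrow> cdiff X n (x + y) = cdiff X n x + cdiff X n y"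
  and diff_scale: "x \<in> cspace X n \<Longrightarrow> cdiff X n (cscale X c x) = cscale X c (cdiff X n x)"
  using linear_diff by (simp_all add: linear_on_def)

lemma subspace_cocycles: "subspace (cocycles X n)"
  unfolding subspace_def cocycles_def
  using subspace_space[of n] diff_scale[of 0 n 0]
  by (auto simp: subspace_0 subspace_add subspace_scale diff_add diff_scale)

lemma subspace_coboundaries: "subspace (coboundaries X n)"
  unfolding subspace_def
proof (intro conjI ballI allI)
  note S = subspace_space[of "n - 1"]
  show "0 \<in> coboundaries X n"
    using subspace_0[OF S] diff_scale[of 0 "n - 1" 0] unfolding coboundaries_def by (auto simp: image_iff)
  show "x + y \<in> coboundaries X n" if xy: "x \<in> coboundaries X n" "y \<in> coboundaries X n" for x y
  proof -
    obtain u v where "u \<in> cspace X (n - 1)" "v \<in> cspace X (n - 1)" "x = cdiff X (n - 1) u" "y = cdiff X (n - 1) v"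
      using xy by (auto simp: coboundaries_def)
    then show ?thesis
      unfolding coboundaries_def by (intro image_eqI[of _ _ "u + v"]) (simp_all add: diff_add subspace_add[OF S])
  qed
  show "cscale X c x \<in> coboundaries X n" if x: "x \<in> coboundaries X n" for c x
  proof -
    obtain u where "u \<in> cspace X (n - 1)" "x = cdiff X (n - 1) u"
      using x by (auto simp: coboundaries_def)
    then show ?thesis
      unfolding coboundaries_def by (intro image_eqI[of _ _ "cscale X c u"]) (simp_all add: diff_scale subspace_scale[OF S])
  qed
qed

end

text \<open>
  A quasi-isomorphism \<open>t : X \<rightarrow> Y\<close> in terms of elements. In the direction from \<open>Y\<close> to \<open>X\<close>, no representatives of
  classes need to be chosen.
\<close>

lemma cohomology_isomorphicI:
  fixes X :: "('k::field, 'c::ab_group_add) cochain_complex"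
    and Y :: "('k, 'e::ab_group_add) cochain_complex"
  assumes X: "linear_cochains X" and Y: "linear_cochains Y"
    and space: "\<And>n x. x \<in> cspace X n \<Longrightarrow> t x \<in> cspace Y n"
    and linear: "\<And>n. linear_on (cspace X n) (cscale X) (cscale Y) t"
    and chain: "\<And>n x. x \<in> cspace X n \<Longrightarrow> cdiff Y n (t x) = t (cdiff X n x)"
    and surj: "\<And>n z. z \<in> cocycles Y n \<Longrightarrow> \<exists>x \<in> cocycles X n. z - t x \<in> coboundaries Y n"
    and inj: "\<And>n x. x \<in> cocycles X n \<Longrightarrow> t x \<in> coboundaries Y n \<Longrightarrow> x \<in> coboundaries X n"
  shows "cohomology_isomorphic Y X"
  unfolding cohomology_isomorphic_def
proof
  fix n
  interpret X: linear_cochains X by (rule X)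
  interpret Y: linear_cochains Y by (rule Y)
  let ?B = "coboundaries X n" and ?B' = "coboundaries Y n"
  note Z = X.subspace_cocycles[of n] and Z' = Y.subspace_cocycles[of n]
    and B = X.subspace_coboundaries[of n] and B' = Y.subspace_coboundaries[of n]
  have cs: "x \<in> cocycles X n \<Longrightarrow> x \<in> cspace X n" for x by (simp add: cocycles_def)
  have t_add: "t (x + y) = t x + t y" and t_scale: "t (cscale X c x) = cscale Y c (t x)"
    if "x \<in> cspace X n" "y \<in> cspace X n" for x y c n
    using linear[of n] that by (simp_all add: linear_on_def)
  have t_zero: "t 0 = 0"
    using t_scale[OF X.subspace_0[OF X.subspace_space] X.subspace_0[OF X.subspace_space], of 0] by simp
  have t_minus: "t (- x) = - t x" if "x \<in> cspace X n" for x
    using t_scale[OF that that, of "- 1"] by simp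
  have t_diff: "t (x - y) = t x - t y" if "x \<in> cspace X n" "y \<in> cspace X n" for x y
    using t_add[OF that(1) X.subspace_neg[OF X.subspace_space that(2)]] t_minus[OF that(2)] by simp
  have t_cocycle: "t x \<in> cocycles Y n" if "x \<in> cocycles X n" for x
    using that space[of x n] chain[of x n] t_zero by (simp add: cocycles_def)
  have t_coboundary: "t x \<in> ?B'" if "x \<in> ?B" for x
    using that space chain by (auto simp: coboundaries_def intro!: image_eqI)
  \<comment> \<open>a class of \<open>Y\<close> is sent to the class of the cocycles of \<open>X\<close> that represent it\<close>
  define \<psi> where "\<psi> C = {x \<in> cocycles X n. t x \<in> C} + ?B" for C
  have \<psi>: "\<psi> (z +o ?B') = x +o ?B" if x: "x \<in> cocycles X n" "z - t x \<in> ?B'" for x z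
  proof (intro set_eqI iffI)
    fix y assume "y \<in> \<psi> (z +o ?B')"
    then obtain a b where a: "a \<in> cocycles X n" "t a - z \<in> ?B'" and b: "b \<in> ?B" "y = a + b"
      by (auto simp: \<psi>_def set_plus_def Y.mem_coset_iff)
    have "t (a - x) = (t a - z) + (z - t x)" by (simp add: t_diff[OF cs[OF a(1)] cs[OF x(1)]])
    then have "t (a - x) \<in> ?B'" using Y.subspace_add[OF B' a(2) x(2)] by simp
    then have "a - x \<in> ?B" by (rule inj[OF X.subspace_diff[OF Z a(1) x(1)]])
    then have "(a - x) + b \<in> ?B" by (rule X.subspace_add[OF B _ b(1)])
    moreover have "(a - x) + b = y - x" by (simp add: b)
    ultimately show "y \<in> x +o ?B" unfolding X.mem_coset_iff by simp
  next
    fix y assume "y \<in> x +o ?B"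
    then have "y - x \<in> ?B" by (simp add: X.mem_coset_iff)
    moreover have "t x - z \<in> ?B'" using Y.subspace_neg[OF B' x(2)] by simp
    ultimately show "y \<in> \<psi> (z +o ?B')"
      unfolding \<psi>_def set_plus_def using x(1)
      by (intro CollectI bexI[of _ x] bexI[of _ "y - x"]) (simp_all add: Y.mem_coset_iff)
  qed
  have \<psi>': "\<exists>z x. C = z +o ?B' \<and> z \<in> cocycles Y n \<and> x \<in> cocycles X n \<and> z - t x \<in> ?B' \<and> \<psi> C = x +o ?B"
    if "C \<in> cohomology Y n" for C
    using that surj \<psi> unfolding cohomology_def quotient_space_def by blast
  have "linear_on (cohomology Y n) (cohomology_scale Y n) (cohomology_scale X n) \<psi>"
    unfolding linear_on_def
  proof (intro conjI ballI allI)
    fix C C' assume "C \<in> cohomology Y n" "C' \<in> cohomology Y n"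
    then obtain z x z' x' where C: "C = z +o ?B'" "x \<in> cocycles X n" "z - t x \<in> ?B'" "\<psi> C = x +o ?B"
      "C' = z' +o ?B'" "x' \<in> cocycles X n" "z' - t x' \<in> ?B'" "\<psi> C' = x' +o ?B"
      using \<psi>' by meson
    have e: "z + z' - t (x + x') = (z - t x) + (z' - t x')" by (simp add: t_add[OF cs[OF C(2)] cs[OF C(6)]])
    have "z + z' - t (x + x') \<in> ?B'" unfolding e by (rule Y.subspace_add[OF B' C(3) C(7)])
    then have "\<psi> ((z + z') +o ?B') = (x + x') +o ?B"
      by (rule \<psi>[OF X.subspace_add[OF Z C(2) C(6)]])
    then show "\<psi> (C + C') = \<psi> C + \<psi> C'"
      unfolding C(4,8) unfolding C(1,5) X.subspace_coset_add[OF B] Y.subspace_coset_add[OF B'] .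
  next
    fix c C assume "C \<in> cohomology Y n"
    then obtain z x where C: "C = z +o ?B'" "x \<in> cocycles X n" "z - t x \<in> ?B'" "\<psi> C = x +o ?B"
      using \<psi>' by meson
    have e: "cscale Y c z - t (cscale X c x) = cscale Y c (z - t x)"
      by (simp add: t_scale[OF cs[OF C(2)] cs[OF C(2)]] Y.scale_right_diff_distrib)
    have "cscale Y c z - t (cscale X c x) \<in> ?B'" unfolding e by (rule Y.subspace_scale[OF B' C(3)])
    then have "\<psi> (cscale Y c z +o ?B') = cscale X c x +o ?B"
      by (rule \<psi>[OF X.subspace_scale[OF Z C(2)]])
    then show "\<psi> (cohomology_scale Y n c C) = cohomology_scale X n c (\<psi> C)"
      unfolding C(4) unfolding C(1) cohomology_scale_def X.subspace_coset_scale[OF B] Y.subspace_coset_scale[OF B'] .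
  qed
  moreover have "bij_betw \<psi> (cohomology Y n) (cohomology X n)"
    unfolding bij_betw_def
  proof
    show "inj_on \<psi> (cohomology Y n)"
    proof (rule inj_onI)
      fix C C' assume "C \<in> cohomology Y n" "C' \<in> cohomology Y n" and eq: "\<psi> C = \<psi> C'"
      then obtain z x z' x' where C: "C = z +o ?B'" "x \<in> cocycles X n" "z - t x \<in> ?B'" "\<psi> C = x +o ?B"
        "C' = z' +o ?B'" "x' \<in> cocycles X n" "z' - t x' \<in> ?B'" "\<psi> C' = x' +o ?B"
        using \<psi>' by meson
      have "x - x' \<in> ?B" using eq unfolding C(4,8) X.subspace_coset_eq[OF B] .
      then have "t x - t x' \<in> ?B'" using t_coboundary t_diff[OF cs[OF C(2)] cs[OF C(6)]] by metis
      moreover have "z - z' = (z - t x) + (t x - t x') - (z' - t x')" by simp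
      ultimately have "z - z' \<in> ?B'"
        using Y.subspace_diff[OF B' Y.subspace_add[OF B' C(3)] C(7)] by metis
      then show "C = C'" unfolding C(1,5) Y.subspace_coset_eq[OF B'] .
    qed
    show "\<psi> ` cohomology Y n = cohomology X n"
    proof (intro set_eqI iffI)
      fix C assume "C \<in> \<psi> ` cohomology Y n"
      then show "C \<in> cohomology X n"
        using \<psi>' unfolding cohomology_def[of X] quotient_space_def by blast
    next
      fix C assume "C \<in> cohomology X n"
      then obtain x where x: "x \<in> cocycles X n" "C = x +o ?B"
        by (auto simp: cohomology_def quotient_space_def)
      have "\<psi> (t x +o ?B') = C"
        unfolding x(2) by (rule \<psi>[OF x(1)]) (simp add: Y.subspace_0[OF B'])
      moreover have "t x +o ?B' \<in> cohomology Y n"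
        using t_cocycle[OF x(1)] by (simp add: cohomology_def quotient_space_def)
      ultimately show "C \<in> \<psi> ` cohomology Y n" by blast
    qed
  qed
  ultimately show "\<exists>\<phi>. bij_betw \<phi> (cohomology Y n) (cohomology X n) \<and>
      linear_on (cohomology Y n) (cohomology_scale Y n) (cohomology_scale X n) \<phi>" by blast
qed

section \<open>Coefficients in a two-term complex\<close>

text \<open>
  The total complex of a cochain map \<open>P\<close>, up to signs contained in \<open>P\<close>, from \<open>(A1, D1)\<close> to \<open>(A0, D0)\<close>. The degree of the first
  component is shifted by 1, as its values lie in degree \<open>-1\<close>.
\<close>

locale two_term_cochains =
  fixes X :: "('k::field, 'c::ab_group_add \<times> 'e::ab_group_add) cochain_complex"
    and s1 :: "'k \<Rightarrow> 'c \<Rightarrow> 'c" and s0 :: "'k \<Rightarrow> 'e \<Rightarrow> 'e"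
    and A1 :: "int \<Rightarrow> 'c set" and A0 :: "int \<Rightarrow> 'e set"
    and D1 :: "int \<Rightarrow> 'c \<Rightarrow> 'c" and D0 :: "int \<Rightarrow> 'e \<Rightarrow> 'e" and P :: "int \<Rightarrow> 'c \<Rightarrow> 'e"
  assumes vs1: "vector_space s1" and vs0: "vector_space s0"
    and sub1: "module.subspace s1 (A1 N)" and sub0: "module.subspace s0 (A0 N)"
    and scale_X: "cscale X = (\<lambda>c \<omega>. (s1 c (fst \<omega>), s0 c (snd \<omega>)))"
    and space_X: "cspace X n = A1 (n + 1) \<times> A0 n"
    and diff_X: "f \<in> A1 (n + 1) \<Longrightarrow> g \<in> A0 n \<Longrightarrow> cdiff X n (f, g) = (D1 (n + 1) f, P n f + D0 n g)"
    and D1_closed: "f \<in> A1 N \<Longrightarrow> D1 N f \<in> A1 (N + 1)" and D0_closed: "g \<in> A0 N \<Longrightarrow> D0 N g \<in> A0 (N + 1)"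
    and P_closed: "f \<in> A1 (N + 1) \<Longrightarrow> P N f \<in> A0 (N + 1)"
    and D1_linear: "linear_on (A1 N) s1 s1 (D1 N)" and D0_linear: "linear_on (A0 N) s0 s0 (D0 N)"
    and P_linear: "linear_on (A1 (N + 1)) s1 s0 (P N)"

sublocale two_term_cochains \<subseteq> S1: vector_space s1 by (rule vs1)
sublocale two_term_cochains \<subseteq> S0: vector_space s0 by (rule vs0)

context two_term_cochains
begin

lemma linear_cochains: "linear_cochains X"
proof -
  have vs: "vector_space (cscale X)"
    unfolding scale_X
    by unfold_locales (simp_all add: S1.scale_right_distrib S0.scale_right_distrib
        S1.scale_left_distrib S0.scale_left_distrib)
  interpret vector_space "cscale X" by (rule vs)
  show ?thesis
  proof
    show "subspace (cspace X n)" for n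
      unfolding subspace_def space_X unfolding scale_X
      using S1.subspace_0[OF sub1[of "n + 1"]] S1.subspace_add[OF sub1[of "n + 1"]] S1.subspace_scale[OF sub1[of "n + 1"]]
        S0.subspace_0[OF sub0[of n]] S0.subspace_add[OF sub0[of n]] S0.subspace_scale[OF sub0[of n]]
      by (auto simp: zero_prod_def)
    show "linear_on (cspace X n) (cscale X) (cscale X) (cdiff X n)" for n
      unfolding linear_on_def space_X
    proof (intro conjI ballI allI)
      fix u v assume "u \<in> A1 (n + 1) \<times> A0 n" "v \<in> A1 (n + 1) \<times> A0 n"
      then obtain f g f' g' where e: "u = (f, g)" "v = (f', g')"
        and m: "f \<in> A1 (n + 1)" "f' \<in> A1 (n + 1)" "g \<in> A0 n" "g' \<in> A0 n" by auto
      have m': "f + f' \<in> A1 (n + 1)" "g + g' \<in> A0 n"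
        using m S1.subspace_add[OF sub1] S0.subspace_add[OF sub0] by auto
      show "cdiff X n (u + v) = cdiff X n u + cdiff X n v"
        using m m' D1_linear[of "n + 1"] D0_linear[of n] P_linear[of n]
        by (simp add: e diff_X linear_on_def algebra_simps)
    next
      fix c u assume "u \<in> A1 (n + 1) \<times> A0 n"
      then obtain f g where e: "u = (f, g)" and m: "f \<in> A1 (n + 1)" "g \<in> A0 n" by auto
      have m': "s1 c f \<in> A1 (n + 1)" "s0 c g \<in> A0 n"
        using m S1.subspace_scale[OF sub1] S0.subspace_scale[OF sub0] by auto
      show "cdiff X n (cscale X c u) = cscale X c (cdiff X n u)"
        using m m' D1_linear[of "n + 1"] D0_linear[of n] P_linear[of n]
        by (simp add: e scale_X diff_X linear_on_def S0.scale_right_distrib)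
    qed
  qed
qed

lemma minus_closed:
  "f \<in> A1 N \<Longrightarrow> f' \<in> A1 N \<Longrightarrow> f - f' \<in> A1 N" "g \<in> A0 N \<Longrightarrow> g' \<in> A0 N \<Longrightarrow> g - g' \<in> A0 N"
  by (auto intro: S1.subspace_diff[OF sub1] S0.subspace_diff[OF sub0])

lemma zero_closed: "0 \<in> A1 N" "0 \<in> A0 N"
  by (rule S1.subspace_0[OF sub1] S0.subspace_0[OF sub0])+

lemma D1_diff:
  assumes "f \<in> A1 N" "f' \<in> A1 N" shows "D1 N (f - f') = D1 N f - D1 N f'"
proof -
  have "D1 N ((f - f') + f') = D1 N (f - f') + D1 N f'"
    using assms D1_linear[of N] minus_closed(1)[OF assms] unfolding linear_on_def by blast
  then show ?thesis by simp
qed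

lemma D0_diff:
  assumes "f \<in> A0 N" "f' \<in> A0 N" shows "D0 N (f - f') = D0 N f - D0 N f'"
proof -
  have "D0 N ((f - f') + f') = D0 N (f - f') + D0 N f'"
    using assms D0_linear[of N] minus_closed(2)[OF assms] unfolding linear_on_def by blast
  then show ?thesis by simp
qed

lemma P_diff:
  assumes "f \<in> A1 (N + 1)" "f' \<in> A1 (N + 1)" shows "P N (f - f') = P N f - P N f'"
proof -
  have "P N ((f - f') + f') = P N (f - f') + P N f'"
    using assms P_linear[of N] minus_closed(1)[OF assms] unfolding linear_on_def by blast
  then show ?thesis by simp
qed

end

text \<open>
  Injective maps \<open>t1\<close>, \<open>t0\<close> of the two components that commute with everything. The assumptions \<open>reduce1\<close> and \<open>reduce0\<close> say
  that every cochain whose differential lies in the image is, up to a coboundary, itself in the image. This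
  is stronger than for cocycles only: in the chase below, the second component is a cocycle only up to
  terms coming from the first.
\<close>

locale two_term_comparison =
  X: two_term_cochains X s1 s0 A1 A0 D1 D0 P +
  Y: two_term_cochains Y s1' s0' B1 B0 E1 E0 R
  for X :: "('k::field, 'c::ab_group_add \<times> 'e::ab_group_add) cochain_complex"
    and s1 s0 A1 A0 D1 D0 P
    and Y :: "('k, 'c'::ab_group_add \<times> 'e'::ab_group_add) cochain_complex"
    and s1' s0' B1 B0 E1 E0 R +
  fixes t1 :: "'c \<Rightarrow> 'c'" and t0 :: "'e \<Rightarrow> 'e'"
  assumes t1_closed: "f \<in> A1 N \<Longrightarrow> t1 f \<in> B1 N" and t0_closed: "g \<in> A0 N \<Longrightarrow> t0 g \<in> B0 N"
    and t1_linear: "linear_on (A1 N) s1 s1' t1" and t0_linear: "linear_on (A0 N) s0 s0' t0"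
    and t1_inj: "inj_on t1 (A1 N)" and t0_inj: "inj_on t0 (A0 N)"
    and t1_D1: "f \<in> A1 N \<Longrightarrow> E1 N (t1 f) = t1 (D1 N f)"
    and t0_D0: "g \<in> A0 N \<Longrightarrow> E0 N (t0 g) = t0 (D0 N g)"
    and t_P: "f \<in> A1 (N + 1) \<Longrightarrow> R N (t1 f) = t0 (P N f)"
    and E1_E1: "u \<in> B1 N \<Longrightarrow> E1 (N + 1) (E1 N u) = 0"
    and E0_E0: "v \<in> B0 N \<Longrightarrow> E0 (N + 1) (E0 N v) = 0"
    and E0_R: "u \<in> B1 N \<Longrightarrow> E0 N (R (N - 1) u) = - R N (E1 N u)"
    and reduce1: "u \<in> B1 N \<Longrightarrow> E1 N u \<in> t1 ` A1 (N + 1) \<Longrightarrow> \<exists>\<theta> \<in> B1 (N - 1). u - E1 (N - 1) \<theta> \<in> t1 ` A1 N"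
    and reduce0: "v \<in> B0 N \<Longrightarrow> E0 N v \<in> t0 ` A0 (N + 1) \<Longrightarrow> \<exists>\<theta> \<in> B0 (N - 1). v - E0 (N - 1) \<theta> \<in> t0 ` A0 N"
begin

lemma t_zero: "t1 0 = 0" "t0 0 = 0"
proof -
  have "t1 (0 + 0) = t1 0 + t1 0" "t0 (0 + 0) = t0 0 + t0 0"
    using t1_linear[of 0] t0_linear[of 0] X.zero_closed[of 0] unfolding linear_on_def by blast+
  then show "t1 0 = 0" "t0 0 = 0" by simp_all
qed

lemma t0_add: "g \<in> A0 N \<Longrightarrow> g' \<in> A0 N \<Longrightarrow> t0 (g + g') = t0 g + t0 g'"
  using t0_linear[of N] unfolding linear_on_def by blast

lemma t0_minus: "g \<in> A0 N \<Longrightarrow> t0 (- g) = - t0 g"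
  using t0_add[of g N "- g"] X.minus_closed(2)[of 0 N g] X.zero_closed[of N] t_zero
  by (simp add: eq_neg_iff_add_eq_0 add.commute)

text \<open>
  Both parts are the same chase: adjust the first component by a coboundary so that it lies in the image, correct the second
  component accordingly, and adjust that one.
\<close>

lemma cohomology_isomorphic: "cohomology_isomorphic Y X"
proof (rule cohomology_isomorphicI[where t = "\<lambda>\<omega>. (t1 (fst \<omega>), t0 (snd \<omega>))"])
  show "linear_cochains X" by (rule X.linear_cochains)
  show "linear_cochains Y" by (rule Y.linear_cochains)
  show "(t1 (fst x), t0 (snd x)) \<in> cspace Y n" if "x \<in> cspace X n" for x n
    using that t1_closed t0_closed by (auto simp: X.space_X Y.space_X)
  show "linear_on (cspace X n) (cscale X) (cscale Y) (\<lambda>\<omega>. (t1 (fst \<omega>), t0 (snd \<omega>)))" for n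
    using t1_linear[of "n + 1"] t0_linear[of n]
    by (auto simp: linear_on_def X.space_X X.scale_X Y.scale_X)
  show "cdiff Y n (t1 (fst x), t0 (snd x)) = (t1 (fst (cdiff X n x)), t0 (snd (cdiff X n x)))"
    if x: "x \<in> cspace X n" for n x
  proof -
    obtain f g where e: "x = (f, g)" and m: "f \<in> A1 (n + 1)" "g \<in> A0 n"
      using x by (auto simp: X.space_X)
    show ?thesis
      using m t0_add[OF X.P_closed[OF m(1)] X.D0_closed[OF m(2)]]
      by (simp add: e X.diff_X Y.diff_X t1_closed t0_closed t1_D1 t0_D0 t_P)
  qed
next
  fix n z assume z: "z \<in> cocycles Y n"
  then obtain f g where e: "z = (f, g)" and m: "f \<in> B1 (n + 1)" "g \<in> B0 n"
    by (auto simp: cocycles_def Y.space_X)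
  have c: "E1 (n + 1) f = 0" "R n f + E0 n g = 0"
    using z m by (auto simp: cocycles_def e Y.diff_X zero_prod_def)
  have "E1 (n + 1) f \<in> t1 ` A1 (n + 1 + 1)" using c X.zero_closed t_zero by (metis imageI)
  from reduce1[OF m(1) this] obtain \<theta> a1 where \<theta>: "\<theta> \<in> B1 n" and a1: "a1 \<in> A1 (n + 1)" "f - E1 n \<theta> = t1 a1"
    by auto
  have E\<theta>: "E1 n \<theta> \<in> B1 (n + 1)" by (rule Y.D1_closed[OF \<theta>])
  have R\<theta>: "R (n - 1) \<theta> \<in> B0 n" using Y.P_closed[of \<theta> "n - 1"] \<theta> by simp
  \<comment> \<open>the second component of \<open>z\<close> minus the coboundary of \<open>(\<theta>, 0)\<close>\<close>
  define g' where "g' = g - R (n - 1) \<theta>"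
  have g': "g' \<in> B0 n" unfolding g'_def by (rule Y.minus_closed(2)[OF m(2) R\<theta>])
  have "E0 n g' = - R n f + R n (E1 n \<theta>)"
    using c(2) by (simp add: g'_def Y.D0_diff[OF m(2) R\<theta>] E0_R[OF \<theta>] eq_neg_iff_add_eq_0 add.commute)
  also have "\<dots> = - R n (t1 a1)"
    unfolding a1(2)[symmetric] Y.P_diff[OF m(1) E\<theta>] by simp
  also have "\<dots> = t0 (- P n a1)" by (simp add: t_P[OF a1(1)] t0_minus[OF X.P_closed[OF a1(1)]])
  finally have Eg': "E0 n g' = t0 (- P n a1)" .
  have Pa: "- P n a1 \<in> A0 (n + 1)" by (rule X.S0.subspace_neg[OF X.sub0 X.P_closed[OF a1(1)]])
  have "E0 n g' \<in> t0 ` A0 (n + 1)" unfolding Eg' using Pa by (rule imageI)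
  from reduce0[OF g' this] obtain \<theta>0 a0 where \<theta>0: "\<theta>0 \<in> B0 (n - 1)"
    and a0: "a0 \<in> A0 n" "g' - E0 (n - 1) \<theta>0 = t0 a0" by auto
  have E\<theta>0: "E0 (n - 1) \<theta>0 \<in> B0 n" using Y.D0_closed[OF \<theta>0] by simp
  have "t1 (D1 (n + 1) a1) = t1 0"
    unfolding t1_D1[OF a1(1), symmetric] a1(2)[symmetric] Y.D1_diff[OF m(1) E\<theta>] c(1) E1_E1[OF \<theta>] t_zero by simp
  then have 1: "D1 (n + 1) a1 = 0"
    by (rule inj_onD[OF t1_inj _ X.D1_closed[OF a1(1)] X.zero_closed(1)])
  have "t0 (D0 n a0) = t0 (- P n a1)"
    unfolding t0_D0[OF a0(1), symmetric] a0(2)[symmetric] Y.D0_diff[OF g' E\<theta>0] Eg'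
    using E0_E0[OF \<theta>0] by simp
  then have 2: "D0 n a0 = - P n a1"
    by (rule inj_onD[OF t0_inj _ X.D0_closed[OF a0(1)] Pa])
  have "(a1, a0) \<in> cocycles X n"
    using a1 a0 1 2 by (simp add: cocycles_def X.space_X X.diff_X zero_prod_def)
  moreover have "z - (t1 a1, t0 a0) \<in> coboundaries Y n"
    unfolding coboundaries_def
  proof (rule image_eqI)
    show "(\<theta>, \<theta>0) \<in> cspace Y (n - 1)" using \<theta> \<theta>0 by (simp add: Y.space_X)
    have "f - t1 a1 = E1 n \<theta>" "g - t0 a0 = R (n - 1) \<theta> + E0 (n - 1) \<theta>0"
      using a1(2) a0(2) by (simp_all add: g'_def algebra_simps)
    then show "z - (t1 a1, t0 a0) = cdiff Y (n - 1) (\<theta>, \<theta>0)"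
      using Y.diff_X[of \<theta> "n - 1" \<theta>0] \<theta> \<theta>0 by (simp add: e)
  qed
  ultimately show "\<exists>x \<in> cocycles X n. z - (t1 (fst x), t0 (snd x)) \<in> coboundaries Y n" by force
next
  fix n x assume x: "x \<in> cocycles X n" and tx: "(t1 (fst x), t0 (snd x)) \<in> coboundaries Y n"
  obtain a1 a0 where e: "x = (a1, a0)" and a: "a1 \<in> A1 (n + 1)" "a0 \<in> A0 n"
    using x by (auto simp: cocycles_def X.space_X)
  obtain \<theta>1 \<theta>0 where \<theta>: "\<theta>1 \<in> B1 n" "\<theta>0 \<in> B0 (n - 1)"
    and t\<theta>: "(t1 a1, t0 a0) = cdiff Y (n - 1) (\<theta>1, \<theta>0)"
    using tx by (auto simp: coboundaries_def e Y.space_X)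
  have t: "t1 a1 = E1 n \<theta>1" "t0 a0 = R (n - 1) \<theta>1 + E0 (n - 1) \<theta>0"
    using t\<theta> Y.diff_X[of \<theta>1 "n - 1" \<theta>0] \<theta> by simp_all
  have "E1 n \<theta>1 \<in> t1 ` A1 (n + 1)" using a t(1) by (metis imageI)
  from reduce1[OF \<theta>(1) this] obtain \<tau>1 b1 where \<tau>1: "\<tau>1 \<in> B1 (n - 1)" and b1: "b1 \<in> A1 n" "\<theta>1 - E1 (n - 1) \<tau>1 = t1 b1"
    by auto
  have E\<tau>: "E1 (n - 1) \<tau>1 \<in> B1 n" using Y.D1_closed[OF \<tau>1] by simp
  have "t1 (D1 n b1) = t1 a1"
    unfolding t1_D1[OF b1(1), symmetric] b1(2)[symmetric] Y.D1_diff[OF \<theta>(1) E\<tau>] t(1)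
    using E1_E1[OF \<tau>1] by simp
  then have 1: "D1 n b1 = a1" by (rule inj_onD[OF t1_inj _ X.D1_closed[OF b1(1)] a(1)])
  have R\<tau>: "R (n - 1 - 1) \<tau>1 \<in> B0 (n - 1)" using Y.P_closed[of \<tau>1 "n - 1 - 1"] \<tau>1 by simp
  \<comment> \<open>the second component of \<open>(\<theta>1, \<theta>0)\<close> minus the coboundary of \<open>(\<tau>1, 0)\<close>\<close>
  define g' where "g' = \<theta>0 - R (n - 1 - 1) \<tau>1"
  have g': "g' \<in> B0 (n - 1)" unfolding g'_def by (rule Y.minus_closed(2)[OF \<theta>(2) R\<tau>])
  have P: "P (n - 1) b1 \<in> A0 n" using X.P_closed[of b1 "n - 1"] b1 by simp
  have "E0 (n - 1) g' = E0 (n - 1) \<theta>0 + R (n - 1) (E1 (n - 1) \<tau>1)"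
    unfolding g'_def Y.D0_diff[OF \<theta>(2) R\<tau>] E0_R[OF \<tau>1] by simp
  also have "R (n - 1) (E1 (n - 1) \<tau>1) = R (n - 1) \<theta>1 - R (n - 1) (t1 b1)"
    unfolding b1(2)[symmetric] using Y.P_diff[of \<theta>1 "n - 1" "E1 (n - 1) \<tau>1"] \<theta>(1) E\<tau> by simp
  also have "R (n - 1) (t1 b1) = t0 (P (n - 1) b1)" using t_P[of b1 "n - 1"] b1 by simp
  also have "E0 (n - 1) \<theta>0 + (R (n - 1) \<theta>1 - t0 (P (n - 1) b1)) = t0 (a0 - P (n - 1) b1)"
    using t0_add[OF a(2) X.S0.subspace_neg[OF X.sub0 P]] t0_minus[OF P] by (simp add: t(2) algebra_simps)
  finally have Eg': "E0 (n - 1) g' = t0 (a0 - P (n - 1) b1)" .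
  have Pa: "a0 - P (n - 1) b1 \<in> A0 (n - 1 + 1)" using X.minus_closed(2)[OF a(2) P] by simp
  have "E0 (n - 1) g' \<in> t0 ` A0 (n - 1 + 1)" unfolding Eg' using Pa by (rule imageI)
  from reduce0[OF g' this] obtain \<tau>0 b0 where \<tau>0: "\<tau>0 \<in> B0 (n - 1 - 1)"
    and b0: "b0 \<in> A0 (n - 1)" "g' - E0 (n - 1 - 1) \<tau>0 = t0 b0" by auto
  have E\<tau>0: "E0 (n - 1 - 1) \<tau>0 \<in> B0 (n - 1)" using Y.D0_closed[OF \<tau>0] by simp
  have "t0 (D0 (n - 1) b0) = t0 (a0 - P (n - 1) b1)"
    unfolding t0_D0[OF b0(1), symmetric] b0(2)[symmetric] Y.D0_diff[OF g' E\<tau>0] Eg'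
    using E0_E0[OF \<tau>0] by simp
  then have 2: "D0 (n - 1) b0 = a0 - P (n - 1) b1"
    by (rule inj_onD[OF t0_inj _ X.D0_closed[OF b0(1)] Pa])
  show "x \<in> coboundaries X n"
    unfolding coboundaries_def
  proof (rule image_eqI)
    show "(b1, b0) \<in> cspace X (n - 1)" using b1 b0 by (simp add: X.space_X)
    show "x = cdiff X (n - 1) (b1, b0)"
      using X.diff_X[of b1 "n - 1" b0] b1(1) b0(1) 1 2 by (simp add: e)
  qed
qed

end

section \<open>The complexes of a representation\<close>

text \<open>
  All constructions above are natural in the module; \<open>d\<close> plays the role of the differential of \<open>V\<close>.
\<close>

locale leibniz_module_morphism =
  M1: leibniz_module s br sV1 \<rho>1 + M0: leibniz_module s br sV0 \<rho>0
  for s :: "'k::field_char_0 \<Rightarrow> 'g::ab_group_add \<Rightarrow> 'g" and br :: "'g \<Rightarrow> 'g \<Rightarrow> 'g"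
    and sV1 :: "'k \<Rightarrow> 'v::ab_group_add \<Rightarrow> 'v" and \<rho>1 :: "'g \<Rightarrow> 'v \<Rightarrow> 'v"
    and sV0 :: "'k \<Rightarrow> 'w::ab_group_add \<Rightarrow> 'w" and \<rho>0 :: "'g \<Rightarrow> 'w \<Rightarrow> 'w" +
  fixes d :: "'v \<Rightarrow> 'w"
  assumes d_add: "d (u + v) = d u + d v" and d_scale: "d (sV1 c v) = sV0 c (d v)"
    and d_\<rho>: "d (\<rho>1 x v) = \<rho>0 x (d v)"
begin

definition push :: "('g, 'g, 'v) family \<Rightarrow> ('g, 'g, 'w) family" where
  "push f = (\<lambda>k xs as. d (f k xs as))"

definition push_ce :: "('g set list \<Rightarrow> 'v) \<Rightarrow> 'g set list \<Rightarrow> 'w" where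
  "push_ce \<eta> = (\<lambda>Xs. d (\<eta> Xs))"

lemma d_simps: "d 0 = 0" "d (- v) = - d v" "d (u - v) = d u - d v"
proof -
  show z: "d 0 = 0" using d_add[of 0 0] by simp
  show m: "d (- v) = - d v" for v
    using d_add[of v "- v"] z by (simp add: eq_neg_iff_add_eq_0 add.commute)
  show "d (u - v) = d u - d v" using d_add[of u "- v"] m by simp
qed

lemma push_tensor:
  assumes f: "f \<in> M1.tensors N"
  shows "push f \<in> M0.tensors N"
  unfolding push_def
proof (rule M0.tensorI)
  show "d (f k xs as) = 0" if "\<not> M0.dom N k xs as" for k xs as
    using M1.domE[OF that f] by (simp add: d_simps)
  show "M0.multilin (\<lambda>xs. d (f k xs as))" for k as
    using M1.tensor_multilin[OF f, of k as] by (simp add: M1.multilin_def M0.multilin_def d_add d_scale)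
  show "d (f k xs as) = d (f k xs bs)" if "mset as = mset bs" for k xs as bs
    using M1.tensor_sym[OF f that] by simp
qed (simp_all add: M1.tensor_linear_sym[OF f] d_add d_scale)

lemma push_semi:
  assumes "f \<in> M1.semi N" shows "push f \<in> M0.semi N"
proof -
  have "M0.skew (\<lambda>xs. push f k xs as)" for k as
  proof -
    have "M1.skew (\<lambda>xs. f k xs as)" using assms M1.semi_iff by blast
    then show ?thesis unfolding M1.skew_def M0.skew_def push_def by (metis d_simps(2))
  qed
  then show ?thesis using assms push_tensor unfolding M1.semi_iff M0.semi_iff by blast
qed

lemma push_hemi:
  assumes "f \<in> M1.hemi N" shows "push f \<in> M0.hemi N"
proof -
  have "push f k (us @ x # y # vs) as + push f k (us @ y # x # vs) as =
      - push f (Suc k) (us @ vs) (M1.h x y # as)" for k us x y vs as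
    using M1.hemi_skew_append[OF assms] unfolding push_def by (metis d_add d_simps(2))
  then show ?thesis using assms push_tensor unfolding M1.hemi_iff M0.hemi_iff by blast
qed

lemma push_hemi_raw: "M0.hemi_raw (push f) k xs as = d (M1.hemi_raw f k xs as)"
  by (simp add: M1.hemi_raw_def M0.hemi_raw_def M1.koszul_part_def M0.koszul_part_def M1.act_part_def M0.act_part_def push_def d_add
      additive_pick_sum[of d, OF d_add] additive_alt_sum[of d, OF d_add]
      additive_bracket_sum[of d, OF d_add] d_\<rho>)

lemma push_semi_raw: "M0.semi_raw (push f) k xs as = d (M1.semi_raw f k xs as)"
proof -
  have e: "push f k ys = (\<lambda>as. d (f k ys as))" for k ys by (simp add: push_def)
  show ?thesis
    by (simp add: M1.semi_raw_def M0.semi_raw_def M1.koszul_part_def M0.koszul_part_def M1.act_part_def M0.act_part_def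
      M1.bracket_part_def M0.bracket_part_def M1.mixed_part_def M0.mixed_part_def M1.ternary_part_def M0.ternary_part_def e d_add
      additive_pick_sum[of d, OF d_add] additive_alt_sum[of d, OF d_add] additive_alt_sum2[of d, OF d_add]
      additive_alt_sum3[of d, OF d_add] additive_der_sum[of d, OF d_add] d_\<rho>)
qed

lemma push_hemiD: "M0.hemiD N (push f) = push (M1.hemiD N f)"
  by (simp add: fun_eq_iff M0.hemiD_apply push_hemi_raw) (simp add: push_def M1.hemiD_apply d_simps)

lemma push_semiD: "M0.semiD N (push f) = push (M1.semiD N f)"
  by (simp add: fun_eq_iff M0.semiD_apply push_semi_raw) (simp add: push_def M1.semiD_apply d_simps)

lemma push_clifford: "M0.clifford x (push f) = push (M1.clifford x f)"
  by (simp add: fun_eq_iff M0.clifford_apply M1.clifford_apply push_def d_simps d_scale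
      additive_alt_sum[of d, OF d_add])

lemma push_wick: "M0.wick (push f) = push (M1.wick f)"
proof -
  have "M0.wick (push f) k xs as = d (M1.wick f k xs as)" for k xs as
  proof (induction xs arbitrary: f)
    case Nil
    show ?case by (simp add: push_def)
  qed (simp add: push_clifford)
  then show ?thesis by (simp add: fun_eq_iff push_def[of "M1.wick f"])
qed

lemma push_pullback: "M0.pullback (push_ce \<eta>) = push (M1.pullback \<eta>)"
  by (simp add: M0.pullback_def M1.pullback_def push_def push_ce_def fun_eq_iff d_simps)

lemma push_ce_closed: "\<eta> \<in> M1.ce N \<Longrightarrow> push_ce \<eta> \<in> M0.ce N"
  unfolding Hom_wedge_def push_ce_def linear_on_def by (auto simp: d_simps d_add d_scale)

definition shift_sign :: "int \<Rightarrow> 'k" where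
  "shift_sign n = (- 1) powi (n + 1)"

lemma shift_sign_step: "shift_sign N = - shift_sign (N - 1)"
  using power_int_add_1[of "- 1 :: 'k" N] by (simp add: shift_sign_def)

end

locale representation_complexes =
  leibniz_module_morphism s br "sclV1 V" "lact_0m V" "sclV0 V" "lact_00 V" "dV V"
  for s :: "'k::field_char_0 \<Rightarrow> 'g::ab_group_add \<Rightarrow> 'g" and br :: "'g \<Rightarrow> 'g \<Rightarrow> 'g"
    and V :: "('k, 'g, 'g, 'v::ab_group_add, 'w::ab_group_add) rep2"
begin

abbreviation dV_family :: "int \<Rightarrow> ('g, 'g, 'v) family \<Rightarrow> ('g, 'g, 'w) family" where
  "dV_family n f \<equiv> M0.scale_family (shift_sign n) (push f)"

abbreviation dV_ce :: "int \<Rightarrow> ('g set list \<Rightarrow> 'v) \<Rightarrow> 'g set list \<Rightarrow> 'w" where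
  "dV_ce n \<eta> \<equiv> M0.scale_ce (shift_sign n) (push_ce \<eta>)"

lemma push_linear: "linear_on A M1.scale_family M0.scale_family (dV_family n)"
  by (simp add: linear_on_def fun_eq_iff M0.scale_family_def M1.scale_family_def push_def d_add d_scale
      M0.V.scale_right_distrib mult.commute)

lemma push_ce_linear: "linear_on A M1.scale_ce M0.scale_ce (dV_ce n)"
  by (simp add: linear_on_def fun_eq_iff M0.scale_ce_def M1.scale_ce_def push_ce_def d_add d_scale
      M0.V.scale_right_distrib mult.commute)

lemma L_of_simps: "spc0 (L_of s br) = UNIV" "spc1 (L_of s br) = M1.K"
  by (simp_all add: L_of_def)

lemma G_of_simps: "spc0 (G_of s br) = UNIV" "spc1 (G_of s br) = M1.K"
  by (simp_all add: G_of_def L_of_def Let_def)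

lemma cochain_scale_eq:
  "cochain_scale V = (\<lambda>c \<omega>. (M1.scale_family c (fst \<omega>), M0.scale_family c (snd \<omega>)))"
  by (simp add: fun_eq_iff cochain_scale_def M1.scale_family_def M0.scale_family_def)

lemma hemi_two_term:
  "two_term_cochains (hemi_complex (L_of s br) V) M1.scale_family M0.scale_family M1.hemi M0.hemi
     M1.hemiD M0.hemiD dV_family"
proof (rule two_term_cochains.intro)
  fix f g n assume f: "f \<in> M1.hemi (n + 1)" and g: "g \<in> M0.hemi n"
  have T: "f \<in> M1.tensors (n + 1)" "g \<in> M0.tensors n" using f g M1.hemi_iff M0.hemi_iff by blast+
  show "cdiff (hemi_complex (L_of s br) V) n (f, g) = (M1.hemiD (n + 1) f, dV_family n f + M0.hemiD n g)"
  proof -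
    have 1: "(if multi_dom UNIV M1.K (n + 2 - 2 * int k) k xs as
        then hemi_diff_part (L_of s br) (sclV1 V) (lact_0m V) f k xs as else 0) = M1.hemiD (n + 1) f k xs as" for k xs as
      using M1.hemi_diff_part_eq[OF T(1), of as k xs] by (simp add: M1.hemiD_apply M1.dom_simps)
    have 2: "(if multi_dom UNIV M1.K (n + 1 - 2 * int k) k xs as
        then sclV0 V ((-1) powi (n + 1)) (dV V (f k xs as)) + hemi_diff_part (L_of s br) (sclV0 V) (lact_00 V) g k xs as
        else 0) = (dV_family n f + M0.hemiD n g) k xs as" for k xs as
      using M0.hemi_diff_part_eq[OF T(2), of as k xs] M1.domE[of "n + 1" k xs as f] T(1)
      by (auto simp: M0.hemiD_apply M1.dom_simps M0.scale_family_def push_def shift_sign_def d_simps)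
    show ?thesis
      unfolding hemi_complex_def hemi_diff_def L_of_simps cochain_complex.simps fst_conv snd_conv 1 2
      by (rule refl)
  qed
qed (auto simp: M1.vector_space_family M0.vector_space_family M1.subspace_hemi M0.subspace_hemi
    hemi_complex_def cochain_scale_eq hemi_cochains_def push_linear M1.hemiD_linear M0.hemiD_linear
    intro: M1.hemiD_hemi M0.hemiD_hemi push_hemi M0.hemi_scale)


lemma semi_two_term:
  "two_term_cochains (semi_complex (G_of s br) V) M1.scale_family M0.scale_family M1.semi M0.semi
     M1.semiD M0.semiD dV_family"
proof (rule two_term_cochains.intro)
  fix f g n assume f: "f \<in> M1.semi (n + 1)" and g: "g \<in> M0.semi n"
  have T: "f \<in> M1.tensors (n + 1)" using f M1.semi_iff by blast
  show "cdiff (semi_complex (G_of s br) V) n (f, g) = (M1.semiD (n + 1) f, dV_family n f + M0.semiD n g)"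
  proof -
    have 1: "(if multi_dom UNIV M1.K (n + 2 - 2 * int k) k xs as
        then semi_diff_part (G_of s br) (sclV1 V) (lact_0m V) f k xs as else 0) = M1.semiD (n + 1) f k xs as" for k xs as
      by (simp add: M1.semi_diff_part_eq M1.semiD_apply M1.dom_simps)
    have 2: "(if multi_dom UNIV M1.K (n + 1 - 2 * int k) k xs as
        then sclV0 V ((-1) powi (n + 1)) (dV V (f k xs as)) + semi_diff_part (G_of s br) (sclV0 V) (lact_00 V) g k xs as
        else 0) = (dV_family n f + M0.semiD n g) k xs as" for k xs as
      using M1.domE[of "n + 1" k xs as f] T
      by (auto simp: M0.semi_diff_part_eq M0.semiD_apply M1.dom_simps M0.scale_family_def push_def shift_sign_def d_simps)
    show ?thesis
      unfolding semi_complex_def semi_diff_def G_of_simps cochain_complex.simps fst_conv snd_conv 1 2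
      by (rule refl)
  qed
qed (auto simp: M1.vector_space_family M0.vector_space_family M1.subspace_semi M0.subspace_semi
    semi_complex_def cochain_scale_eq semi_cochains_def push_linear M1.semiD_linear M0.semiD_linear
    intro: M1.semiD_semi M0.semiD_semi push_semi M0.semi_scale)

lemma ce_scale_eq:
  "cscale (lie_ce_complex s br V) = (\<lambda>c \<omega>. (M1.scale_ce c (fst \<omega>), M0.scale_ce c (snd \<omega>)))"
  by (simp add: fun_eq_iff lie_ce_complex_def ce_complex_def M1.scale_ce_def M0.scale_ce_def)

lemma ce_space_eq: "cspace (lie_ce_complex s br V) n = M1.ce (n + 1) \<times> M0.ce n"
  by (simp add: lie_ce_complex_def ce_complex_def)

lemma ce_two_term:
  "two_term_cochains (lie_ce_complex s br V) M1.scale_ce M0.scale_ce M1.ce M0.ce M1.ceD M0.ceD dV_ce"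
proof (rule two_term_cochains.intro)
  fix f g n assume f: "f \<in> M1.ce (n + 1)" and g: "g \<in> M0.ce n"
  show "cdiff (lie_ce_complex s br V) n (f, g) = (M1.ceD (n + 1) f, dV_ce n f + M0.ceD n g)"
  proof -
    have 1: "(if int (length Xs) = n + 2 \<and> set Xs \<subseteq> M1.Q
        then ce_diff_part (lie_bracket s br) (sclV1 V) (coset_action (lact_0m V)) f Xs else 0) = M1.ceD (n + 1) f Xs" for Xs
      by (simp add: M1.ceD_def)
    have 2: "(if int (length Xs) = n + 1 \<and> set Xs \<subseteq> M1.Q
        then sclV0 V ((-1) powi (n + 1)) (dV V (f Xs)) + ce_diff_part (lie_bracket s br) (sclV0 V) (coset_action (lact_00 V)) g Xs
        else 0) = (dV_ce n f + M0.ceD n g) Xs" for Xs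
      using M1.ce_off[OF f, of Xs]
      by (auto simp: M0.ceD_def M0.scale_ce_def push_ce_def shift_sign_def d_simps)
    show ?thesis
      unfolding lie_ce_complex_def ce_complex_def cochain_complex.simps fst_conv snd_conv 1 2
      by (rule refl)
  qed
qed (auto simp: M1.vector_space_ce M0.vector_space_ce M1.subspace_ce M0.subspace_ce
    ce_scale_eq ce_space_eq
    push_ce_linear M1.ceD_linear M0.ceD_linear
    intro: M1.ceD_closed M0.ceD_closed push_ce_closed M0.ce_scale)

lemma semiD_push:
  "M0.semiD N (dV_family (N - 1) f) = - dV_family N (M1.semiD N f)"
  by (simp add: M0.semiD_scale push_semiD shift_sign_step[of N]) (simp add: M0.scale_family_def fun_eq_iff)

lemma hemiD_scale: "M0.hemiD N (M0.scale_family c f) = M0.scale_family c (M0.hemiD N f)"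
  by (simp add: fun_eq_iff M0.hemiD_apply M0.hemi_raw_scale) (simp add: M0.scale_family_def M0.hemiD_apply)

lemma hemiD_push:
  "M0.hemiD N (dV_family (N - 1) f) = - dV_family N (M1.hemiD N f)"
  by (simp add: hemiD_scale push_hemiD shift_sign_step[of N]) (simp add: M0.scale_family_def fun_eq_iff)

lemma hemi_semi: "cohomology_isomorphic (hemi_complex (L_of s br) V) (semi_complex (G_of s br) V)"
proof -
  interpret two_term_comparison
    "semi_complex (G_of s br) V" M1.scale_family M0.scale_family M1.semi M0.semi M1.semiD M0.semiD dV_family
    "hemi_complex (L_of s br) V" M1.scale_family M0.scale_family M1.hemi M0.hemi M1.hemiD M0.hemiD dV_family
    M1.wick M0.wick
  proof (rule two_term_comparison.intro[OF semi_two_term hemi_two_term], unfold_locales)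
    show "linear_on (M1.semi N) M1.scale_family M1.scale_family M1.wick" for N
      by (simp add: linear_on_def fun_eq_iff M1.wick_add M1.wick_scale) (simp add: M1.scale_family_def)
    show "linear_on (M0.semi N) M0.scale_family M0.scale_family M0.wick" for N
      by (simp add: linear_on_def fun_eq_iff M0.wick_add M0.wick_scale) (simp add: M0.scale_family_def)
    show "dV_family N (M1.wick f) = M0.wick (dV_family N f)" for N f
      by (simp add: fun_eq_iff M0.wick_scale push_wick) (simp add: M0.scale_family_def)
    show "\<exists>\<theta>\<in>M1.hemi (N - 1). u - M1.hemiD (N - 1) \<theta> \<in> M1.wick ` M1.semi N" if "u \<in> M1.hemi N" for u N
    proof (rule bexI[OF _ M1.hemi_zero])
      have "M1.hemiD (N - 1) 0 = 0" using M1.hemi_raw_diff[of 0 0] by (simp add: fun_eq_iff M1.hemiD_apply)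
      then show "u - M1.hemiD (N - 1) 0 \<in> M1.wick ` M1.semi N"
        using M1.wick_surjective[OF that] by (simp only: diff_zero) blast
    qed
    show "\<exists>\<theta>\<in>M0.hemi (N - 1). u - M0.hemiD (N - 1) \<theta> \<in> M0.wick ` M0.semi N" if "u \<in> M0.hemi N" for u N
    proof (rule bexI[OF _ M0.hemi_zero])
      have "M0.hemiD (N - 1) 0 = 0" using M0.hemi_raw_diff[of 0 0] by (simp add: fun_eq_iff M0.hemiD_apply)
      then show "u - M0.hemiD (N - 1) 0 \<in> M0.wick ` M0.semi N"
        using M0.wick_surjective[OF that] by (simp only: diff_zero) blast
    qed
  qed (rule M1.wick_hemi M0.wick_hemi M1.wick_inj_on M0.wick_inj_on M1.hemiD_wick M0.hemiD_wick
      M1.hemiD_hemiD M0.hemiD_hemiD hemiD_push; assumption?)+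
  show ?thesis by (rule cohomology_isomorphic)
qed

lemma semi_ce: "cohomology_isomorphic (semi_complex (G_of s br) V) (lie_ce_complex s br V)"
proof -
  interpret two_term_comparison
    "lie_ce_complex s br V" M1.scale_ce M0.scale_ce M1.ce M0.ce M1.ceD M0.ceD dV_ce
    "semi_complex (G_of s br) V" M1.scale_family M0.scale_family M1.semi M0.semi M1.semiD M0.semiD dV_family
    M1.pullback M0.pullback
  proof (rule two_term_comparison.intro[OF ce_two_term semi_two_term], unfold_locales)
    show "linear_on (M1.ce N) M1.scale_ce M1.scale_family M1.pullback" for N
      by (simp add: linear_on_def M1.pullback_add M1.pullback_scale)
    show "linear_on (M0.ce N) M0.scale_ce M0.scale_family M0.pullback" for N
      by (simp add: linear_on_def M0.pullback_add M0.pullback_scale)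
    show "M1.pullback f \<in> M1.semi N" if "f \<in> M1.ce N" for f N
      using M1.pullback_basic[OF that] by (simp add: M1.basic_def)
    show "M0.pullback f \<in> M0.semi N" if "f \<in> M0.ce N" for f N
      using M0.pullback_basic[OF that] by (simp add: M0.basic_def)
    show "dV_family N (M1.pullback f) = M0.pullback (dV_ce N f)" for N f
      by (simp add: M0.pullback_scale push_pullback)
    show "\<exists>\<theta>\<in>M1.semi (N - 1). u - M1.semiD (N - 1) \<theta> \<in> M1.pullback ` M1.ce N"
      if u: "u \<in> M1.semi N" "M1.semiD N u \<in> M1.pullback ` M1.ce (N + 1)" for u N
    proof -
      have "M1.semiD N u \<in> M1.basic (N + 1)" using u(2) M1.pullback_basic by auto
      then obtain \<theta> where \<theta>: "\<theta> \<in> M1.semi (N - 1)" "u - M1.semiD (N - 1) \<theta> \<in> M1.basic N"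
        using M1.cohomologous_to_basic[OF u(1)] by blast
      obtain \<eta> where "\<eta> \<in> M1.ce N" "M1.pullback \<eta> = u - M1.semiD (N - 1) \<theta>"
        using M1.basic_descends[OF \<theta>(2)] by blast
      then show ?thesis using \<theta>(1) by (metis imageI)
    qed
    show "\<exists>\<theta>\<in>M0.semi (N - 1). u - M0.semiD (N - 1) \<theta> \<in> M0.pullback ` M0.ce N"
      if u: "u \<in> M0.semi N" "M0.semiD N u \<in> M0.pullback ` M0.ce (N + 1)" for u N
    proof -
      have "M0.semiD N u \<in> M0.basic (N + 1)" using u(2) M0.pullback_basic by auto
      then obtain \<theta> where \<theta>: "\<theta> \<in> M0.semi (N - 1)" "u - M0.semiD (N - 1) \<theta> \<in> M0.basic N"
        using M0.cohomologous_to_basic[OF u(1)] by blast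
      obtain \<eta> where "\<eta> \<in> M0.ce N" "M0.pullback \<eta> = u - M0.semiD (N - 1) \<theta>"
        using M0.basic_descends[OF \<theta>(2)] by blast
      then show ?thesis using \<theta>(1) by (metis imageI)
    qed
  qed (rule M1.pullback_inj_on M0.pullback_inj_on M1.semiD_pullback M0.semiD_pullback
      M1.semiD_semiD M0.semiD_semiD semiD_push; assumption?)+
  show ?thesis by (rule cohomology_isomorphic)
qed

end

text \<open>
  The action of \<open>\<alpha> \<in> K\<close> on \<open>V\<^sup>0\<close> and on \<open>V\<^sup>-\<^sup>1\<close> is \<open>d l\<^sub>\<alpha>\<close> and \<open>l\<^sub>\<alpha> d\<close>, so both vanish.
\<close>

lemma representation_complexesI:
  fixes s :: "'k::field_char_0 \<Rightarrow> 'g::ab_group_add \<Rightarrow> 'g"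
    and V :: "('k, 'g, 'g, 'v::ab_group_add, 'w::ab_group_add) rep2"
  assumes "leibniz_algebra s br" and "hemistrict_rep (L_of s br) V"
    and van: "\<forall>\<alpha>\<in>spc1 (L_of s br). \<forall>u. lact_m0 V \<alpha> u = 0"
  shows "representation_complexes s br V"
proof -
  interpret A: leibniz_algebra s br by (rule assms(1))
  interpret R: hemistrict_rep "L_of s br" V by (rule assms(2))
  interpret d: Vector_Spaces.linear "sclV1 V" "sclV0 V" "dV V" by (rule R.dV_linear)
  have L: "spc0 (L_of s br) = UNIV" "spc1 (L_of s br) = leibniz_kernel s br" "scl0 (L_of s br) = s"
    "br_00 (L_of s br) = br" "dL (L_of s br) = (\<lambda>\<alpha>. \<alpha>)"
    by (simp_all add: L_of_def)
  show ?thesis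
  proof unfold_locales
    fix x y u v c
    show "lact_0m V (x + y) v = lact_0m V x v + lact_0m V y v" "lact_0m V (s c x) v = sclV1 V c (lact_0m V x v)"
      "lact_0m V x (v + v') = lact_0m V x v + lact_0m V x v'" "lact_0m V x (sclV1 V c v) = sclV1 V c (lact_0m V x v)" for v'
      using R.bil_l0m by (simp_all add: L bilinear_on_def linear_on_def)
    show "lact_00 V (x + y) u = lact_00 V x u + lact_00 V y u" "lact_00 V (s c x) u = sclV0 V c (lact_00 V x u)"
      "lact_00 V x (u + u') = lact_00 V x u + lact_00 V x u'" "lact_00 V x (sclV0 V c u) = sclV0 V c (lact_00 V x u)" for u'
      using R.bil_l00 by (simp_all add: L bilinear_on_def linear_on_def)
    show "lact_0m V (br x y) v = lact_0m V x (lact_0m V y v) - lact_0m V y (lact_0m V x v)"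
      using R.l_br_00_m[of x y v] by (simp add: L)
    show "lact_00 V (br x y) u = lact_00 V x (lact_00 V y u) - lact_00 V y (lact_00 V x u)"
      using R.l_br_00_0[of x y u] by (simp add: L)
    show "lact_0m V \<alpha> v = 0" if "\<alpha> \<in> leibniz_kernel s br" for \<alpha>
      using R.d_lmm[of \<alpha> v] van that by (simp add: L)
    show "lact_00 V \<alpha> u = 0" if "\<alpha> \<in> leibniz_kernel s br" for \<alpha>
      using R.d_lm0[of \<alpha> u] van that by (simp add: L d.zero)
    show "dV V (lact_0m V x v) = lact_00 V x (dV V v)"
      using R.d_l0m[of x v] by (simp add: L)
  qed (simp_all add: d.add d.scale)
qed

theorem theorem4p12:
  fixes s :: "'k::real_normed_field \<Rightarrow> 'g::ab_group_add \<Rightarrow> 'g"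
    and br :: "'g \<Rightarrow> 'g \<Rightarrow> 'g"
    and V :: "('k, 'g, 'g, 'v::ab_group_add, 'w::ab_group_add) rep2"
  assumes "leibniz_algebra s br"
    and "hemistrict_rep (L_of s br) V"
    and "\<forall>\<alpha>\<in>spc1 (L_of s br). \<forall>u. lact_m0 V \<alpha> u = 0"
  shows "cohomology_isomorphic (hemi_complex (L_of s br) V) (semi_complex (G_of s br) V) \<and>
         cohomology_isomorphic (semi_complex (G_of s br) V) (lie_ce_complex s br V)"
proof -
  interpret representation_complexes s br V
    by (rule representation_complexesI[OF assms])
  show ?thesis using hemi_semi semi_ce by blast
qed

end
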